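(* Let $a,b,\sigma_L,\sigma_R>0$ and let $\alpha_1,\alpha_3$ be nonzero constants. Let $(u^L,u^R)$ be the solution (in the sense of the context) of $$u^L_t=\sigma_L^2u^L_{xx}\ (-a<x<0,\ t>0),\qquad u^R_t=\sigma_R^2u^R_{xx}\ (0<x<b,\ t>0),$$ $$u^L(x,0)=u_0^L(x)\ (-a<x<0),\qquad u^R(x,0)=u_0^R(x)\ (0<x<b),$$ $$\alpha_1u^L(-a,t)=f^L(t),\qquad \alpha_3u^R(b,t)=f^R(t)\qquad(t>0),$$ $$u^L(0,t)=u^R(0,t),\qquad \sigma_L^2u_x^L(0,t)=\sigma_R^2u_x^R(0,t)\qquad(t>0).$$ Then, for $-a<x<0$, $t>0$, writing $p=e^{ika}$, $q=e^{ikb\sigma_L/\sigma_R}$ and $E=e^{ikx-(\sigma_Lk)^2t}$, $$\begin{aligned}u^L(x,t)=\;&\frac1{2\pi}\int_{-\infty}^\infty E\,\hat u_0^L(k)\,dk+\int_{\partial D_0^-}\frac{E}{\Delta_L(k)}\Big\{\mathcal{K}(k)+\tfrac12\big[-(\sigma_L+\sigma_R)+q^2(\sigma_L-\sigma_R)\big]\hat u_0^L(k)\Big\}dk\\&+\int_{\partial D_0^+}\frac{E}{\Delta_L(k)}\Big\{\mathcal{K}(k)+\tfrac12\big[-p^2(\sigma_R-\sigma_L)-p^2q^2(\sigma_L+\sigma_R)\big]\hat u_0^L(k)\Big\}dk,\end{aligned}$$ where $$\begin{aligned}\mathcal{K}(k)=\;&-\frac{2ik\sigma_L^2\sigma_R\,p^2q}{\alpha_3}\hat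 f^R((\sigma_Lk)^2,t)+\frac{ik\sigma_L^2\,p\,[(\sigma_L+\sigma_R)-q^2(\sigma_L-\sigma_R)]}{\alpha_1}\hat f^L((\sigma_Lk)^2,t)\\&+\tfrac12p^2\big[(\sigma_L+\sigma_R)+q^2(\sigma_R-\sigma_L)\big]\hat u_0^L(-k)-\sigma_Lp^2q^2\,\hat u_0^R(k\sigma_L/\sigma_R)+\sigma_Lp^2\,\hat u_0^R(-k\sigma_L/\sigma_R);\end{aligned}$$ and, for $0<x<b$, $t>0$, writing $P=e^{ika\sigma_R/\sigma_L}$, $Q=e^{ikb}$ and $F=e^{ikx-(\sigma_Rk)^2t}$, $$\begin{aligned}u^R(x,t)=\;&\frac1{2\pi}\int_{-\infty}^\infty F\,\hat u_0^R(k)\,dk+\int_{\partial D_0^-}\frac{F}{\Delta_R(k)}\Big\{\mathcal{M}(k)+\tfrac12\big[-(\sigma_L+\sigma_R)+P^2(\sigma_R-\sigma_L)\big]\hat u_0^R(k)\Big\}dk\\&+\int_{\partial D_0^+}\frac{F}{\Delta_R(k)}\Big\{\mathcal{M}(k)+\tfrac12\big[-Q^2(\sigma_L-\sigma_R)-P^2Q^2(\sigma_L+\sigma_R)\big]\hat u_0^R(k)\Big\}dk,\end{aligned}$$ where $$\begin{aligned}\mathcal{M}(k)=\;&\frac{2ik\sigma_L\sigma_R^2\,P}{\alpha_1}\hat f^L((\sigma_Rk)^2,t)-\frac{ik\sigma_R^2\,Q\,[(\sigma_L-\sigma_R)+P^2(\sigma_L+\sigma_R)]}{\alpha_3}\hat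 f^R((\sigma_Rk)^2,t)\\&-\sigma_R\,\hat u_0^L(k\sigma_R/\sigma_L)+\sigma_RP^2\,\hat u_0^L(-k\sigma_R/\sigma_L)+\tfrac12\big[(\sigma_L-\sigma_R)+P^2(\sigma_L+\sigma_R)\big]\hat u_0^R(-k).\end{aligned}$$
   Context: Notation: for $k,\omega\in\mathbb{C}$, $$\hat u_0^L(k)=\int_{-a}^0e^{-ikx}u_0^L(x)\,dx,\qquad \hat u_0^R(k)=\int_0^be^{-ikx}u_0^R(x)\,dx,$$ $$\hat f^L(\omega,t)=\int_0^te^{\omega s}f^L(s)\,ds,\qquad \hat f^R(\omega,t)=\int_0^te^{\omega s}f^R(s)\,ds,$$ $$\Delta_L(k)=\pi\Big(\sigma_L(e^{2iak}+1)(e^{2ibk\sigma_L/\sigma_R}-1)+\sigma_R(e^{2iak}-1)(e^{2ibk\sigma_L/\sigma_R}+1)\Big),\qquad \Delta_R(k)=\Delta_L(k\sigma_R/\sigma_L).$$ Contours: $D=\{k\in\mathbb{C}:\operatorname{Re}(k^2)<0\}=D^+\cup D^-$, where $D^\pm$ are the parts of $D$ in the upper/lower half-plane. $D_0^\pm$ is $D^\pm$ deformed so that its boundary avoids $k=0$: $D_0^\pm=\{k\in D^\pm:|k|>r\}$ for some fixed $r>0$. Boundaries are oriented with the region on the left: $\partial D_0^+$ runs from $\infty e^{3\pi i/4}$ to $\infty e^{i\pi/4}$, and $\partial D_0^-$ runs from $\infty e^{-i\pi/4}$ to $\infty e^{-3\pi i/4}$. Standing regularity conventions: $u_0^L,u_0^R$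 are integrable. A solution is a classical one: for $t>0$, $u^L$ (resp. $u^R$) is $C^1$ in $t$ and $C^2$ in $x$ in the open domain, $u$ and $u_x$ extend continuously to the endpoints of the $x$-interval, their endpoint values are integrable in time on $(0,T)$ for every $T>0$, and $t\mapsto u(\cdot,t)$ is continuous from $[0,\infty)$ into $L^1$ (so that the initial condition is attained). *)

theory Defs
  imports "HOL-Complex_Analysis.Complex_Analysis"
begin

text \<open>
  Classical solutions \<open>u x t\<close> of \<open>u_t = \<sigma>^2 u_xx\<close> on \<open>(lo,hi) \<times> (0,\<infinity>)\<close>. The argument \<open>ux\<close> is the
  spatial derivative of \<open>u\<close> inside the interval. The values of \<open>u\<close> and \<open>ux\<close> at \<open>lo\<close> and \<open>hi\<close> are
  those of the continuous extensions, and are therefore uniquely determined for \<open>t > 0\<close>.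
\<close>

definition classical_heat_solution ::
  "real \<Rightarrow> real \<Rightarrow> real \<Rightarrow> (real \<Rightarrow> real \<Rightarrow> complex) \<Rightarrow> (real \<Rightarrow> real \<Rightarrow> complex) \<Rightarrow> bool" where
  "classical_heat_solution \<sigma> lo hi u ux \<longleftrightarrow>
    (\<exists>ut uxx.
      (\<forall>x\<in>{lo<..<hi}. \<forall>t>0.
        ((\<lambda>s. u x s) has_vector_derivative ut x t) (at t) \<and>
        ((\<lambda>y. u y t) has_vector_derivative ux x t) (at x) \<and>
        ((\<lambda>y. ux y t) has_vector_derivative uxx x t) (at x) \<and>
        ut x t = of_real (\<sigma>\<^sup>2) * uxx x t) \<and>
      continuous_on ({lo<..<hi} \<times> {0<..}) (\<lambda>(x, t). ut x t) \<and>
      continuous_on ({lo<..<hi} \<times> {0<..}) (\<lambda>(x, t). uxx x t)) \<and>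
    continuous_on ({lo..hi} \<times> {0<..}) (\<lambda>(x, t). u x t) \<and>
    continuous_on ({lo..hi} \<times> {0<..}) (\<lambda>(x, t). ux x t) \<and>
    (\<forall>T>0. \<forall>y\<in>{lo, hi}.
      (\<lambda>t. u y t) absolutely_integrable_on {0<..<T} \<and>
      (\<lambda>t. ux y t) absolutely_integrable_on {0<..<T}) \<and>
    (\<forall>t\<ge>0. (\<lambda>x. u x t) absolutely_integrable_on {lo..hi}) \<and>
    (\<forall>t\<ge>0. ((\<lambda>s. integral {lo..hi} (\<lambda>x. norm (u x s - u x t))) \<longlongrightarrow> 0) (at t within {0..}))"

definition fourier_hat :: "real \<Rightarrow> real \<Rightarrow> (real \<Rightarrow> complex) \<Rightarrow> complex \<Rightarrow> complex" where
  "fourier_hat lo hi v k = integral {lo..hi} (\<lambda>x. exp (- \<i> * k * of_real x) * v x)"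

definition time_hat :: "(real \<Rightarrow> complex) \<Rightarrow> complex \<Rightarrow> real \<Rightarrow> complex" where
  "time_hat f \<omega> t = integral {0..t} (\<lambda>s. exp (\<omega> * of_real s) * f s)"

definition Delta_L :: "real \<Rightarrow> real \<Rightarrow> real \<Rightarrow> real \<Rightarrow> complex \<Rightarrow> complex" where
  "Delta_L a b \<sigma>L \<sigma>R k = of_real pi *
    (of_real \<sigma>L * (exp (2 * \<i> * of_real a * k) + 1)
       * (exp (2 * \<i> * of_real b * k * of_real (\<sigma>L / \<sigma>R)) - 1)
     + of_real \<sigma>R * (exp (2 * \<i> * of_real a * k) - 1)
       * (exp (2 * \<i> * of_real b * k * of_real (\<sigma>L / \<sigma>R)) + 1))"

definition Delta_R :: "real \<Rightarrow> real \<Rightarrow> real \<Rightarrow> real \<Rightarrow> complex \<Rightarrow> complex" where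
  "Delta_R a b \<sigma>L \<sigma>R k = Delta_L a b \<sigma>L \<sigma>R (k * of_real (\<sigma>R / \<sigma>L))"

text \<open>
  Integration over the contour that comes in from \<open>\<infinity>\<close> along the ray of argument \<open>\<theta>\<close> down to
  modulus \<open>r\<close>, follows the arc of radius \<open>r\<close> from argument \<open>\<theta>\<close> to argument \<open>\<phi>\<close>, and goes out to
  \<open>\<infinity>\<close> along the ray of argument \<open>\<phi>\<close>. The two rays are integrated absolutely.
\<close>

definition sector_contour_integrable :: "real \<Rightarrow> real \<Rightarrow> real \<Rightarrow> (complex \<Rightarrow> complex) \<Rightarrow> bool" where
  "sector_contour_integrable r \<theta> \<phi> g \<longleftrightarrow>
    (\<lambda>s. g (of_real s * cis \<theta>)) absolutely_integrable_on {r..} \<and>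
    g contour_integrable_on part_circlepath 0 r \<theta> \<phi> \<and>
    (\<lambda>s. g (of_real s * cis \<phi>)) absolutely_integrable_on {r..}"

definition sector_contour_integral :: "real \<Rightarrow> real \<Rightarrow> real \<Rightarrow> (complex \<Rightarrow> complex) \<Rightarrow> complex" where
  "sector_contour_integral r \<theta> \<phi> g =
    - cis \<theta> * integral {r..} (\<lambda>s. g (of_real s * cis \<theta>))
    + contour_integral (part_circlepath 0 r \<theta> \<phi>) g
    + cis \<phi> * integral {r..} (\<lambda>s. g (of_real s * cis \<phi>))"

text \<open>
  The boundaries of \<open>{k. Re (k^2) < 0 \<and> Im k > 0 \<and> norm k > r}\<close> and of
  \<open>{k. Re (k^2) < 0 \<and> Im k < 0 \<and> norm k > r}\<close>, with the region on the left.
\<close>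

abbreviation D0_plus_integrable :: "real \<Rightarrow> (complex \<Rightarrow> complex) \<Rightarrow> bool" where
  "D0_plus_integrable r \<equiv> sector_contour_integrable r (3 * pi / 4) (pi / 4)"

abbreviation D0_plus_integral :: "real \<Rightarrow> (complex \<Rightarrow> complex) \<Rightarrow> complex" where
  "D0_plus_integral r \<equiv> sector_contour_integral r (3 * pi / 4) (pi / 4)"

abbreviation D0_minus_integrable :: "real \<Rightarrow> (complex \<Rightarrow> complex) \<Rightarrow> bool" where
  "D0_minus_integrable r \<equiv> sector_contour_integrable r (- pi / 4) (- 3 * pi / 4)"

abbreviation D0_minus_integral :: "real \<Rightarrow> (complex \<Rightarrow> complex) \<Rightarrow> complex" where
  "D0_minus_integral r \<equiv> sector_contour_integral r (- pi / 4) (- 3 * pi / 4)"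

definition calK ::
  "real \<Rightarrow> real \<Rightarrow> real \<Rightarrow> real \<Rightarrow> complex \<Rightarrow> complex \<Rightarrow>
   (real \<Rightarrow> complex) \<Rightarrow> (real \<Rightarrow> complex) \<Rightarrow> (real \<Rightarrow> complex) \<Rightarrow> (real \<Rightarrow> complex) \<Rightarrow>
   real \<Rightarrow> complex \<Rightarrow> complex" where
  "calK a b \<sigma>L \<sigma>R \<alpha>1 \<alpha>3 fL fR u0L u0R t k =
    (let p = exp (\<i> * k * of_real a);
         q = exp (\<i> * k * of_real (b * \<sigma>L / \<sigma>R));
         sL = complex_of_real \<sigma>L;
         sR = complex_of_real \<sigma>R
     in - (2 * \<i> * k * sL\<^sup>2 * sR * p\<^sup>2 * q / \<alpha>3) * time_hat fR ((sL * k)\<^sup>2) t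
        + \<i> * k * sL\<^sup>2 * p * ((sL + sR) - q\<^sup>2 * (sL - sR)) / \<alpha>1 * time_hat fL ((sL * k)\<^sup>2) t
        + 1 / 2 * p\<^sup>2 * ((sL + sR) + q\<^sup>2 * (sR - sL)) * fourier_hat (- a) 0 u0L (- k)
        - sL * p\<^sup>2 * q\<^sup>2 * fourier_hat 0 b u0R (k * sL / sR)
        + sL * p\<^sup>2 * fourier_hat 0 b u0R (- k * sL / sR))"

definition calM ::
  "real \<Rightarrow> real \<Rightarrow> real \<Rightarrow> real \<Rightarrow> complex \<Rightarrow> complex \<Rightarrow>
   (real \<Rightarrow> complex) \<Rightarrow> (real \<Rightarrow> complex) \<Rightarrow> (real \<Rightarrow> complex) \<Rightarrow> (real \<Rightarrow> complex) \<Rightarrow>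
   real \<Rightarrow> complex \<Rightarrow> complex" where
  "calM a b \<sigma>L \<sigma>R \<alpha>1 \<alpha>3 fL fR u0L u0R t k =
    (let P = exp (\<i> * k * of_real (a * \<sigma>R / \<sigma>L));
         Q = exp (\<i> * k * of_real b);
         sL = complex_of_real \<sigma>L;
         sR = complex_of_real \<sigma>R
     in 2 * \<i> * k * sL * sR\<^sup>2 * P / \<alpha>1 * time_hat fL ((sR * k)\<^sup>2) t
        - \<i> * k * sR\<^sup>2 * Q * ((sL - sR) + P\<^sup>2 * (sL + sR)) / \<alpha>3 * time_hat fR ((sR * k)\<^sup>2) t
        - sR * fourier_hat (- a) 0 u0L (k * sR / sL)
        + sR * P\<^sup>2 * fourier_hat (- a) 0 u0L (- k * sR / sL)
        + 1 / 2 * ((sL - sR) + P\<^sup>2 * (sL + sR)) * fourier_hat 0 b u0R (- k))"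

end

theory Submission
  imports Defs "HOL-Probability.Characteristic_Functions" "HOL-Real_Asymp.Real_Asymp"
begin

text \<open>
  Integrating the heat equation against \<open>exp (- \<i> k y + (\<sigma> k)\<^sup>2 s)\<close> over the space-time strip gives the
  global relation between the Fourier transforms of \<open>u\<close> at times \<open>0\<close> and \<open>t\<close> and the time transforms
  of the boundary values. Insert it into the Fourier inversion formula at time \<open>t\<close>, regularised by a
  Gaussian factor \<open>exp (- (\<delta> k)\<^sup>2 / 2)\<close>: on \<open>Re (k\<^sup>2) \<ge> 0\<close> the terms from the right and left endpoints decay
  in the lower and upper half plane, so they can be moved to the boundaries of \<open>D0_minus\<close> and
  \<open>D0_plus\<close>, where the factor has modulus one on the rays and \<open>\<delta>\<close> can be sent to \<open>0\<close>.
  The global relations of both layers at \<open>\<plusminus>k\<close> are four linear equations that express the unknown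
  boundary transforms through the data and the transforms of the solution at time \<open>t\<close>. The
  contribution of the latter is holomorphic and exponentially small in \<open>D0_minus\<close> and \<open>D0_plus\<close>, so
  that it integrates to \<open>0\<close>. All zeros of the denominator are real, hence off the contours.
\<close>

section \<open>Exponential transforms\<close>

text \<open>The obstacle is missing decay on the real line. \<open>u x t\<close> need not vanish at
  the endpoints, so its transform need not be absolutely integrable, and the boundary terms are
  controlled there only by a multiple of \<open>1 + norm k\<close>. The Gaussian supplies decay near
  the real axis; towards the rays the exponential of the distance from \<open>x\<close> to the
  endpoint takes over. Inside \<open>Re (k^2) < 0\<close> the Gaussian grows, so the deformation has
  to stop at the rays. The brackets in the formula come from the elimination: each is the
  combination of global relations that isolates the boundary term of one endpoint, multiplied by
  Delta. Since the brackets are linear in the data, the part due to time \<open>t\<close> is the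
  same bracket with the solution at time \<open>t\<close> as initial data and zero boundary data.
  The global relation attaches \<open>exp (\<omega> * t)\<close> to it, which cancels the time
  factor of the integrand, and this factor is what grows in \<open>D\<close>. Delta vanishes at
  \<open>k = 0\<close>, whence the radius \<open>r\<close>. In the remaining region
  \<open>\<bar>Im k\<bar>\<close> is at least \<open>norm k / 2\<close>, hence at least
  \<open>r / 2\<close>, so it suffices to bound Delta from below on half planes away from the real
  axis.\<close>

lemma absolutely_integrable_continuous_mult:
  fixes f g :: "real \<Rightarrow> complex"
  assumes "continuous_on {l..h} f" "g absolutely_integrable_on {l..h}"
  shows "(\<lambda>x. f x * g x) absolutely_integrable_on {l..h}"
proof (rule absolutely_integrable_bounded_measurable_product[OF bilinear_times])
  show "f \<in> borel_measurable (lebesgue_on {l..h})"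
    using assms(1) by (intro continuous_imp_measurable_on_sets_lebesgue) auto
  show "bounded (f ` {l..h})"
    using assms(1) by (intro compact_imp_bounded compact_continuous_image) auto
qed (use assms in auto)

lemma exp_integral_norm_le:
  fixes g :: "real \<Rightarrow> complex"
  assumes g: "g absolutely_integrable_on {l..h}"
    and m: "\<And>s. s \<in> {l..h} \<Longrightarrow> Re (z * of_real s) \<le> m"
  shows "norm (integral {l..h} (\<lambda>s. exp (z * of_real s) * g s))
    \<le> exp m * integral {l..h} (\<lambda>s. norm (g s))"
proof -
  have i: "(\<lambda>s. exp (z * of_real s) * g s) absolutely_integrable_on {l..h}"
    by (intro absolutely_integrable_continuous_mult g continuous_intros)
  have "norm (integral {l..h} (\<lambda>s. exp (z * of_real s) * g s))
      \<le> integral {l..h} (\<lambda>s. exp m * norm (g s))"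
  proof (rule integral_norm_bound_integral)
    show "(\<lambda>s. exp m * norm (g s)) integrable_on {l..h}"
      using g by (intro integrable_on_mult_right) (auto simp: absolutely_integrable_on_def)
    fix s assume "s \<in> {l..h}"
    then show "norm (exp (z * of_real s) * g s) \<le> exp m * norm (g s)"
      using m by (auto simp: norm_mult intro!: mult_right_mono)
  qed (use i in \<open>auto simp: absolutely_integrable_on_def\<close>)
  then show ?thesis by simp
qed

text \<open>Differentiation under the integral sign for a merely integrable \<open>g\<close>: the
  difference quotients converge pointwise, and the mean value inequality bounds them by a constant
  times \<open>norm (g s)\<close>. Holomorphy of all space and time transforms rests on
  this.\<close>

lemma exp_integral_has_derivative:
  fixes g :: "real \<Rightarrow> complex"
  assumes g: "g absolutely_integrable_on {l..h}"
  shows "((\<lambda>z. integral {l..h} (\<lambda>s. exp (z * of_real s) * g s)) has_field_derivative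
    integral {l..h} (\<lambda>s. of_real s * exp (z * of_real s) * g s)) (at z)"
proof -
  let ?F = "\<lambda>z. integral {l..h} (\<lambda>s. exp (z * of_real s) * g s)"
  let ?q = "\<lambda>w s. (exp ((z + w) * of_real s) - exp (z * of_real s)) / w * g s"
  have "(x - y) / w * v = (x * v - y * v) * (1 / w)" for x y w v :: complex
    by (simp add: field_simps)
  then have q_eq: "?q w = (\<lambda>s. (exp ((z + w) * of_real s) * g s - exp (z * of_real s) * g s) * (1 / w))" for w
    by blast
  define M where "M = max \<bar>l\<bar> \<bar>h\<bar>"
  have M: "\<bar>s\<bar> \<le> M" if "s \<in> {l..h}" for s using that by (auto simp: M_def)
  have int: "(\<lambda>s. exp (w * of_real s) * g s) integrable_on {l..h}" for w
    by (intro set_lebesgue_integral_eq_integral(1) absolutely_integrable_continuous_mult g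
        continuous_intros)
  show ?thesis
    unfolding DERIV_def tendsto_at_iff_sequentially comp_def
  proof (intro allI impI)
    fix X :: "nat \<Rightarrow> complex"
    assume X: "\<forall>i. X i \<in> UNIV - {0}" and X0: "X \<longlonglongrightarrow> 0"
    obtain B where B: "\<And>n. norm (X n) \<le> B" and "B \<ge> 0"
    proof -
      have "Bseq X" using X0 convergentI convergent_imp_Bseq by blast
      then show thesis using that BseqE less_imp_le by metis
    qed
    \<comment> \<open>Bounds the derivative \<open>of_real s * exp (w * of_real s)\<close> for every
      \<open>w\<close> within distance \<open>B\<close> of \<open>z\<close> and every
      \<open>s\<close> in the interval, hence every difference quotient independently of
      \<open>n\<close>.\<close>
    define C where "C = M * exp ((norm z + B) * M)"
    have bound: "norm (?q (X n) s) \<le> C * norm (g s)" if s: "s \<in> {l..h}" for n s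
    proof -
      have "norm (exp ((z + X n) * of_real s) - exp (z * of_real s)) \<le> C * norm ((z + X n) - z)"
      proof (rule field_differentiable_bound[of "cball z B" "\<lambda>z. exp (z * of_real s)"
            "\<lambda>z. of_real s * exp (z * of_real s)"])
        fix w assume w: "w \<in> cball z B"
        have "norm w \<le> norm z + B"
          using w norm_triangle_ineq2[of w z] by (auto simp: dist_norm norm_minus_commute)
        then have "norm w * \<bar>s\<bar> \<le> (norm z + B) * M"
          using M[OF s] \<open>B \<ge> 0\<close> by (intro mult_mono) auto
        then have "Re (w * of_real s) \<le> (norm z + B) * M"
          using complex_Re_le_cmod[of "w * of_real s"] unfolding norm_mult norm_of_real by linarith
        moreover have "0 \<le> M" using M[OF s] by linarith
        ultimately show "norm (of_real s * exp (w * of_real s)) \<le> C"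
          using M[OF s] unfolding norm_mult C_def norm_exp_eq_Re norm_of_real by (intro mult_mono) simp_all
        show "((\<lambda>z. exp (z * of_real s)) has_field_derivative of_real s * exp (w * of_real s))
            (at w within cball z B)"
          by (auto intro!: derivative_eq_intros)
      qed (use B \<open>B \<ge> 0\<close> in \<open>auto simp: dist_norm\<close>)
      then have "norm ((exp ((z + X n) * of_real s) - exp (z * of_real s)) / X n) \<le> C"
        using X by (simp add: norm_divide divide_simps)
      then show ?thesis unfolding norm_mult[of _ "g s"] by (rule mult_right_mono) simp
    qed
    have "(\<lambda>n. integral {l..h} (?q (X n)))
        \<longlonglongrightarrow> integral {l..h} (\<lambda>s. of_real s * exp (z * of_real s) * g s)"
    proof (rule dominated_convergence(2)[where h = "\<lambda>s. C * norm (g s)"])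
      fix n
      have "(\<lambda>s. (exp ((z + X n) * of_real s) * g s - exp (z * of_real s) * g s) * (1 / X n))
          integrable_on {l..h}"
        by (intro integrable_on_mult_left integrable_diff int)
      then show "?q (X n) integrable_on {l..h}"
        unfolding q_eq .
    next
      show "(\<lambda>s. C * norm (g s)) integrable_on {l..h}"
        using g by (intro integrable_on_mult_right) (auto simp: absolutely_integrable_on_def)
    next
      fix s assume "s \<in> {l..h}"
      have "((\<lambda>z. exp (z * of_real s)) has_field_derivative of_real s * exp (z * of_real s)) (at z)"
        by (auto intro!: derivative_eq_intros)
      then have "(\<lambda>n. (exp ((z + X n) * of_real s) - exp (z * of_real s)) / X n)
          \<longlonglongrightarrow> of_real s * exp (z * of_real s)"
        unfolding DERIV_def tendsto_at_iff_sequentially comp_def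
        by (rule spec[of _ X, THEN mp, THEN mp]) (use X X0 in simp_all)
      then show "(\<lambda>n. ?q (X n) s) \<longlonglongrightarrow> of_real s * exp (z * of_real s) * g s"
        by (intro tendsto_mult tendsto_const)
    qed (use bound in auto)
    moreover have "integral {l..h} (?q (X n)) = (?F (z + X n) - ?F z) / X n" for n
    proof -
      have "integral {l..h} (?q (X n))
          = integral {l..h} (\<lambda>s. (exp ((z + X n) * of_real s) * g s - exp (z * of_real s) * g s) * (1 / X n))"
        unfolding q_eq ..
      also have "\<dots> = (?F (z + X n) - ?F z) * (1 / X n)"
        by (subst integral_mult_left) (simp add: integral_diff int)
      finally show ?thesis by simp
    qed
    ultimately show "(\<lambda>n. (?F (z + X n) - ?F z) / X n)
        \<longlonglongrightarrow> integral {l..h} (\<lambda>s. of_real s * exp (z * of_real s) * g s)"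
      by (simp only:)
  qed
qed

lemma exp_integral_holomorphic:
  fixes g :: "real \<Rightarrow> complex"
  assumes "g absolutely_integrable_on {l..h}" "c holomorphic_on S"
  shows "(\<lambda>k. integral {l..h} (\<lambda>s. exp (c k * of_real s) * g s)) holomorphic_on S"
proof -
  have "(\<lambda>z. integral {l..h} (\<lambda>s. exp (z * of_real s) * g s)) holomorphic_on UNIV"
    using exp_integral_has_derivative[OF assms(1)] by (auto simp: holomorphic_on_open)
  from holomorphic_on_compose_gen[OF assms(2) this] show ?thesis by (simp add: o_def)
qed

lemma fourier_hat_holomorphic:
  assumes "v absolutely_integrable_on {lo..hi}" "c holomorphic_on S"
  shows "(\<lambda>k. fourier_hat lo hi v (c k)) holomorphic_on S"
proof -
  have "(\<lambda>k. - \<i> * c k) holomorphic_on S"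
    using assms(2) by (intro holomorphic_intros)
  from exp_integral_holomorphic[OF assms(1) this] show ?thesis
    unfolding fourier_hat_def .
qed

lemma time_hat_holomorphic:
  assumes "f absolutely_integrable_on {0..t}" "c holomorphic_on S"
  shows "(\<lambda>k. time_hat f (c k) t) holomorphic_on S"
  using exp_integral_holomorphic[OF assms] unfolding time_hat_def .

lemma fourier_hat_norm_le:
  assumes "v absolutely_integrable_on {lo..hi}"
    and "\<And>x. x \<in> {lo..hi} \<Longrightarrow> Im k * x \<le> m"
  shows "norm (fourier_hat lo hi v k) \<le> exp m * integral {lo..hi} (\<lambda>x. norm (v x))"
  unfolding fourier_hat_def using assms by (intro exp_integral_norm_le) simp_all

lemma time_hat_norm_le:
  assumes "f absolutely_integrable_on {0..t}" "Re \<omega> \<ge> 0"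
  shows "norm (time_hat f \<omega> t) \<le> exp (Re \<omega> * t) * integral {0..t} (\<lambda>s. norm (f s))"
  unfolding time_hat_def using assms by (intro exp_integral_norm_le) (simp_all add: mult_left_mono)

section \<open>The global relation\<close>

text \<open>Green's identity on a closed rectangle inside the open strip, where the integrand is
  continuous and the order of integration may be exchanged.\<close>

lemma heat_green_rectangle:
  fixes u ux :: "real \<Rightarrow> real \<Rightarrow> complex" and k :: complex
  assumes heat: "classical_heat_solution \<sigma> lo hi u ux"
    and cd: "lo < c" "c \<le> d" "d < hi" and t: "0 < t0" "t0 \<le> t"
    and \<omega>: "\<omega> = (of_real \<sigma> * k)\<^sup>2"
  shows "integral {c..d} (\<lambda>y. exp (- \<i> * k * of_real y + \<omega> * of_real t) * u y t
      - exp (- \<i> * k * of_real y + \<omega> * of_real t0) * u y t0)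
    = integral {t0..t} (\<lambda>s. of_real (\<sigma>\<^sup>2) * exp (- \<i> * k * of_real d + \<omega> * of_real s) * (ux d s + \<i> * k * u d s)
      - of_real (\<sigma>\<^sup>2) * exp (- \<i> * k * of_real c + \<omega> * of_real s) * (ux c s + \<i> * k * u c s))"
proof -
  obtain ut uxx where
    dt: "\<And>x s. x \<in> {lo<..<hi} \<Longrightarrow> s > 0 \<Longrightarrow> ((\<lambda>s. u x s) has_vector_derivative ut x s) (at s)" and
    dx: "\<And>x s. x \<in> {lo<..<hi} \<Longrightarrow> s > 0 \<Longrightarrow> ((\<lambda>y. u y s) has_vector_derivative ux x s) (at x)" and
    dxx: "\<And>x s. x \<in> {lo<..<hi} \<Longrightarrow> s > 0 \<Longrightarrow> ((\<lambda>y. ux y s) has_vector_derivative uxx x s) (at x)" and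
    pde: "\<And>x s. x \<in> {lo<..<hi} \<Longrightarrow> s > 0 \<Longrightarrow> ut x s = of_real (\<sigma>\<^sup>2) * uxx x s" and
    cuxx: "continuous_on ({lo<..<hi} \<times> {0<..}) (\<lambda>(x, t). uxx x t)"
    using heat unfolding classical_heat_solution_def by blast
  have cu: "continuous_on ({lo..hi} \<times> {0<..}) (\<lambda>(x, t). u x t)"
    using heat unfolding classical_heat_solution_def by blast
  let ?e = "\<lambda>y s. exp (- \<i> * k * of_real y + \<omega> * of_real s)"
  \<comment> \<open>Since \<open>\<omega> = (\<sigma> k)\<^sup>2\<close>, this is both the time
    derivative of \<open>?e y s * u y s\<close> and the space derivative of
    \<open>\<sigma>\<^sup>2 * ?e y s * (ux y s + \<i> * k * u y s)\<close>; integrating it in the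
    two orders gives the two sides.\<close>
  let ?H = "\<lambda>y s. of_real (\<sigma>\<^sup>2) * ?e y s * (uxx y s + k\<^sup>2 * u y s)"
  have sub: "cbox (c, t0) (d, t) \<subseteq> {lo<..<hi} \<times> {0<..}"
    using cd t by (auto simp: cbox_Pair_eq)
  have cont: "continuous_on (cbox (c, t0) (d, t)) (\<lambda>(y, s). ?H y s)"
  proof -
    have "continuous_on (cbox (c, t0) (d, t)) (\<lambda>p. u (fst p) (snd p))"
      using continuous_on_subset[OF cu, OF order_trans[OF sub]] by (force simp: case_prod_beta)
    moreover have "continuous_on (cbox (c, t0) (d, t)) (\<lambda>p. uxx (fst p) (snd p))"
      using continuous_on_subset[OF cuxx sub] by (simp add: case_prod_beta)
    ultimately show ?thesis
      unfolding case_prod_beta by (intro continuous_intros)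
  qed
  have swap: "integral {c..d} (\<lambda>y. integral {t0..t} (?H y)) = integral {t0..t} (\<lambda>s. integral {c..d} (\<lambda>y. ?H y s))"
    using integral_swap_continuous[OF cont] by simp
  have 1: "integral {t0..t} (?H y) = ?e y t * u y t - ?e y t0 * u y t0" if y: "y \<in> {c..d}" for y
  proof (rule integral_unique, rule fundamental_theorem_of_calculus[OF t(2)])
    fix s assume s: "s \<in> {t0..t}"
    have "((\<lambda>s. ?e y s * u y s) has_vector_derivative ?e y s * ut y s + ?e y s * \<omega> * u y s) (at s)"
    proof (intro has_vector_derivative_mult dt)
      show "((\<lambda>s. ?e y s) has_vector_derivative ?e y s * \<omega>) (at s)"
        by (rule has_vector_derivative_real_field) (auto intro!: derivative_eq_intros)
    qed (use y s cd t in auto)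
    moreover have "?e y s * ut y s + ?e y s * \<omega> * u y s = ?H y s"
    proof -
      have "E * (c * X) + E * (w * k)\<^sup>2 * V = c * E * (X + k\<^sup>2 * V)"
        if "w\<^sup>2 = c" for E X w V c :: complex
        unfolding that[symmetric] by (simp add: algebra_simps power2_eq_square)
      moreover have "ut y s = of_real (\<sigma>\<^sup>2) * uxx y s"
        using y s cd t by (intro pde) auto
      ultimately show ?thesis unfolding \<omega> by (simp only: of_real_power)
    qed
    ultimately show "((\<lambda>s. ?e y s * u y s) has_vector_derivative ?H y s) (at s within {t0..t})"
      by (auto intro: has_vector_derivative_at_within)
  qed
  have 2: "integral {c..d} (\<lambda>y. ?H y s) = of_real (\<sigma>\<^sup>2) * ?e d s * (ux d s + \<i> * k * u d s)
      - of_real (\<sigma>\<^sup>2) * ?e c s * (ux c s + \<i> * k * u c s)" if s: "s \<in> {t0..t}" for s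
  proof (rule integral_unique, rule fundamental_theorem_of_calculus[OF cd(2)])
    fix y assume y: "y \<in> {c..d}"
    have "((\<lambda>y. (of_real (\<sigma>\<^sup>2) * ?e y s) * (ux y s + \<i> * k * u y s)) has_vector_derivative
        (of_real (\<sigma>\<^sup>2) * ?e y s) * (uxx y s + \<i> * k * ux y s)
        + (of_real (\<sigma>\<^sup>2) * ?e y s * (- \<i> * k)) * (ux y s + \<i> * k * u y s)) (at y)"
    proof (rule has_vector_derivative_mult)
      show "((\<lambda>y. of_real (\<sigma>\<^sup>2) * ?e y s) has_vector_derivative of_real (\<sigma>\<^sup>2) * ?e y s * (- \<i> * k)) (at y)"
        by (rule has_vector_derivative_real_field) (auto intro!: derivative_eq_intros)
      show "((\<lambda>y. ux y s + \<i> * k * u y s) has_vector_derivative uxx y s + \<i> * k * ux y s) (at y)"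
        using y s cd t by (intro has_vector_derivative_add has_vector_derivative_mult_right dx dxx) auto
    qed
    moreover have "(of_real (\<sigma>\<^sup>2) * ?e y s) * (uxx y s + \<i> * k * ux y s)
        + (of_real (\<sigma>\<^sup>2) * ?e y s * (- \<i> * k)) * (ux y s + \<i> * k * u y s) = ?H y s"
    proof -
      have "(c * E) * (X + \<i> * k * W) + (c * E * (- \<i> * k)) * (W + \<i> * k * V) = c * E * (X + k\<^sup>2 * V)"
        for E X W V c :: complex
        by (simp add: algebra_simps power2_eq_square)
      then show ?thesis .
    qed
    ultimately show "((\<lambda>y. of_real (\<sigma>\<^sup>2) * ?e y s * (ux y s + \<i> * k * u y s)) has_vector_derivative ?H y s)
        (at y within {c..d})"
      by (auto intro: has_vector_derivative_at_within)
  qed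
  have "integral {c..d} (\<lambda>y. ?e y t * u y t - ?e y t0 * u y t0) = integral {c..d} (\<lambda>y. integral {t0..t} (?H y))"
    by (rule integral_cong) (simp only: 1)
  also note swap
  also have "integral {t0..t} (\<lambda>s. integral {c..d} (\<lambda>y. ?H y s))
    = integral {t0..t} (\<lambda>s. of_real (\<sigma>\<^sup>2) * ?e d s * (ux d s + \<i> * k * u d s)
      - of_real (\<sigma>\<^sup>2) * ?e c s * (ux c s + \<i> * k * u c s))"
    by (rule integral_cong) (simp only: 2)
  finally show ?thesis .
qed

text \<open>\<open>uxx\<close> need not extend to \<open>lo\<close> and \<open>hi\<close>, so the
  rectangles cannot touch them. Instead, \<open>D x\<close> compares the two contributions with the
  right edge at \<open>x\<close>. It is constant on the open interval by the rectangle identity and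
  continuous on the closed one, because only \<open>u\<close> and \<open>ux\<close> enter;
  \<open>D hi = D lo\<close> is the claim.\<close>

lemma heat_green_strip:
  fixes u ux :: "real \<Rightarrow> real \<Rightarrow> complex" and k :: complex
  assumes heat: "classical_heat_solution \<sigma> lo hi u ux"
    and lohi: "lo < hi" and t: "0 < t0" "t0 \<le> t"
    and \<omega>: "\<omega> = (of_real \<sigma> * k)\<^sup>2"
  shows "integral {lo..hi} (\<lambda>y. exp (- \<i> * k * of_real y + \<omega> * of_real t) * u y t
      - exp (- \<i> * k * of_real y + \<omega> * of_real t0) * u y t0)
    = integral {t0..t} (\<lambda>s. of_real (\<sigma>\<^sup>2) * exp (- \<i> * k * of_real hi + \<omega> * of_real s) * (ux hi s + \<i> * k * u hi s))
      - integral {t0..t} (\<lambda>s. of_real (\<sigma>\<^sup>2) * exp (- \<i> * k * of_real lo + \<omega> * of_real s) * (ux lo s + \<i> * k * u lo s))"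
proof -
  let ?e = "\<lambda>y s. exp (- \<i> * k * of_real y + \<omega> * of_real s)"
  let ?P = "\<lambda>x s. of_real (\<sigma>\<^sup>2) * ?e x s * (ux x s + \<i> * k * u x s)"
  let ?W = "\<lambda>y. ?e y t * u y t - ?e y t0 * u y t0"
  have cu: "continuous_on ({lo..hi} \<times> {0<..}) (\<lambda>(x, t). u x t)"
    and cux: "continuous_on ({lo..hi} \<times> {0<..}) (\<lambda>(x, t). ux x t)"
    using heat unfolding classical_heat_solution_def by blast+
  have cu_x: "continuous_on {lo..hi} (\<lambda>x. u x s)" if "s > 0" for s
  proof -
    have "continuous_on {lo..hi} (\<lambda>x. (\<lambda>(x, t). u x t) (x, s))"
      using that by (intro continuous_on_compose2[OF cu] continuous_intros) auto
    then show ?thesis by simp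
  qed
  have cW: "continuous_on {lo..hi} ?W"
    using t by (intro continuous_intros cu_x) auto
  have cP: "continuous_on ({lo..hi} \<times> cbox t0 t) (\<lambda>(x, s). ?P x s)"
  proof -
    have sub: "{lo..hi} \<times> {t0..t} \<subseteq> {lo..hi} \<times> {0<..}" using t by auto
    show ?thesis
      using continuous_on_subset[OF cu sub] continuous_on_subset[OF cux sub]
      unfolding case_prod_beta by (auto intro!: continuous_intros)
  qed
  have iP: "?P x integrable_on {t0..t}" if "x \<in> {lo..hi}" for x
  proof -
    have "continuous_on {t0..t} (\<lambda>s. (\<lambda>(x, s). ?P x s) (x, s))"
      using that by (intro continuous_on_compose2[OF cP] continuous_intros) auto
    then show ?thesis by (intro integrable_continuous_real) simp
  qed
  define D where "D x = integral {lo..x} ?W - integral {t0..t} (?P x)" for x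
  have cD: "continuous_on {lo..hi} D"
    unfolding D_def
  proof (rule continuous_on_diff)
    show "continuous_on {lo..hi} (\<lambda>x. integral {lo..x} ?W)"
      by (rule indefinite_integral_continuous_1[OF integrable_continuous_real[OF cW]])
    show "continuous_on {lo..hi} (\<lambda>x. integral {t0..t} (?P x))"
      using integral_continuous_on_param[OF cP] unfolding box_real .
  qed
  have mono: "D d = D c" if "lo < c" "c \<le> d" "d < hi" for c d
  proof -
    have "integral {lo..d} ?W = integral {lo..c} ?W + integral {c..d} ?W"
    proof (rule Henstock_Kurzweil_Integration.integral_combine[symmetric])
      show "?W integrable_on {lo..d}"
        using that by (intro integrable_continuous_real[OF continuous_on_subset[OF cW]]) auto
    qed (use that in auto)
    also have "integral {c..d} ?W = integral {t0..t} (\<lambda>s. ?P d s - ?P c s)"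
      using heat_green_rectangle[OF heat that t \<omega>] .
    also have "\<dots> = integral {t0..t} (?P d) - integral {t0..t} (?P c)"
      using that by (intro integral_diff iP) auto
    finally show ?thesis by (simp add: D_def)
  qed
  define m where "m = (lo + hi) / 2"
  have m: "lo < m" "m < hi" using lohi by (auto simp: m_def)
  have "D x = D m" if "x \<in> {lo..hi}" for x
  proof (rule continuous_constant_on_closure[of "{lo<..<hi}"])
    show "D x = D m" if "x \<in> {lo<..<hi}" for x
      using mono[of x m] mono[of m x] m that by (cases "x \<le> m") auto
  qed (use cD lohi that in auto)
  from this[of lo] this[of hi] lohi have "D hi = D lo" by auto
  then show ?thesis by (simp add: D_def algebra_simps)
qed

text \<open>The initial time of the strip identity tends to 0. The transforms converge because their
  difference is at most a constant times the L1 distance of the solutions; the boundary integrals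
  converge because the endpoint values are integrable down to time 0.\<close>

theorem heat_global_relation:
  fixes u ux :: "real \<Rightarrow> real \<Rightarrow> complex" and k :: complex
  assumes heat: "classical_heat_solution \<sigma> lo hi u ux"
    and lohi: "lo < hi" and t: "0 < t"
    and \<omega>: "\<omega> = (of_real \<sigma> * k)\<^sup>2"
  shows "exp (\<omega> * of_real t) * fourier_hat lo hi (\<lambda>x. u x t) k
    = fourier_hat lo hi (\<lambda>x. u x 0) k
      + of_real (\<sigma>\<^sup>2) * (exp (- \<i> * k * of_real hi) * (time_hat (ux hi) \<omega> t + \<i> * k * time_hat (u hi) \<omega> t)
        - exp (- \<i> * k * of_real lo) * (time_hat (ux lo) \<omega> t + \<i> * k * time_hat (u lo) \<omega> t))"
proof -
  let ?e = "\<lambda>y s. exp (- \<i> * k * of_real y + \<omega> * of_real s)"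
  let ?P = "\<lambda>x s. of_real (\<sigma>\<^sup>2) * ?e x s * (ux x s + \<i> * k * u x s)"
  let ?fh = "\<lambda>s. fourier_hat lo hi (\<lambda>x. u x s) k"
  have L1: "(\<lambda>x. u x s) absolutely_integrable_on {lo..hi}" if "s \<ge> 0" for s
    using heat that unfolding classical_heat_solution_def by blast
  have L1_cont: "((\<lambda>s. integral {lo..hi} (\<lambda>x. norm (u x s - u x 0))) \<longlongrightarrow> 0) (at 0 within {0..})"
    using heat unfolding classical_heat_solution_def by auto
  have iu: "u y absolutely_integrable_on {0..t}" "ux y absolutely_integrable_on {0..t}" if "y \<in> {lo, hi}" for y
    using heat that t unfolding classical_heat_solution_def absolutely_integrable_on_Icc_iff_Ioo by blast+
  have aP: "(\<lambda>s. exp (\<omega> * of_real s) * g s) integrable_on {0..t}" if "g absolutely_integrable_on {0..t}" for g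
    by (intro set_lebesgue_integral_eq_integral(1) absolutely_integrable_continuous_mult that continuous_intros)
  have P: "(?P y has_integral of_real (\<sigma>\<^sup>2) * (exp (- \<i> * k * of_real y) *
      (time_hat (ux y) \<omega> t + \<i> * k * time_hat (u y) \<omega> t))) {0..t}" if "y \<in> {lo, hi}" for y
  proof -
    have "((\<lambda>s. of_real (\<sigma>\<^sup>2) * (exp (- \<i> * k * of_real y) * (exp (\<omega> * of_real s) * ux y s + \<i> * k * (exp (\<omega> * of_real s) * u y s))))
      has_integral of_real (\<sigma>\<^sup>2) * (exp (- \<i> * k * of_real y) *
      (time_hat (ux y) \<omega> t + \<i> * k * time_hat (u y) \<omega> t))) {0..t}"
      unfolding time_hat_def
      by (intro has_integral_mult_right has_integral_add integrable_integral aP iu that)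
    moreover have "of_real (\<sigma>\<^sup>2) * (exp (- \<i> * k * of_real y) * (exp (\<omega> * of_real s) * ux y s + \<i> * k * (exp (\<omega> * of_real s) * u y s)))
        = ?P y s" for s
    proof -
      have "c * (A * (B * X + \<i> * k * (B * Y))) = c * (A * B) * (X + \<i> * k * Y)" for c A B X Y :: complex
        by (simp add: algebra_simps)
      then show ?thesis unfolding exp_add .
    qed
    ultimately show ?thesis by (simp only:)
  qed
  have ifh: "(\<lambda>x. exp (- \<i> * k * of_real x) * u x s) integrable_on {lo..hi}" if "s \<ge> 0" for s
    by (intro set_lebesgue_integral_eq_integral(1) absolutely_integrable_continuous_mult L1 that continuous_intros)
  have strip: "exp (\<omega> * of_real t) * ?fh t - exp (\<omega> * of_real s) * ?fh s
      = integral {s..t} (?P hi) - integral {s..t} (?P lo)" if s: "0 < s" "s \<le> t" for s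
  proof -
    have "exp (\<omega> * of_real t) * ?fh t - exp (\<omega> * of_real s) * ?fh s
      = integral {lo..hi} (\<lambda>y. exp (\<omega> * of_real t) * (exp (- \<i> * k * of_real y) * u y t)
          - exp (\<omega> * of_real s) * (exp (- \<i> * k * of_real y) * u y s))"
      unfolding fourier_hat_def using s t
      by (subst integral_diff) (auto intro!: integrable_on_mult_right ifh[simplified])
    also have "\<dots> = integral {lo..hi} (\<lambda>y. ?e y t * u y t - ?e y s * u y s)"
      unfolding exp_add by (simp only: mult_ac)
    also note heat_green_strip[OF heat lohi s \<omega>]
    finally show ?thesis .
  qed
  have ev: "eventually (\<lambda>s. s \<in> {0<..t}) (at_right (0::real))"
    using t by (auto simp: eventually_at_right_field intro!: exI[of _ t])
  have fh_lim: "(?fh \<longlongrightarrow> ?fh 0) (at_right 0)"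
  proof (rule LIM_zero_cancel, rule tendsto_norm_zero_cancel, rule tendsto_0_le)
    show "((\<lambda>s. integral {lo..hi} (\<lambda>x. norm (u x s - u x 0))) \<longlongrightarrow> 0) (at_right 0)"
      using L1_cont by (rule tendsto_within_subset) auto
    define m where "m = \<bar>Im k\<bar> * max \<bar>lo\<bar> \<bar>hi\<bar>"
    show "\<forall>\<^sub>F s in at_right 0. norm (norm (?fh s - ?fh 0))
        \<le> norm (integral {lo..hi} (\<lambda>x. norm (u x s - u x 0))) * exp m"
      using ev
    proof eventually_elim
      case (elim s)
      have "?fh s - ?fh 0 = fourier_hat lo hi (\<lambda>x. u x s - u x 0) k"
        unfolding fourier_hat_def using ifh[of s] ifh[of 0] elim
        by (subst integral_diff[symmetric]) (auto simp: right_diff_distrib)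
      also have "norm \<dots> \<le> exp m * integral {lo..hi} (\<lambda>x. norm (u x s - u x 0))"
      proof (rule fourier_hat_norm_le)
        show "(\<lambda>x. u x s - u x 0) absolutely_integrable_on {lo..hi}"
          using L1[of s] L1[of 0] elim by (intro set_integral_diff(1)) auto
        fix x assume "x \<in> {lo..hi}"
        then have "\<bar>Im k * x\<bar> \<le> m"
          unfolding m_def abs_mult by (intro mult_left_mono) auto
        then show "Im k * x \<le> m" by simp
      qed
      also have "\<dots> \<le> norm (integral {lo..hi} (\<lambda>x. norm (u x s - u x 0))) * exp m"
        by (simp add: mult.commute)
      finally show ?case by simp
    qed
  qed
  have lim1: "((\<lambda>s. integral {s..t} (?P hi) - integral {s..t} (?P lo)) \<longlongrightarrow>
      exp (\<omega> * of_real t) * ?fh t - exp (\<omega> * of_real 0) * ?fh 0) (at_right 0)"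
  proof (rule Lim_transform_eventually)
    show "((\<lambda>s. exp (\<omega> * of_real t) * ?fh t - exp (\<omega> * of_real s) * ?fh s) \<longlongrightarrow>
      exp (\<omega> * of_real t) * ?fh t - exp (\<omega> * of_real 0) * ?fh 0) (at_right 0)"
      by (intro tendsto_intros fh_lim)
    show "\<forall>\<^sub>F s in at_right 0. exp (\<omega> * of_real t) * ?fh t - exp (\<omega> * of_real s) * ?fh s
        = integral {s..t} (?P hi) - integral {s..t} (?P lo)"
      using ev by eventually_elim (rule strip; simp)
  qed
  have lim_P: "((\<lambda>s. integral {s..t} (?P y)) \<longlongrightarrow> integral {0..t} (?P y)) (at_right 0)"
    if "y \<in> {lo, hi}" for y
  proof -
    have "continuous_on {0..t} (\<lambda>s. integral {s..t} (?P y))"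
      using P[OF that] by (intro indefinite_integral_continuous_1') (rule has_integral_integrable)
    then have "((\<lambda>s. integral {s..t} (?P y)) \<longlongrightarrow> integral {0..t} (?P y)) (at 0 within {0..t})"
      unfolding continuous_on_def using t by simp
    moreover have "at 0 within {0..t} = at_right 0"
      using t by (simp add: at_within_Icc_at_right)
    ultimately show ?thesis by simp
  qed
  have aux: "X = Y + c * (A - B)" if "X - exp (\<omega> * of_real 0) * Y = c * A - c * B" for X Y A B c
    using that by (simp add: algebra_simps)
  have "exp (\<omega> * of_real t) * ?fh t - exp (\<omega> * of_real 0) * ?fh 0
      = integral {0..t} (?P hi) - integral {0..t} (?P lo)"
    by (rule tendsto_unique[OF _ lim1 tendsto_diff[OF lim_P lim_P]]) simp_all
  also have "integral {0..t} (?P hi) = of_real (\<sigma>\<^sup>2) * (exp (- \<i> * k * of_real hi) *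
      (time_hat (ux hi) \<omega> t + \<i> * k * time_hat (u hi) \<omega> t))"
    by (intro integral_unique P) simp
  also have "integral {0..t} (?P lo) = of_real (\<sigma>\<^sup>2) * (exp (- \<i> * k * of_real lo) *
      (time_hat (ux lo) \<omega> t + \<i> * k * time_hat (u lo) \<omega> t))"
    by (intro integral_unique P) simp
  finally show ?thesis by (rule aux)
qed

section \<open>Gaussian regularisation of Fourier inversion\<close>

lemma std_normal_fourier:
  "(LINT z|lborel. std_normal_density z *\<^sub>R exp (\<i> * of_real (w * z))) = of_real (exp (- w\<^sup>2 / 2))"
proof -
  have "of_real (exp (- w\<^sup>2 / 2)) = char std_normal_distribution w"
    by (simp add: char_std_normal_distribution)
  also have "\<dots> = (LINT z|lborel. std_normal_density z *\<^sub>R exp (\<i> * of_real (w * z)))"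
    unfolding char_def by (rule integral_density) (auto simp: normal_density_nonneg)
  finally show ?thesis ..
qed

lemma gaussian_fourier:
  assumes "\<delta> > 0"
  shows "(LINT k|lborel. std_normal_density (\<delta> * k) *\<^sub>R exp (\<i> * of_real (k * w)))
    = of_real (sqrt (2 * pi) / \<delta> * std_normal_density (w / \<delta>))"
proof -
  let ?I = "LINT k|lborel. std_normal_density (\<delta> * k) *\<^sub>R exp (\<i> * of_real (k * w))"
  have "of_real (exp (- (w / \<delta>)\<^sup>2 / 2))
      = (LINT z|lborel. std_normal_density z *\<^sub>R exp (\<i> * of_real (w / \<delta> * z)))"
    by (rule std_normal_fourier[symmetric])
  also have "\<dots> = \<bar>\<delta>\<bar> *\<^sub>R (LINT k|lborel. std_normal_density (0 + \<delta> * k) *\<^sub>R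
      exp (\<i> * of_real (w / \<delta> * (0 + \<delta> * k))))"
    using assms by (intro lborel_integral_real_affine) auto
  also have "\<dots> = \<delta> *\<^sub>R ?I"
    using assms by (simp add: mult.commute)
  finally have "?I = of_real (exp (- (w / \<delta>)\<^sup>2 / 2) / \<delta>)"
    using assms by (simp add: scaleR_conv_of_real field_simps)
  then show ?thesis
    by (simp add: std_normal_density_def)
qed

text \<open>Passage to Lebesgue integrals over the whole line, the form in which Fubini is applied
  below.\<close>

lemma fourier_hat_lborel:
  assumes v: "continuous_on {lo..hi} v"
  shows "integrable lborel (\<lambda>y. exp (\<i> * of_real (k * (x - y))) * (indicator {lo..hi} y *\<^sub>R v y))" (is ?int)
    and "exp (\<i> * of_real k * of_real x) * fourier_hat lo hi v (of_real k)
      = (LINT y|lborel. exp (\<i> * of_real (k * (x - y))) * (indicator {lo..hi} y *\<^sub>R v y))" (is ?eq)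
proof -
  have i: "set_integrable lborel {lo..hi} (\<lambda>y. exp (\<i> * of_real (k * (x - y))) * v y)"
    by (intro borel_integrable_atLeastAtMost' continuous_intros v)
  then show ?int by (simp add: set_integrable_def)
  have "exp (\<i> * of_real k * of_real x) * fourier_hat lo hi v (of_real k)
    = integral {lo..hi} (\<lambda>y. exp (\<i> * of_real k * of_real x) * (exp (- \<i> * of_real k * of_real y) * v y))"
    unfolding fourier_hat_def by simp
  also have "\<dots> = integral {lo..hi} (\<lambda>y. exp (\<i> * of_real (k * (x - y))) * v y)"
    by (simp add: algebra_simps exp_diff exp_minus divide_inverse)
  also have "\<dots> = (LINT y:{lo..hi}|lborel. exp (\<i> * of_real (k * (x - y))) * v y)"
    using set_borel_integral_eq_integral(2)[OF i] ..
  finally show ?eq by (simp add: set_lebesgue_integral_def)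
qed

text \<open>With the Gaussian present Fubini applies, and the inner integral over \<open>k\<close>
  is again a Gaussian. What remains is the mean of \<open>v\<close>, extended by 0, under the normal
  law with centre \<open>x\<close> and standard deviation \<open>\<delta>\<close>; substituting
  \<open>y = x + \<delta> * z\<close> moves \<open>\<delta>\<close> from the density into the
  argument of \<open>v\<close>.\<close>

lemma gaussian_regularised_inversion:
  fixes v :: "real \<Rightarrow> complex"
  assumes v: "continuous_on {lo..hi} v" and "\<delta> > 0"
  shows "((\<lambda>k::real. exp (\<i> * of_real k * of_real x - (of_real \<delta> * of_real k)\<^sup>2 / 2) * fourier_hat lo hi v (of_real k))
    has_integral 2 * of_real pi * (LINT z|lborel. std_normal_density z *\<^sub>R
      (indicator {lo..hi} (x + \<delta> * z) *\<^sub>R v (x + \<delta> * z)))) UNIV"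
proof -
  define V where "V y = indicator {lo..hi} y *\<^sub>R v y" for y :: real
  have V_meas [measurable]: "V \<in> borel_measurable borel"
    unfolding V_def using v by (intro borel_measurable_continuous_on_indicator) auto
  have V_int: "integrable lborel V"
    using borel_integrable_atLeastAtMost'[OF v] by (simp add: set_integrable_def V_def[abs_def])
  define f where "f = (\<lambda>(k, y). std_normal_density (\<delta> * k) *\<^sub>R (exp (\<i> * of_real (k * (x - y))) * V y))"
  have f_meas [measurable]: "f \<in> borel_measurable (lborel \<Otimes>\<^sub>M lborel)"
    unfolding f_def by measurable
  have gi: "integrable lborel (\<lambda>k. std_normal_density (\<delta> * k))"
    using lborel_integrable_real_affine[OF integrable_normal_density, of 1 \<delta> 0 0] assms(2) by simp
  have fi: "integrable (lborel \<Otimes>\<^sub>M lborel) f"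
  proof (rule lborel_pair.Fubini_integrable[OF f_meas])
    show "integrable lborel (\<lambda>k. LINT y|lborel. norm (f (k, y)))"
      using gi by (simp add: f_def norm_mult)
    show "AE k in lborel. integrable lborel (\<lambda>y. f (k, y))"
      unfolding f_def V_def prod.case
      by (intro AE_I2 integrable_scaleR_right fourier_hat_lborel(1)[OF v])
  qed
  \<comment> \<open>\<open>exp (- (\<delta> * k)\<^sup>2 / 2)\<close> is
    \<open>sqrt (2 * pi)\<close> times the standard normal density at \<open>\<delta> * k\<close>,
    which is where the normalising factor comes from.\<close>
  have reg: "exp (\<i> * of_real k * of_real x - (of_real \<delta> * of_real k)\<^sup>2 / 2) * fourier_hat lo hi v (of_real k)
      = sqrt (2 * pi) *\<^sub>R (LINT y|lborel. f (k, y))" for k :: real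
  proof -
    have "sqrt (2 * pi) *\<^sub>R (LINT y|lborel. f (k, y))
      = of_real (sqrt (2 * pi) * std_normal_density (\<delta> * k)) * (exp (\<i> * of_real k * of_real x) * fourier_hat lo hi v (of_real k))"
      unfolding f_def using fourier_hat_lborel(2)[OF v] by (simp add: V_def scaleR_conv_of_real)
    also have "sqrt (2 * pi) * std_normal_density (\<delta> * k) = exp (- (\<delta> * k)\<^sup>2 / 2)"
      by (simp add: std_normal_density_def)
    finally have "sqrt (2 * pi) *\<^sub>R (LINT y|lborel. f (k, y))
      = (of_real (exp (- (\<delta> * k)\<^sup>2 / 2)) * exp (\<i> * of_real k * of_real x)) * fourier_hat lo hi v (of_real k)"
      by (simp only: mult.assoc)
    also have "of_real (exp (- (\<delta> * k)\<^sup>2 / 2)) * exp (\<i> * of_real k * of_real x)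
        = exp (\<i> * of_real k * of_real x - (of_real \<delta> * of_real k)\<^sup>2 / 2)"
      by (simp add: exp_of_real[symmetric] mult_exp_exp)
    finally show ?thesis ..
  qed
  have "integrable lborel (\<lambda>k. sqrt (2 * pi) *\<^sub>R (LINT y|lborel. f (k, y)))"
    by (intro integrable_scaleR_right lborel_pair.integrable_fst'[OF fi])
  then have "((\<lambda>k. sqrt (2 * pi) *\<^sub>R (LINT y|lborel. f (k, y))) has_integral
      (LINT k|lborel. sqrt (2 * pi) *\<^sub>R (LINT y|lborel. f (k, y)))) UNIV"
    by (rule has_integral_integral_lborel)
  moreover have "(LINT k|lborel. sqrt (2 * pi) *\<^sub>R (LINT y|lborel. f (k, y)))
      = sqrt (2 * pi) *\<^sub>R (LINT y|lborel. (LINT k|lborel. f (k, y)))"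
    using lborel_pair.Fubini_integral[of "\<lambda>k y. f (k, y)"] fi by simp
  moreover have "(LINT k|lborel. f (k, y)) = of_real (sqrt (2 * pi) / \<delta> * std_normal_density ((x - y) / \<delta>)) * V y" for y
  proof -
    have "(LINT k|lborel. f (k, y))
        = (LINT k|lborel. (std_normal_density (\<delta> * k) *\<^sub>R exp (\<i> * of_real (k * (x - y)))) * V y)"
      by (simp add: f_def)
    also have "\<dots> = (LINT k|lborel. std_normal_density (\<delta> * k) *\<^sub>R exp (\<i> * of_real (k * (x - y)))) * V y"
      by (rule integral_mult_left_zero)
    finally show ?thesis
      unfolding gaussian_fourier[OF assms(2)] .
  qed
  moreover have "(LINT y|lborel. of_real (sqrt (2 * pi) / \<delta> * std_normal_density ((x - y) / \<delta>)) * V y)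
      = \<bar>\<delta>\<bar> *\<^sub>R (LINT z|lborel. of_real (sqrt (2 * pi) / \<delta> * std_normal_density ((x - (x + \<delta> * z)) / \<delta>)) * V (x + \<delta> * z))"
    using assms(2) by (intro lborel_integral_real_affine) auto
  moreover have "(\<lambda>z. of_real (sqrt (2 * pi) / \<delta> * std_normal_density ((x - (x + \<delta> * z)) / \<delta>)) * V (x + \<delta> * z))
      = (\<lambda>z. (sqrt (2 * pi) / \<delta>) *\<^sub>R (std_normal_density z *\<^sub>R V (x + \<delta> * z)))"
    using assms(2) by (auto simp: std_normal_density_def scaleR_conv_of_real)
  moreover have "sqrt (2 * pi) *\<^sub>R (\<bar>\<delta>\<bar> *\<^sub>R (LINT z|lborel. (sqrt (2 * pi) / \<delta>) *\<^sub>R (std_normal_density z *\<^sub>R V (x + \<delta> * z))))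
      = 2 * of_real pi * (LINT z|lborel. std_normal_density z *\<^sub>R V (x + \<delta> * z))"
    using assms(2) by (simp add: scaleR_conv_of_real flip: of_real_mult) simp
  ultimately show ?thesis
    unfolding reg by (simp only: V_def)
qed

text \<open>The normal means concentrate at \<open>x\<close>. As their density no longer depends on
  \<open>n\<close>, dominated convergence with a bound on \<open>v\<close> suffices, and continuity
  at the interior point \<open>x\<close> gives the pointwise limit.\<close>

lemma gaussian_inversion_limit:
  fixes v :: "real \<Rightarrow> complex"
  assumes v: "continuous_on {lo..hi} v" and x: "lo < x" "x < hi"
    and \<delta>: "\<And>n. \<delta> n > 0" "\<delta> \<longlonglongrightarrow> 0"
  shows "(\<lambda>n. 1 / (2 * of_real pi) * integral UNIV (\<lambda>k::real.
      exp (\<i> * of_real k * of_real x - (of_real (\<delta> n) * of_real k)\<^sup>2 / 2) * fourier_hat lo hi v (of_real k))) \<longlonglongrightarrow> v x"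
proof -
  define V where "V y = indicator {lo..hi} y *\<^sub>R v y" for y :: real
  have V_meas [measurable]: "V \<in> borel_measurable borel"
    unfolding V_def using v by (intro borel_measurable_continuous_on_indicator) auto
  obtain B where B: "\<And>y. y \<in> {lo..hi} \<Longrightarrow> norm (v y) \<le> B"
    using compact_imp_bounded[OF compact_continuous_image[OF v compact_Icc]] unfolding bounded_iff by blast
  have VB: "norm (V y) \<le> max B 0" for y
    using B[of y] by (auto simp: V_def indicator_def)
  have eq: "1 / (2 * of_real pi) * integral UNIV (\<lambda>k::real.
      exp (\<i> * of_real k * of_real x - (of_real (\<delta> n) * of_real k)\<^sup>2 / 2) * fourier_hat lo hi v (of_real k))
    = (LINT z|lborel. std_normal_density z *\<^sub>R V (x + \<delta> n * z))" for n
    using integral_unique[OF gaussian_regularised_inversion[OF v \<delta>(1), of x n]] by (simp add: V_def)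
  have "(\<lambda>n. LINT z|lborel. std_normal_density z *\<^sub>R V (x + \<delta> n * z)) \<longlonglongrightarrow>
      (LINT z|lborel. std_normal_density z *\<^sub>R V x)"
  proof (rule integral_dominated_convergence[where w = "\<lambda>z. std_normal_density z * max B 0"])
    show "AE z in lborel. (\<lambda>n. std_normal_density z *\<^sub>R V (x + \<delta> n * z)) \<longlonglongrightarrow> std_normal_density z *\<^sub>R V x"
    proof (intro AE_I2 tendsto_scaleR tendsto_const)
      fix z
      have lim: "(\<lambda>n. x + \<delta> n * z) \<longlonglongrightarrow> x"
        using \<delta>(2) by (auto intro!: tendsto_eq_intros)
      have ev: "eventually (\<lambda>n. x + \<delta> n * z \<in> {lo<..<hi}) sequentially"
        using topological_tendstoD[OF lim, of "{lo<..<hi}"] x by auto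
      have "isCont v x"
        using continuous_on_interior[OF v, of x] x by simp
      then have "(\<lambda>n. v (x + \<delta> n * z)) \<longlonglongrightarrow> v x"
        using lim by (rule isCont_tendsto_compose)
      then have "(\<lambda>n. v (x + \<delta> n * z)) \<longlonglongrightarrow> V x"
        using x by (simp add: V_def)
      then show "(\<lambda>n. V (x + \<delta> n * z)) \<longlonglongrightarrow> V x"
        by (rule Lim_transform_eventually) (use ev in eventually_elim, auto simp: V_def)
    qed
    show "AE z in lborel. norm (std_normal_density z *\<^sub>R V (x + \<delta> n * z)) \<le> std_normal_density z * max B 0" for n
      using VB by (auto intro!: mult_left_mono simp: normal_density_nonneg)
  qed auto
  also have "(LINT z|lborel. std_normal_density z *\<^sub>R V x) = V x"
    by simp
  also have "V x = v x" using x by (simp add: V_def)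
  finally show ?thesis unfolding eq .
qed

section \<open>Integrals over sector contours\<close>

lemma integral_exhaust_tendsto:
  fixes h :: "real \<Rightarrow> complex"
  assumes h: "h absolutely_integrable_on S"
    and A: "\<And>n. A n \<subseteq> S" "\<And>n. h integrable_on A n"
    and ev: "\<And>x. x \<in> S \<Longrightarrow> eventually (\<lambda>n::nat. x \<in> A n) sequentially"
  shows "(\<lambda>n. integral (A n) h) \<longlonglongrightarrow> integral S h"
proof -
  let ?f = "\<lambda>n x. if x \<in> A n then h x else 0"
  have "(\<lambda>n. integral S (?f n)) \<longlonglongrightarrow> integral S h"
  proof (rule dominated_convergence(2)[where h = "\<lambda>x. norm (h x)"])
    show "?f n integrable_on S" for n
      using A by (simp add: integrable_on_def)
    show "(\<lambda>x. norm (h x)) integrable_on S"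
      using h by (simp add: absolutely_integrable_on_def)
    show "(\<lambda>n. ?f n x) \<longlonglongrightarrow> h x" if "x \<in> S" for x
      by (rule tendsto_eventually) (use ev[OF that] in eventually_elim, simp)
  qed auto
  moreover have "integral S (?f n) = integral (A n) h" for n
    using has_integral_restrict[OF A(1), where f = h] A(2)[of n] by (metis integrable_integral integral_unique)
  ultimately show ?thesis by simp
qed

lemma absolutely_integrable_exp_majorant_ray:
  fixes f :: "real \<Rightarrow> complex"
  assumes "continuous_on {r..} f" "c > 0" "\<And>s. s \<ge> r \<Longrightarrow> norm (f s) \<le> C * exp (- c * s)"
  shows "f absolutely_integrable_on {r..}"
proof (rule measurable_bounded_by_integrable_imp_absolutely_integrable)
  show "f \<in> borel_measurable (lebesgue_on {r..})"
    using assms(1) by (intro continuous_imp_measurable_on_sets_lebesgue) auto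
  show "(\<lambda>s. C * exp (- c * s)) integrable_on {r..}"
    using integrable_on_exp_minus_to_infinity[OF assms(2)] by (rule integrable_on_mult_right)
qed (use assms in auto)

lemma absolutely_integrable_exp_majorant_line:
  fixes f :: "real \<Rightarrow> complex"
  assumes f: "continuous_on UNIV f" and c: "c > 0" and bound: "\<And>s. norm (f s) \<le> C * exp (- c * \<bar>s\<bar>)"
  shows "f absolutely_integrable_on UNIV"
proof (rule measurable_bounded_by_integrable_imp_absolutely_integrable)
  show "f \<in> borel_measurable (lebesgue_on UNIV)"
    using f by (intro continuous_imp_measurable_on_sets_lebesgue) auto
  have 0: "(\<lambda>s. exp (- c * s)) integrable_on {0..}"
    using integrable_on_exp_minus_to_infinity[OF c] .
  have 1: "(\<lambda>s. exp (- c * \<bar>s\<bar>)) absolutely_integrable_on {0..}"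
    by (rule nonnegative_absolutely_integrable_1, rule integrable_eq[OF 0]) auto
  then have "(\<lambda>s. exp (- c * \<bar>s\<bar>)) absolutely_integrable_on {..0}"
    using has_absolute_integral_reflect_real[of "{0..}" "{..0}" "\<lambda>s. exp (- c * \<bar>s\<bar>)"] by auto
  from set_integrable_Un[OF 1 this] have "(\<lambda>s. exp (- c * \<bar>s\<bar>)) absolutely_integrable_on ({0..} \<union> {..0})"
    by auto
  also have "{0..} \<union> {..0::real} = UNIV" by auto
  finally show "(\<lambda>s. C * exp (- c * \<bar>s\<bar>)) integrable_on UNIV"
    by (intro integrable_on_mult_right set_lebesgue_integral_eq_integral(1))
qed (use bound in auto)

lemma integral_symmetric_interval_tendsto:
  fixes g :: "real \<Rightarrow> complex"
  assumes g: "g absolutely_integrable_on UNIV"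
  shows "(\<lambda>n. integral {- real n..real n} g) \<longlonglongrightarrow> integral UNIV g"
proof (rule integral_exhaust_tendsto[OF g])
  show "g integrable_on {- real n..real n}" for n
    using integrable_on_subcbox[of g UNIV "- real n" "real n"] g by (simp add: absolutely_integrable_on_def)
  show "\<forall>\<^sub>F n in sequentially. x \<in> {- real n..real n}" for x
    using eventually_ge_at_top[of "nat \<lceil>\<bar>x\<bar>\<rceil>"] by eventually_elim (auto simp: nat_le_iff ceiling_le_iff)
qed auto

lemma integral_UNIV_reflect:
  fixes f :: "real \<Rightarrow> complex"
  assumes f: "f absolutely_integrable_on UNIV" and f': "(\<lambda>x. f (- x)) absolutely_integrable_on UNIV"
  shows "integral UNIV (\<lambda>x. f (- x)) = integral UNIV f"
proof -
  have "integral {- real n..real n} (\<lambda>x. f (- x)) = integral {- real n..real n} f" for n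
    using Henstock_Kurzweil_Integration.integral_reflect_real[of "real n" "- real n" f] by simp
  with integral_symmetric_interval_tendsto[OF f']
  have "(\<lambda>n. integral {- real n..real n} f) \<longlonglongrightarrow> integral UNIV (\<lambda>x. f (- x))"
    by simp
  from LIMSEQ_unique[OF this integral_symmetric_interval_tendsto[OF f]] show ?thesis .
qed

text \<open>
  Replaces closed contours in the deformation arguments: two contours agree as soon as a primitive
  has asymptotically the same values at their ends.
\<close>

lemma sector_contour_integral_primitive:
  assumes r: "r > 0" and g: "sector_contour_integrable r \<theta> \<phi> g"
    and F: "\<And>k. k \<in> S \<Longrightarrow> (F has_field_derivative g k) (at k)"
    and S: "\<And>s. s \<ge> r \<Longrightarrow> of_real s * cis \<theta> \<in> S" "\<And>s. s \<ge> r \<Longrightarrow> of_real s * cis \<phi> \<in> S"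
      "path_image (part_circlepath 0 r \<theta> \<phi>) \<subseteq> S"
  shows "(\<lambda>n. F (of_nat n * cis \<phi>) - F (of_nat n * cis \<theta>)) \<longlonglongrightarrow> sector_contour_integral r \<theta> \<phi> g"
proof -
  have ray: "(\<lambda>n. F (of_nat n * cis \<psi>) - F (of_real r * cis \<psi>)) \<longlonglongrightarrow>
      cis \<psi> * integral {r..} (\<lambda>s. g (of_real s * cis \<psi>))"
    if S: "\<And>s. s \<ge> r \<Longrightarrow> of_real s * cis \<psi> \<in> S"
      and int: "(\<lambda>s. g (of_real s * cis \<psi>)) absolutely_integrable_on {r..}" for \<psi>
  proof -
    have ftc: "((\<lambda>s. g (of_real s * cis \<psi>) * cis \<psi>) has_integral F (of_real R * cis \<psi>) - F (of_real r * cis \<psi>)) {r..R}"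
      if "R \<ge> r" for R
    proof (rule fundamental_theorem_of_calculus[OF that])
      fix s assume s: "s \<in> {r..R}"
      have "((\<lambda>z. F (z * cis \<psi>)) has_field_derivative g (of_real s * cis \<psi>) * cis \<psi>) (at (of_real s))"
      proof (rule DERIV_chain2[where f = F and g = "\<lambda>z. z * cis \<psi>"])
        show "(F has_field_derivative g (of_real s * cis \<psi>)) (at (of_real s * cis \<psi>))"
          using s by (intro F S) auto
      qed (auto intro!: derivative_eq_intros)
      then show "((\<lambda>s. F (of_real s * cis \<psi>)) has_vector_derivative g (of_real s * cis \<psi>) * cis \<psi>) (at s within {r..R})"
        by (rule has_vector_derivative_real_field)
    qed
    have lim: "(\<lambda>n. integral {r..real n} (\<lambda>s. g (of_real s * cis \<psi>))) \<longlonglongrightarrow> integral {r..} (\<lambda>s. g (of_real s * cis \<psi>))"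
    proof (rule integral_exhaust_tendsto[OF int])
      show "(\<lambda>s. g (of_real s * cis \<psi>)) integrable_on {r..real n}" for n
        using integrable_on_subcbox[of "\<lambda>s. g (of_real s * cis \<psi>)" "{r..}" r "real n"] int
        by (simp add: absolutely_integrable_on_def)
      show "\<forall>\<^sub>F n in sequentially. x \<in> {r..real n}" if "x \<in> {r..}" for x
        using eventually_ge_at_top[of "nat \<lceil>x\<rceil>"]
        by eventually_elim (use that in \<open>auto simp: nat_le_iff ceiling_le_iff\<close>)
    qed auto
    show ?thesis
    proof (rule Lim_transform_eventually)
      show "(\<lambda>n. cis \<psi> * integral {r..real n} (\<lambda>s. g (of_real s * cis \<psi>))) \<longlonglongrightarrow>
          cis \<psi> * integral {r..} (\<lambda>s. g (of_real s * cis \<psi>))"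
        by (intro tendsto_mult tendsto_const lim)
      show "\<forall>\<^sub>F n in sequentially. cis \<psi> * integral {r..real n} (\<lambda>s. g (of_real s * cis \<psi>))
          = F (of_nat n * cis \<psi>) - F (of_real r * cis \<psi>)"
        using eventually_ge_at_top[of "nat \<lceil>r\<rceil>"]
      proof eventually_elim
        case (elim n)
        then have "r \<le> real n" by (auto simp: nat_le_iff ceiling_le_iff)
        from integral_unique[OF ftc[OF this]] show ?case by (simp add: mult.commute)
      qed
    qed
  qed
  have "contour_integral (part_circlepath 0 r \<theta> \<phi>) g = F (of_real r * cis \<phi>) - F (of_real r * cis \<theta>)"
    using contour_integral_unique[OF contour_integral_primitive[of S F g "part_circlepath 0 r \<theta> \<phi>"]] F S(3)
    by (simp add: cis_conv_exp has_field_derivative_at_within)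
  then have eq: "sector_contour_integral r \<theta> \<phi> g
      = - (cis \<theta> * integral {r..} (\<lambda>s. g (of_real s * cis \<theta>)))
        + (F (of_real r * cis \<phi>) - F (of_real r * cis \<theta>)) + cis \<phi> * integral {r..} (\<lambda>s. g (of_real s * cis \<phi>))"
    by (simp add: sector_contour_integral_def)
  \<comment> \<open>The values of \<open>F\<close> at radius \<open>r\<close>, where arc and rays
    meet, cancel.\<close>
  have "(\<lambda>n. - (F (of_nat n * cis \<theta>) - F (of_real r * cis \<theta>)) + (F (of_real r * cis \<phi>) - F (of_real r * cis \<theta>))
      + (F (of_nat n * cis \<phi>) - F (of_real r * cis \<phi>))) \<longlonglongrightarrow> sector_contour_integral r \<theta> \<phi> g"
    unfolding eq using g S unfolding sector_contour_integrable_def by (intro tendsto_intros ray) auto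
  then show ?thesis by simp
qed

lemma sector_contour_integral_reflect:
  "sector_contour_integral r \<theta> \<phi> (\<lambda>k. g (- k)) = - sector_contour_integral r (\<theta> + pi) (\<phi> + pi) g" (is ?eq)
  "sector_contour_integrable r \<theta> \<phi> (\<lambda>k. g (- k)) \<longleftrightarrow> sector_contour_integrable r (\<theta> + pi) (\<phi> + pi) g" (is ?iff)
proof -
  have cis: "cis (\<psi> + pi) = - cis \<psi>" for \<psi>
    by (simp add: cis.ctr complex_eq_iff)
  have path: "part_circlepath 0 r (\<theta> + pi) (\<phi> + pi) = uminus \<circ> part_circlepath 0 r \<theta> \<phi>"
  proof
    fix x
    have "linepath (\<theta> + pi) (\<phi> + pi) x = linepath \<theta> \<phi> x + pi"
      by (simp add: linepath_def algebra_simps)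
    then have "cis (linepath (\<theta> + pi) (\<phi> + pi) x) = - cis (linepath \<theta> \<phi> x)"
      by (simp only: cis)
    then show "part_circlepath 0 r (\<theta> + pi) (\<phi> + pi) x = (uminus \<circ> part_circlepath 0 r \<theta> \<phi>) x"
      by (simp add: part_circlepath_def cis_conv_exp)
  qed
  have path': "part_circlepath 0 r \<theta> \<phi> = uminus \<circ> part_circlepath 0 r (\<theta> + pi) (\<phi> + pi)"
    unfolding path by (simp add: fun_eq_iff)
  have "g contour_integrable_on part_circlepath 0 r (\<theta> + pi) (\<phi> + pi)
      \<longleftrightarrow> (\<lambda>k. g (- k)) contour_integrable_on part_circlepath 0 r \<theta> \<phi>"
    using contour_integrable_negatepath[of "part_circlepath 0 r \<theta> \<phi>" g]
      contour_integrable_negatepath[of "part_circlepath 0 r (\<theta> + pi) (\<phi> + pi)" "\<lambda>k. g (- k)"]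
    by (auto simp flip: path path')
  then show ?iff
    by (simp add: sector_contour_integrable_def cis)
  show ?eq
    unfolding sector_contour_integral_def path contour_integral_negatepath[OF valid_path_part_circlepath]
    by (simp add: cis)
qed

text \<open>\<open>k \<mapsto> - k\<close> adds \<open>pi\<close> to the angles and carries the
  lower contour to the upper one; the sign comes from the reversed direction of \<open>dk\<close>.
  Statements about the upper contour are thereby reduced to the lower one.\<close>

lemma D0_plus_reflect:
  "D0_plus_integral r g = - D0_minus_integral r (\<lambda>k. g (- k))"
  "D0_plus_integrable r g \<longleftrightarrow> D0_minus_integrable r (\<lambda>k. g (- k))"
  using sector_contour_integral_reflect[of r "- pi / 4" "- 3 * pi / 4" g] by (simp_all add: field_simps)

lemma sector_contour_integral_add:
  assumes "sector_contour_integrable r \<theta> \<phi> f" "sector_contour_integrable r \<theta> \<phi> g"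
  shows "sector_contour_integrable r \<theta> \<phi> (\<lambda>k. f k + g k)"
    "sector_contour_integral r \<theta> \<phi> (\<lambda>k. f k + g k) = sector_contour_integral r \<theta> \<phi> f + sector_contour_integral r \<theta> \<phi> g"
  using assms unfolding sector_contour_integrable_def sector_contour_integral_def
  by (simp_all add: set_integral_add(1) contour_integrable_add contour_integral_add integral_add
      set_lebesgue_integral_eq_integral(1) algebra_simps)

lemma sector_contour_integral_cmult:
  assumes "sector_contour_integrable r \<theta> \<phi> f"
  shows "sector_contour_integrable r \<theta> \<phi> (\<lambda>k. c * f k)"
    "sector_contour_integral r \<theta> \<phi> (\<lambda>k. c * f k) = c * sector_contour_integral r \<theta> \<phi> f"
  using assms unfolding sector_contour_integrable_def sector_contour_integral_def
  by (simp_all add: contour_integrable_lmul contour_integral_lmul algebra_simps)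

lemma cis_D0_minus:
  "cis (- pi / 4) = Complex (sqrt 2 / 2) (- (sqrt 2 / 2))"
  "cis (- 3 * pi / 4) = Complex (- (sqrt 2 / 2)) (- (sqrt 2 / 2))"
proof -
  have "cos (3 * pi / 4) = cos (pi - pi / 4)" "sin (3 * pi / 4) = sin (pi - pi / 4)"
    by (simp_all add: field_simps)
  then have "cos (3 * pi / 4) = - (sqrt 2 / 2)" "sin (3 * pi / 4) = sqrt 2 / 2"
    unfolding cos_pi_minus sin_pi_minus cos_45 sin_45 by auto
  then show "cis (- pi / 4) = Complex (sqrt 2 / 2) (- (sqrt 2 / 2))"
    "cis (- 3 * pi / 4) = Complex (- (sqrt 2 / 2)) (- (sqrt 2 / 2))"
    by (simp_all add: complex_eq_iff cos_45 sin_45)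
qed

lemma Re_power2_cis_D0_minus: "Re ((of_real s * cis (- pi / 4))\<^sup>2) = 0" "Re ((of_real s * cis (- 3 * pi / 4))\<^sup>2) = 0"
  unfolding cis_D0_minus by (simp_all add: power2_eq_square)

lemma arc_D0_minus:
  assumes "r > 0" "k \<in> path_image (part_circlepath 0 r (- pi / 4) (- 3 * pi / 4))"
  shows "Im k < 0" "norm k = r"
proof -
  obtain y where y: "- 3 * pi / 4 \<le> y" "y \<le> - pi / 4" and k: "k = of_real r * cis y"
    using assms(2) unfolding path_image_part_circlepath' by (auto simp: closed_segment_eq_real_ivl split: if_splits)
  have "sin (- y) > 0" using y pi_gt_zero by (intro sin_gt_zero) linarith+
  then show "Im k < 0" using assms(1) by (simp add: k mult_pos_neg)
  show "norm k = r" using assms(1) by (simp add: k norm_mult)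
qed

text \<open>The arc is compact inside the domain of holomorphy, so decay matters only along the two
  rays, which are where \<open>Re (k^2) = 0\<close>.\<close>

lemma D0_minus_integrable_exp_majorant:
  assumes r: "r > 0" and h: "h holomorphic_on {k. Im k < 0}" and c: "c > 0"
    and bound: "\<And>k. Im k < 0 \<Longrightarrow> Re (k\<^sup>2) = 0 \<Longrightarrow> norm k \<ge> r \<Longrightarrow> norm (h k) \<le> C * exp (- c * norm k)"
  shows "D0_minus_integrable r h"
proof -
  have cont: "continuous_on {k. Im k < 0} h"
    using h by (rule holomorphic_on_imp_continuous_on)
  have ray: "(\<lambda>s. h (of_real s * cis \<psi>)) absolutely_integrable_on {r..}"
    if Im: "Im (cis \<psi>) < 0" and Re: "\<And>s. Re ((of_real s * cis \<psi>)\<^sup>2) = 0" for \<psi>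
  proof (rule absolutely_integrable_exp_majorant_ray[OF _ c])
    show "continuous_on {r..} (\<lambda>s. h (of_real s * cis \<psi>))"
      using Im r by (intro continuous_on_compose2[OF cont] continuous_intros) (auto simp: mult_pos_neg)
    show "norm (h (of_real s * cis \<psi>)) \<le> C * exp (- c * s)" if "s \<ge> r" for s
      using bound[of "of_real s * cis \<psi>"] Im Re[of s] that r by (simp add: norm_mult mult_pos_neg)
  qed
  show ?thesis
    unfolding sector_contour_integrable_def
  proof (intro conjI ray Re_power2_cis_D0_minus contour_integrable_continuous_part_circlepath)
    show "continuous_on (path_image (part_circlepath 0 r (- pi / 4) (- 3 * pi / 4))) h"
      by (rule continuous_on_subset[OF cont]) (use arc_D0_minus[OF r] in auto)
  qed (unfold cis_D0_minus, auto)
qed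

lemma linear_times_exp_tendsto_0:
  assumes "c > 0"
  shows "(\<lambda>n. C * exp (- c * real n) * (2 * real n)) \<longlonglongrightarrow> 0"
  using assms by real_asymp

text \<open>A primitive on the half plane turns the integral into the limit of the difference of its
  values at far points of the two rays. These points are joined by a chord, on which the integrand
  is exponentially small while its length grows linearly. A chord, unlike an arc, fits the mean
  value inequality on convex sets.\<close>

lemma D0_minus_integral_eq_0:
  assumes r: "r > 0" and h: "h holomorphic_on {k. Im k < 0}" and c: "c > 0"
    and bound: "\<And>k. Im k < 0 \<Longrightarrow> Re (k\<^sup>2) \<le> 0 \<Longrightarrow> norm k \<ge> r \<Longrightarrow> norm (h k) \<le> C * exp (- c * norm k)"
  shows "D0_minus_integrable r h" "D0_minus_integral r h = 0"
proof -
  show int: "D0_minus_integrable r h"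
    using bound by (intro D0_minus_integrable_exp_majorant[OF r h c, of C]) auto
  obtain F where F: "\<And>k. Im k < 0 \<Longrightarrow> (F has_field_derivative h k) (at k)"
    using holomorphic_convex_primitive'[OF convex_halfspace_Im_lt open_halfspace_Im_lt h]
    by (metis mem_Collect_eq at_within_open open_halfspace_Im_lt)
  have lim: "(\<lambda>n. F (of_nat n * cis (- 3 * pi / 4)) - F (of_nat n * cis (- pi / 4))) \<longlonglongrightarrow> D0_minus_integral r h"
  proof (rule sector_contour_integral_primitive[OF r int, of "{k. Im k < 0}"])
    show "of_real s * cis (- pi / 4) \<in> {k. Im k < 0}" "of_real s * cis (- 3 * pi / 4) \<in> {k. Im k < 0}" if "s \<ge> r" for s
      using that r unfolding cis_D0_minus by simp_all
  qed (use F arc_D0_minus[OF r] in auto)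
  \<comment> \<open>The sine of \<open>pi / 4\<close>: the chord joining the points of modulus
    \<open>n\<close> on the two rays lies at depth \<open>n * q\<close> below the real axis.\<close>
  define q where "q = sqrt 2 / 2"
  have q: "q > 0" by (simp add: q_def)
  have C: "C \<ge> 0"
  proof -
    have "norm (h (- \<i> * of_real r)) \<le> C * exp (- c * norm (- \<i> * of_real r))"
      using r by (intro bound) (auto simp: power_mult_distrib norm_mult)
    then have "0 \<le> C * exp (- c * norm (- \<i> * of_real r))"
      using norm_ge_zero order_trans by blast
    then show ?thesis by (simp add: zero_le_mult_iff)
  qed
  have "(\<lambda>n. F (of_nat n * cis (- 3 * pi / 4)) - F (of_nat n * cis (- pi / 4))) \<longlonglongrightarrow> 0"
  proof (rule tendsto_norm_zero_cancel, rule tendsto_sandwich[OF _ _ tendsto_const])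
    show "(\<lambda>n. C * exp (- (c * q) * real n) * (2 * real n)) \<longlonglongrightarrow> 0"
      using c q by (intro linear_times_exp_tendsto_0) auto
    show "\<forall>\<^sub>F n in sequentially. norm (F (of_nat n * cis (- 3 * pi / 4)) - F (of_nat n * cis (- pi / 4)))
        \<le> C * exp (- (c * q) * real n) * (2 * real n)"
      using eventually_ge_at_top[of "nat \<lceil>r / q\<rceil>"]
    proof eventually_elim
      case (elim n)
      then have n: "real n * q \<ge> r"
        using q by (auto simp: nat_le_iff ceiling_le_iff field_simps)
      \<comment> \<open>The part of the closed sector between the rays that lies on or below the
        chord. Being cut out by linear inequalities it is convex, and they imply
        \<open>Re (k^2) \<le> 0\<close> and \<open>norm k \<ge> n * q\<close>.\<close>
      define Q where "Q = {k. Im k \<le> - (real n * q)} \<inter> {k. inner (Complex 1 1) k \<le> 0} \<inter> {k. inner (Complex (- 1) 1) k \<le> 0}"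
      have "norm (F (of_nat n * cis (- 3 * pi / 4)) - F (of_nat n * cis (- pi / 4)))
        \<le> C * exp (- (c * q) * real n) * norm (of_nat n * cis (- 3 * pi / 4) - of_nat n * cis (- pi / 4))"
      proof (rule field_differentiable_bound[of Q F h])
        show "convex Q" unfolding Q_def
          by (intro convex_Int convex_halfspace_le convex_halfspace_Im_le)
        fix k assume k: "k \<in> Q"
        have Im: "Im k \<le> - (real n * q)" and Re: "\<bar>Re k\<bar> \<le> - Im k"
          using k by (auto simp: Q_def inner_complex_def)
        have neg: "Im k < 0" using Im n r by linarith
        then show "(F has_field_derivative h k) (at k within Q)"
          by (rule has_field_derivative_at_within[OF F])
        have nk: "norm k \<ge> real n * q" using abs_Im_le_cmod[of k] Im by linarith
        have "(Re k)\<^sup>2 \<le> (Im k)\<^sup>2" by (rule abs_le_square_iff[THEN iffD1]) (use Re in linarith)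
        then have "norm (h k) \<le> C * exp (- c * norm k)"
          using neg nk n by (intro bound) (auto simp: power2_eq_square)
        also have "\<dots> \<le> C * exp (- (c * q) * real n)"
          using C c nk by (intro mult_left_mono) (auto simp: mult_ac mult_left_mono)
        finally show "norm (h k) \<le> C * exp (- (c * q) * real n)" .
      qed (unfold Q_def cis_D0_minus q_def, auto simp: inner_complex_def)
      also have "norm (of_nat n * cis (- 3 * pi / 4) - of_nat n * cis (- pi / 4)) \<le> 2 * real n"
        using norm_triangle_ineq4[of "of_nat n * cis (- 3 * pi / 4)" "of_nat n * cis (- pi / 4)"] by (simp add: norm_mult)
      finally show ?case using C by (simp add: mult_left_mono)
    qed
  qed auto
  from LIMSEQ_unique[OF lim this] show "D0_minus_integral r h = 0" .
qed

lemma D0_plus_integral_eq_0: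
  assumes r: "r > 0" and h: "h holomorphic_on {k. Im k > 0}" and c: "c > 0"
    and bound: "\<And>k. Im k > 0 \<Longrightarrow> Re (k\<^sup>2) \<le> 0 \<Longrightarrow> norm k \<ge> r \<Longrightarrow> norm (h k) \<le> C * exp (- c * norm k)"
  shows "D0_plus_integrable r h" "D0_plus_integral r h = 0"
proof -
  have "(\<lambda>k. h (- k)) holomorphic_on {k. Im k < 0}"
    by (rule holomorphic_on_compose_gen[OF _ h, unfolded o_def]) (auto intro!: holomorphic_intros)
  moreover have "norm (h (- k)) \<le> C * exp (- c * norm k)" if "Im k < 0" "Re (k\<^sup>2) \<le> 0" "norm k \<ge> r" for k
    using bound[of "- k"] that by simp
  ultimately show "D0_plus_integrable r h" "D0_plus_integral r h = 0"
    unfolding D0_plus_reflect using D0_minus_integral_eq_0[OF r _ c, of "\<lambda>k. h (- k)" C] by simp_all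
qed

text \<open>The primitive is now entire, so the passage around the origin is harmless. Each far end
  of the real line is joined to the far end of the adjacent ray by a chord on which \<open>h\<close>
  is exponentially small. The sign appears because the lower contour runs from right to
  left.\<close>

lemma line_integral_eq_D0_minus_integral:
  assumes r: "r > 0" and h: "h holomorphic_on UNIV" and c: "c > 0"
    and bound: "\<And>k. Im k \<le> 0 \<Longrightarrow> Re (k\<^sup>2) \<ge> 0 \<Longrightarrow> norm (h k) \<le> C * exp (- c * norm k)"
  shows "(\<lambda>k::real. h (of_real k)) absolutely_integrable_on UNIV" "D0_minus_integrable r h"
    "integral UNIV (\<lambda>k::real. h (of_real k)) = - D0_minus_integral r h"
proof -
  have cont: "continuous_on UNIV h"
    using h by (rule holomorphic_on_imp_continuous_on)
  show line: "(\<lambda>k::real. h (of_real k)) absolutely_integrable_on UNIV"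
  proof (rule absolutely_integrable_exp_majorant_line[OF _ c])
    show "continuous_on UNIV (\<lambda>k::real. h (of_real k))"
      by (intro continuous_on_compose2[OF cont] continuous_intros) auto
    show "norm (h (of_real k)) \<le> C * exp (- c * \<bar>k\<bar>)" for k :: real
      using bound[of "of_real k"] by simp
  qed
  show int: "D0_minus_integrable r h"
    using bound by (intro D0_minus_integrable_exp_majorant[OF r _ c, of h C] holomorphic_on_subset[OF h]) auto
  obtain F where F: "\<And>k. (F has_field_derivative h k) (at k)"
    using holomorphic_convex_primitive'[OF convex_UNIV open_UNIV h] by auto
  have ftc: "integral {- real n..real n} (\<lambda>k. h (of_real k)) = F (of_nat n) - F (- of_nat n)" for n
  proof -
    have "((\<lambda>k. h (of_real k)) has_integral F (of_real (real n)) - F (of_real (- real n))) {- real n..real n}"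
      by (rule fundamental_theorem_of_calculus) (auto intro: has_vector_derivative_real_field F)
    then show ?thesis by (simp add: integral_unique)
  qed
  have lim1: "(\<lambda>n. F (of_nat n) - F (- of_nat n)) \<longlonglongrightarrow> integral UNIV (\<lambda>k. h (of_real k))"
    using integral_symmetric_interval_tendsto[OF line] unfolding ftc .
  have lim2: "(\<lambda>n. F (of_nat n * cis (- 3 * pi / 4)) - F (of_nat n * cis (- pi / 4))) \<longlonglongrightarrow> D0_minus_integral r h"
    by (rule sector_contour_integral_primitive[OF r int, of UNIV]) (use F in auto)
  define q where "q = sqrt 2 / 2"
  have q: "q > 0" "q \<le> 1" using real_le_lsqrt[of 2 2] by (auto simp: q_def)
  have C: "C \<ge> 0"
    using bound[of 0] norm_ge_zero[of "h 0"] by (simp del: norm_ge_zero)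
  \<comment> \<open>\<open>e = 1\<close> is the right corner and \<open>e = - 1\<close> the left
    one. The convex set \<open>Q\<close> used below is the octant between the half axis and the
    adjacent ray, cut off where \<open>\<bar>Re k\<bar>\<close> is less than \<open>n * q\<close>;
    it contains both ends of the chord.\<close>
  have corner: "(\<lambda>n. F (of_nat n * z) - F (of_nat n * w)) \<longlonglongrightarrow> 0"
    if e: "e \<in> {1, - 1}" and z: "z = of_real e" and w: "w = Complex (e * q) (- q)" and "norm w = 1" for e z w
  proof (rule tendsto_norm_zero_cancel, rule tendsto_sandwich[OF _ _ tendsto_const])
    show "(\<lambda>n. C * exp (- (c * q) * real n) * (2 * real n)) \<longlonglongrightarrow> 0"
      using c q by (intro linear_times_exp_tendsto_0) auto
    show "\<forall>\<^sub>F n in sequentially. norm (F (of_nat n * z) - F (of_nat n * w)) \<le> C * exp (- (c * q) * real n) * (2 * real n)"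
    proof (rule always_eventually, rule allI)
      fix n
      define Q where "Q = {k. inner (of_real e) k \<ge> real n * q} \<inter> {k. inner (Complex e 1) k \<ge> 0} \<inter> {k. Im k \<le> 0}"
      have "norm (F (of_nat n * z) - F (of_nat n * w)) \<le> C * exp (- (c * q) * real n) * norm (of_nat n * z - of_nat n * w)"
      proof (rule field_differentiable_bound[of Q F h])
        show "convex Q" unfolding Q_def
          by (intro convex_Int convex_halfspace_ge convex_halfspace_Im_le)
        fix k assume k: "k \<in> Q"
        show "(F has_field_derivative h k) (at k within Q)"
          by (rule has_field_derivative_at_within[OF F])
        have Im: "Im k \<le> 0" and Re: "\<bar>Im k\<bar> \<le> \<bar>Re k\<bar>" "real n * q \<le> \<bar>Re k\<bar>"
          using k e by (auto simp: Q_def inner_complex_def)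
        have nk: "norm k \<ge> real n * q" using abs_Re_le_cmod[of k] Re by linarith
        have "(Im k)\<^sup>2 \<le> (Re k)\<^sup>2" by (rule abs_le_square_iff[THEN iffD1]) (use Re in linarith)
        then have "norm (h k) \<le> C * exp (- c * norm k)"
          using Im by (intro bound) (auto simp: power2_eq_square)
        also have "\<dots> \<le> C * exp (- (c * q) * real n)"
          using C c nk by (intro mult_left_mono) (auto simp: mult_ac mult_left_mono)
        finally show "norm (h k) \<le> C * exp (- (c * q) * real n)" .
      next
        show "of_nat n * z \<in> Q" using e q by (auto simp: Q_def z inner_complex_def mult_left_le)
        show "of_nat n * w \<in> Q" using e q by (auto simp: Q_def w inner_complex_def)
      qed
      also have "norm (of_nat n * z - of_nat n * w) \<le> 2 * real n"
        using norm_triangle_ineq4[of "of_nat n * z" "of_nat n * w"] e z that(4) by (auto simp: norm_mult)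
      finally show "norm (F (of_nat n * z) - F (of_nat n * w)) \<le> C * exp (- (c * q) * real n) * (2 * real n)"
        using C by (simp add: mult_left_mono)
    qed
  qed auto
  have c1: "(\<lambda>n. F (of_nat n * 1) - F (of_nat n * cis (- pi / 4))) \<longlonglongrightarrow> 0"
    by (rule corner[of 1, OF _ _ _ norm_cis]) (simp, simp, unfold cis_D0_minus q_def, simp)
  have c2: "(\<lambda>n. F (of_nat n * (- 1)) - F (of_nat n * cis (- 3 * pi / 4))) \<longlonglongrightarrow> 0"
    by (rule corner[of "- 1", OF _ _ _ norm_cis]) (simp, simp, unfold cis_D0_minus q_def, simp)
  have "(\<lambda>n. (F (of_nat n * 1) - F (of_nat n * cis (- pi / 4))) - (F (of_nat n * (- 1)) - F (of_nat n * cis (- 3 * pi / 4)))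
      - (F (of_nat n * cis (- 3 * pi / 4)) - F (of_nat n * cis (- pi / 4)))) \<longlonglongrightarrow> 0 - 0 - D0_minus_integral r h"
    by (intro tendsto_diff c1 c2 lim2)
  then have "(\<lambda>n. F (of_nat n) - F (- of_nat n)) \<longlonglongrightarrow> - D0_minus_integral r h"
    by simp
  from LIMSEQ_unique[OF lim1 this] show "integral UNIV (\<lambda>k::real. h (of_real k)) = - D0_minus_integral r h" .
qed

section \<open>Boundary terms\<close>

lemma absolutely_integrable_UNIV_reflect:
  fixes f :: "real \<Rightarrow> complex"
  assumes "f absolutely_integrable_on UNIV"
  shows "(\<lambda>x. f (- x)) absolutely_integrable_on UNIV"
proof (rule absolutely_integrable_componentwise)
  fix b :: complex assume "b \<in> Basis"
  then have "(\<lambda>x. f x \<bullet> b) absolutely_integrable_on UNIV"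
    using assms by (subst (asm) absolutely_integrable_componentwise_iff) blast
  then show "(\<lambda>x. f (- x) \<bullet> b) absolutely_integrable_on UNIV"
    using has_absolute_integral_reflect_real[of UNIV UNIV "\<lambda>x. f x \<bullet> b"] by auto
qed

lemma norm_gaussian:
  "norm (exp (- (of_real \<delta> * k)\<^sup>2 / 2)) = exp (- (\<delta>\<^sup>2 * Re (k\<^sup>2) / 2))"
proof -
  have "Re ((of_real \<delta> * k)\<^sup>2) = \<delta>\<^sup>2 * Re (k\<^sup>2)"
    unfolding power_mult_distrib by (simp flip: of_real_power)
  then show ?thesis unfolding norm_exp_eq_Re by simp
qed

lemma gaussian_tendsto_1:
  assumes "\<delta> \<longlonglongrightarrow> 0"
  shows "(\<lambda>n. exp (- (of_real (\<delta> n) * k)\<^sup>2 / 2) :: complex) \<longlonglongrightarrow> 1"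
proof -
  have "(\<lambda>n. exp (- (of_real (\<delta> n) * k)\<^sup>2 / 2) :: complex) \<longlonglongrightarrow> exp (- (of_real 0 * k)\<^sup>2 / 2)"
    by (intro tendsto_intros assms) auto
  then show ?thesis by simp
qed

text \<open>On the rays the Gaussian has modulus one, so \<open>norm (g k)\<close> is a majorant for
  dominated convergence. On the arc the modulus may exceed one, but there \<open>norm k = r\<close>
  and the factor tends to 1 uniformly.\<close>

lemma D0_minus_gaussian_limit:
  assumes r: "r > 0" and g: "g holomorphic_on {k. Im k < 0}" "D0_minus_integrable r g"
    and int: "\<And>n. D0_minus_integrable r (\<lambda>k. exp (- (of_real (\<delta> n) * k)\<^sup>2 / 2) * g k)"
    and \<delta>: "\<delta> \<longlonglongrightarrow> 0"
  shows "(\<lambda>n. D0_minus_integral r (\<lambda>k. exp (- (of_real (\<delta> n) * k)\<^sup>2 / 2) * g k)) \<longlonglongrightarrow> D0_minus_integral r g"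
proof -
  let ?G = "\<lambda>n k. exp (- (of_real (\<delta> n) * k)\<^sup>2 / 2) :: complex"
  let ?\<gamma> = "part_circlepath 0 r (- pi / 4) (- 3 * pi / 4)"
  have ray: "(\<lambda>n. integral {r..} (\<lambda>s. ?G n (of_real s * cis \<psi>) * g (of_real s * cis \<psi>)))
      \<longlonglongrightarrow> integral {r..} (\<lambda>s. g (of_real s * cis \<psi>))"
    if Re: "\<And>s. Re ((of_real s * cis \<psi>)\<^sup>2) = 0"
      and g: "(\<lambda>s. g (of_real s * cis \<psi>)) absolutely_integrable_on {r..}"
      and Gg: "\<And>n. (\<lambda>s. ?G n (of_real s * cis \<psi>) * g (of_real s * cis \<psi>)) absolutely_integrable_on {r..}" for \<psi>
  proof (rule dominated_convergence(2)[where h = "\<lambda>s. norm (g (of_real s * cis \<psi>))"])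
    show "(\<lambda>s. ?G n (of_real s * cis \<psi>) * g (of_real s * cis \<psi>)) integrable_on {r..}" for n
      using Gg[of n] by (simp add: absolutely_integrable_on_def)
    show "(\<lambda>s. norm (g (of_real s * cis \<psi>))) integrable_on {r..}"
      using g by (simp add: absolutely_integrable_on_def)
    show "norm (?G n (of_real s * cis \<psi>) * g (of_real s * cis \<psi>)) \<le> norm (g (of_real s * cis \<psi>))" for n s
      unfolding norm_mult norm_gaussian Re by simp
    show "(\<lambda>n. ?G n (of_real s * cis \<psi>) * g (of_real s * cis \<psi>)) \<longlonglongrightarrow> g (of_real s * cis \<psi>)" for s
      using tendsto_mult[OF gaussian_tendsto_1[OF \<delta>] tendsto_const, of "of_real s * cis \<psi>" "g (of_real s * cis \<psi>)"] by simp
  qed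
  have arc: "(\<lambda>n. contour_integral ?\<gamma> (\<lambda>k. ?G n k * g k)) \<longlonglongrightarrow> contour_integral ?\<gamma> g"
  proof (rule contour_integral_uniform_limit(2))
    show "\<forall>\<^sub>F n in sequentially. (\<lambda>k. ?G n k * g k) contour_integrable_on ?\<gamma>"
      using int by (auto simp: sector_contour_integrable_def)
    show "norm (vector_derivative ?\<gamma> (at x)) \<le> r * pi" for x
    proof -
      have "norm (of_real (- 3 * pi / 4) - of_real (- pi / 4) :: complex) \<le> pi"
        unfolding of_real_diff[symmetric] norm_of_real using pi_gt_zero by auto
      then show ?thesis
        using r by (auto simp: vector_derivative_part_circlepath norm_mult norm_exp_i_times mult_left_mono simp del: of_real_diff)
    qed
    have "continuous_on (path_image ?\<gamma>) g"
      by (rule continuous_on_subset[OF holomorphic_on_imp_continuous_on[OF g(1)]]) (use arc_D0_minus[OF r] in auto)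
    then have "compact (g ` path_image ?\<gamma>)"
      by (intro compact_continuous_image compact_path_image) auto
    then obtain M where M: "\<And>k. k \<in> path_image ?\<gamma> \<Longrightarrow> norm (g k) \<le> M" and "M > 0"
      using compact_imp_bounded bounded_pos by (metis imageI)
    show "uniform_limit (path_image ?\<gamma>) (\<lambda>n k. ?G n k * g k) g sequentially"
    proof (rule uniform_limitI)
      fix e :: real assume "e > 0"
      then have "e / M > 0" using \<open>M > 0\<close> by simp
      moreover have "isCont (exp :: complex \<Rightarrow> complex) 0" by simp
      ultimately obtain d where d: "d > 0" "\<And>w :: complex. norm w < d \<Longrightarrow> norm (exp w - 1) < e / M"
        unfolding continuous_at_eps_delta by (auto simp: dist_norm)
      have "(\<lambda>n. (\<delta> n * r)\<^sup>2 / 2) \<longlonglongrightarrow> (0 * r)\<^sup>2 / 2"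
        by (intro tendsto_intros \<delta>) auto
      then have "\<forall>\<^sub>F n in sequentially. (\<delta> n * r)\<^sup>2 / 2 < d"
        using d(1) by (intro order_tendstoD(2)) auto
      then show "\<forall>\<^sub>F n in sequentially. \<forall>k\<in>path_image ?\<gamma>. dist (?G n k * g k) (g k) < e"
      proof eventually_elim
        case (elim n)
        show ?case
        proof
          fix k assume k: "k \<in> path_image ?\<gamma>"
          have "norm (- (of_real (\<delta> n) * k)\<^sup>2 / 2) = (\<delta> n * r)\<^sup>2 / 2"
            using arc_D0_minus(2)[OF r k] by (simp add: norm_divide norm_power norm_mult power_mult_distrib)
          then have "norm (?G n k - 1) < e / M" using d(2) elim by simp
          then have "norm (?G n k - 1) * M < e"
            using \<open>M > 0\<close> by (simp only: pos_less_divide_eq)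
          moreover have "norm (?G n k - 1) * norm (g k) \<le> norm (?G n k - 1) * M"
            using M[OF k] by (intro mult_left_mono) auto
          ultimately show "dist (?G n k * g k) (g k) < e"
            unfolding dist_norm norm_mult[symmetric] left_diff_distrib by simp
        qed
      qed
    qed
  qed auto
  show ?thesis
    unfolding sector_contour_integral_def
    using g(2) int unfolding sector_contour_integrable_def
    by (intro tendsto_intros ray arc Re_power2_cis_D0_minus) auto
qed

text \<open>Used to pay for the linear growth of the boundary densities with part of an exponential
  decay rate.\<close>

lemma one_plus_le_exp:
  fixes c x :: real
  assumes "c > 0" "x \<ge> 0"
  shows "1 + x \<le> (1 + 1 / c) * exp (c * x)"
proof -
  have "1 + x \<le> (1 + 1 / c) * (1 + c * x)"
    using assms by (simp add: field_simps)
  also have "\<dots> \<le> (1 + 1 / c) * exp (c * x)"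
    using assms exp_ge_add_one_self[of "c * x"] by (intro mult_left_mono) auto
  finally show ?thesis .
qed

text \<open>From \<open>Re (k^2) = norm k ^ 2 - 2 * Im k ^ 2\<close>. The threshold 1/2 separates
  the two sources of decay: below it the Gaussian is small, above it the exponential in
  \<open>Im k\<close> is.\<close>

lemma norm_Im_sector:
  assumes "\<bar>Im k\<bar> < norm k / 2"
  shows "Re (k\<^sup>2) \<ge> (norm k)\<^sup>2 / 2"
proof -
  have "(Im k)\<^sup>2 \<le> (norm k / 2)\<^sup>2"
    by (rule abs_le_square_iff[THEN iffD1]) (use assms in linarith)
  moreover have "(norm k)\<^sup>2 = (Re k)\<^sup>2 + (Im k)\<^sup>2" by (rule cmod_power2)
  ultimately show ?thesis by (simp add: power2_eq_square)
qed

text \<open>Between the real line and the lower contour, the Gaussian and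
  \<open>exp (- \<i> * k * d)\<close> together dominate the linear growth of \<open>A\<close>, so
  the regularised integral can be moved. On the contour the second factor alone ensures
  integrability, and the Gaussian can be removed.\<close>

lemma boundary_term_minus:
  assumes r: "r > 0" and d: "d > 0" and A: "A holomorphic_on UNIV"
    and bound: "\<And>k. Re (k\<^sup>2) \<ge> 0 \<Longrightarrow> norm (A k) \<le> C * (1 + norm k)"
    and \<delta>: "\<And>n. \<delta> n > 0" "\<delta> \<longlonglongrightarrow> 0"
  defines "g \<equiv> \<lambda>k. exp (- \<i> * k * of_real d) * A k"
  shows "D0_minus_integrable r g"
    "(\<lambda>k::real. exp (- (of_real (\<delta> n) * of_real k)\<^sup>2 / 2) * g (of_real k)) absolutely_integrable_on UNIV"
    "(\<lambda>n. integral UNIV (\<lambda>k::real. exp (- (of_real (\<delta> n) * of_real k)\<^sup>2 / 2) * g (of_real k)))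
      \<longlonglongrightarrow> - D0_minus_integral r g"
proof -
  let ?G = "\<lambda>n k. exp (- (of_real (\<delta> n) * k)\<^sup>2 / 2) :: complex"
  have C: "C \<ge> 0" using bound[of 0] norm_ge_zero[of "A 0"] by (simp del: norm_ge_zero)
  have holg: "g holomorphic_on S" for S
    unfolding g_def by (intro holomorphic_intros holomorphic_on_subset[OF A]) auto
  have ng: "norm (g k) \<le> exp (d * Im k) * (C * (1 + norm k))" if "Re (k\<^sup>2) \<ge> 0" for k
    using bound[OF that] by (auto simp: g_def norm_mult mult.commute intro!: mult_left_mono)
  show int: "D0_minus_integrable r g"
  proof (rule D0_minus_integrable_exp_majorant[OF r holg])
    \<comment> \<open>On the rays \<open>\<bar>Im k\<bar> \<ge> norm k / 2\<close>, so the available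
      rate is \<open>d / 2\<close>; half of it is spent on the factor
      \<open>1 + norm k\<close>.\<close>
    show "d / 4 > 0" using d by simp
    fix k assume k: "Im k < 0" "Re (k\<^sup>2) = 0" "norm k \<ge> r"
    have "\<bar>Im k\<bar> \<ge> norm k / 2"
      using norm_Im_sector[of k] k r by (cases "\<bar>Im k\<bar> \<ge> norm k / 2") auto
    then have Im: "Im k \<le> - (norm k / 2)" using k by simp
    have "norm (g k) \<le> exp (d * Im k) * (C * (1 + norm k))" using ng k by simp
    also have "\<dots> \<le> exp (- (d * (norm k / 2))) * (C * ((1 + 1 / (d / 4)) * exp (d / 4 * norm k)))"
      using mult_left_mono[OF Im, of d] d C one_plus_le_exp[of "d / 4" "norm k"] by (intro mult_mono) (auto simp: mult_left_mono)
    also have "\<dots> = (C * (1 + 1 / (d / 4))) * (exp (- (d * (norm k / 2))) * exp (d / 4 * norm k))"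
      by (simp only: mult_ac)
    also have "exp (- (d * (norm k / 2))) * exp (d / 4 * norm k) = exp (- (d / 4) * norm k)"
      unfolding mult_exp_exp by (simp add: field_simps)
    finally show "norm (g k) \<le> (C * (1 + 1 / (d / 4))) * exp (- (d / 4) * norm k)" .
  qed
  have reg: "(\<lambda>k::real. ?G n (of_real k) * g (of_real k)) absolutely_integrable_on UNIV \<and>
      D0_minus_integrable r (\<lambda>k. ?G n k * g k) \<and>
      integral UNIV (\<lambda>k::real. ?G n (of_real k) * g (of_real k)) = - D0_minus_integral r (\<lambda>k. ?G n k * g k)" for n
  proof -
    \<comment> \<open>The weaker of the two rates. It is \<open>d / 2\<close> where
      \<open>\<bar>Im k\<bar> \<ge> norm k / 2\<close>. Elsewhere
      \<open>norm k ^ 2 \<ge> 2 * norm k - 1\<close> turns the Gaussian exponent into a linear one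
      with rate \<open>\<delta>\<^sup>2 / 2\<close>, at the price of the constant
      \<open>exp (\<delta>\<^sup>2 / 4)\<close>. Half of \<open>c\<close> then absorbs
      \<open>1 + norm k\<close>.\<close>
    define c where "c = min (d / 2) ((\<delta> n)\<^sup>2 / 2)"
    have c: "c > 0" using d \<delta>(1)[of n] by (simp add: c_def)
    have hol: "(\<lambda>k. ?G n k * g k) holomorphic_on UNIV"
      by (intro holomorphic_intros holg) auto
    have "norm (?G n k * g k) \<le> (exp ((\<delta> n)\<^sup>2 / 4) * (C * (1 + 1 / (c / 2)))) * exp (- (c / 2) * norm k)"
      if k: "Im k \<le> 0" "Re (k\<^sup>2) \<ge> 0" for k
    proof -
      have e: "- ((\<delta> n)\<^sup>2 * Re (k\<^sup>2) / 2) + d * Im k \<le> (\<delta> n)\<^sup>2 / 4 + - (c * norm k)"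
      proof (cases "\<bar>Im k\<bar> \<ge> norm k / 2")
        case True
        then have "d * Im k \<le> d * (- (norm k / 2))" using d k by (intro mult_left_mono) auto
        also have "\<dots> = - (d / 2 * norm k)" by simp
        also have "\<dots> \<le> - (c * norm k)"
          unfolding c_def neg_le_iff_le by (intro mult_right_mono) auto
        finally have "d * Im k \<le> - (c * norm k)" .
        moreover have "(\<delta> n)\<^sup>2 * Re (k\<^sup>2) / 2 \<ge> 0" using k by simp
        ultimately show ?thesis using zero_le_power2[of "\<delta> n"] by linarith
      next
        case False
        have "(norm k)\<^sup>2 \<ge> 2 * norm k - 1"
          using zero_le_power2[of "norm k - 1"] by (simp add: power2_diff)
        then have "Re (k\<^sup>2) \<ge> norm k - 1 / 2" using norm_Im_sector[of k] False by simp
        then have "(\<delta> n)\<^sup>2 / 2 * Re (k\<^sup>2) \<ge> (\<delta> n)\<^sup>2 / 2 * (norm k - 1 / 2)"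
          by (intro mult_left_mono) auto
        moreover have "(\<delta> n)\<^sup>2 / 2 * norm k \<ge> c * norm k"
          unfolding c_def by (intro mult_right_mono) auto
        moreover have "d * Im k \<le> 0" using d k by (simp add: mult_nonneg_nonpos)
        ultimately show ?thesis by (simp add: algebra_simps)
      qed
      have "norm (?G n k * g k) \<le> exp (- ((\<delta> n)\<^sup>2 * Re (k\<^sup>2) / 2)) * (exp (d * Im k) * (C * (1 + norm k)))"
        unfolding norm_mult norm_gaussian by (intro mult_left_mono ng k) auto
      also have "\<dots> = exp (- ((\<delta> n)\<^sup>2 * Re (k\<^sup>2) / 2) + d * Im k) * (C * (1 + norm k))"
        by (simp only: exp_add mult.assoc)
      also have "\<dots> \<le> exp ((\<delta> n)\<^sup>2 / 4 + - (c * norm k)) * (C * ((1 + 1 / (c / 2)) * exp (c / 2 * norm k)))"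
        using e C c one_plus_le_exp[of "c / 2" "norm k"] by (intro mult_mono) (auto simp: mult_left_mono)
      also have "\<dots> = (exp ((\<delta> n)\<^sup>2 / 4) * (C * (1 + 1 / (c / 2)))) * (exp (- (c * norm k)) * exp (c / 2 * norm k))"
        unfolding exp_add by (simp only: mult_ac)
      also have "exp (- (c * norm k)) * exp (c / 2 * norm k) = exp (- (c / 2) * norm k)"
        unfolding mult_exp_exp by (simp add: field_simps)
      finally show ?thesis .
    qed
    from line_integral_eq_D0_minus_integral[OF r hol _ this] c show ?thesis by simp
  qed
  then show "(\<lambda>k::real. ?G n (of_real k) * g (of_real k)) absolutely_integrable_on UNIV" by blast
  have "(\<lambda>n. - D0_minus_integral r (\<lambda>k. ?G n k * g k)) \<longlonglongrightarrow> - D0_minus_integral r g"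
    using reg by (intro tendsto_minus D0_minus_gaussian_limit[OF r holg int _ \<delta>(2)]) blast
  then show "(\<lambda>n. integral UNIV (\<lambda>k::real. ?G n (of_real k) * g (of_real k))) \<longlonglongrightarrow> - D0_minus_integral r g"
    using reg by simp
qed

lemma boundary_term_plus:
  assumes r: "r > 0" and d: "d > 0" and A: "A holomorphic_on UNIV"
    and bound: "\<And>k. Re (k\<^sup>2) \<ge> 0 \<Longrightarrow> norm (A k) \<le> C * (1 + norm k)"
    and \<delta>: "\<And>n. \<delta> n > 0" "\<delta> \<longlonglongrightarrow> 0"
  defines "g \<equiv> \<lambda>k. exp (\<i> * k * of_real d) * A k"
  shows "D0_plus_integrable r g"
    "(\<lambda>k::real. exp (- (of_real (\<delta> n) * of_real k)\<^sup>2 / 2) * g (of_real k)) absolutely_integrable_on UNIV"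
    "(\<lambda>n. integral UNIV (\<lambda>k::real. exp (- (of_real (\<delta> n) * of_real k)\<^sup>2 / 2) * g (of_real k)))
      \<longlonglongrightarrow> D0_plus_integral r g"
proof -
  let ?f = "\<lambda>n k. exp (- (of_real (\<delta> n) * of_real k)\<^sup>2 / 2) * g (of_real k)"
  have A': "(\<lambda>k. A (- k)) holomorphic_on UNIV"
    by (rule holomorphic_on_compose_gen[OF _ A, unfolded o_def]) (auto intro!: holomorphic_intros)
  have bound': "norm (A (- k)) \<le> C * (1 + norm k)" if "Re (k\<^sup>2) \<ge> 0" for k
    using bound[of "- k"] that by simp
  note minus = boundary_term_minus[OF r d A' bound' \<delta>]
  have g: "exp (- \<i> * k * of_real d) * A (- k) = g (- k)" for k
    by (simp add: g_def)
  show "D0_plus_integrable r g"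
    unfolding D0_plus_reflect using minus(1) unfolding g .
  have refl: "(\<lambda>k. exp (- (of_real (\<delta> n) * of_real k)\<^sup>2 / 2) * g (- of_real k)) = (\<lambda>k. ?f n (- k))" for n
    by simp
  have int': "(\<lambda>k. ?f n (- k)) absolutely_integrable_on UNIV" for n
    using minus(2)[of n] unfolding g refl .
  from absolutely_integrable_UNIV_reflect[OF this] show int: "?f n absolutely_integrable_on UNIV" for n
    by simp
  have "integral UNIV (\<lambda>k. ?f n (- k)) = integral UNIV (?f n)" for n
    by (rule integral_UNIV_reflect[OF int int'])
  then show "(\<lambda>n. integral UNIV (?f n)) \<longlonglongrightarrow> D0_plus_integral r g"
    unfolding D0_plus_reflect using minus(3) unfolding g refl by simp
qed

text \<open>The exponential factor keeps the time transforms bounded on \<open>Re (k\<^sup>2) \<ge> 0\<close>.\<close>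

definition boundary_density ::
  "real \<Rightarrow> (real \<Rightarrow> real \<Rightarrow> complex) \<Rightarrow> (real \<Rightarrow> real \<Rightarrow> complex) \<Rightarrow> real \<Rightarrow> real \<Rightarrow> complex \<Rightarrow> complex" where
  "boundary_density \<sigma> u ux t y k = of_real (\<sigma>\<^sup>2) * exp (- (of_real \<sigma> * k)\<^sup>2 * of_real t) *
    (time_hat (ux y) ((of_real \<sigma> * k)\<^sup>2) t + \<i> * k * time_hat (u y) ((of_real \<sigma> * k)\<^sup>2) t)"

lemma boundary_density_holomorphic:
  assumes "u y absolutely_integrable_on {0..t}" "ux y absolutely_integrable_on {0..t}"
  shows "boundary_density \<sigma> u ux t y holomorphic_on S"
  unfolding boundary_density_def by (intro holomorphic_intros time_hat_holomorphic assms)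

lemma boundary_density_bound:
  assumes u: "u y absolutely_integrable_on {0..t}" and ux: "ux y absolutely_integrable_on {0..t}"
  obtains C where "\<And>k. Re (k\<^sup>2) \<ge> 0 \<Longrightarrow> norm (boundary_density \<sigma> u ux t y k) \<le> C * (1 + norm k)"
proof -
  define I0 I1 where "I0 = integral {0..t} (\<lambda>s. norm (u y s))" and "I1 = integral {0..t} (\<lambda>s. norm (ux y s))"
  have I: "I0 \<ge> 0" "I1 \<ge> 0"
    unfolding I0_def I1_def using u ux
    by (auto intro!: integral_nonneg simp: absolutely_integrable_on_def)
  have "norm (boundary_density \<sigma> u ux t y k) \<le> (\<sigma>\<^sup>2 * (I0 + I1)) * (1 + norm k)" if k: "Re (k\<^sup>2) \<ge> 0" for k
  proof -
    define \<omega> where "\<omega> = (of_real \<sigma> * k)\<^sup>2"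
    have \<omega>: "Re \<omega> \<ge> 0"
      using k unfolding \<omega>_def power_mult_distrib by (simp flip: of_real_power)
    have th: "norm (exp (- \<omega> * of_real t) * time_hat f \<omega> t) \<le> integral {0..t} (\<lambda>s. norm (f s))"
      if "f absolutely_integrable_on {0..t}" for f
    proof -
      have "norm (exp (- \<omega> * of_real t) * time_hat f \<omega> t)
          \<le> exp (- (Re \<omega> * t)) * (exp (Re \<omega> * t) * integral {0..t} (\<lambda>s. norm (f s)))"
        unfolding norm_mult using time_hat_norm_le[OF that \<omega>] by (auto intro!: mult_left_mono)
      also have "\<dots> = integral {0..t} (\<lambda>s. norm (f s))"
        by (simp add: mult_exp_exp flip: mult.assoc)
      finally show ?thesis .
    qed
    have "boundary_density \<sigma> u ux t y k = of_real (\<sigma>\<^sup>2) *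
        (exp (- \<omega> * of_real t) * time_hat (ux y) \<omega> t + \<i> * k * (exp (- \<omega> * of_real t) * time_hat (u y) \<omega> t))"
      unfolding boundary_density_def \<omega>_def by (simp add: algebra_simps)
    also have "norm \<dots> \<le> \<sigma>\<^sup>2 * (I1 + norm k * I0)"
      unfolding norm_mult[of "of_real (\<sigma>\<^sup>2)"] norm_of_real abs_power2
    proof (intro mult_left_mono order_trans[OF norm_triangle_ineq] add_mono)
      show "norm (exp (- \<omega> * of_real t) * time_hat (ux y) \<omega> t) \<le> I1"
        unfolding I1_def by (rule th[OF ux])
      show "norm (\<i> * k * (exp (- \<omega> * of_real t) * time_hat (u y) \<omega> t)) \<le> norm k * I0"
        unfolding I0_def norm_mult[of "\<i> * k"] using th[OF u] by (auto intro!: mult_left_mono simp: norm_mult)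
    qed simp
    also have "\<dots> \<le> \<sigma>\<^sup>2 * ((I0 + I1) * (1 + norm k))"
      using I by (intro mult_left_mono) (auto simp: algebra_simps)
    finally show ?thesis by (simp only: mult.assoc)
  qed
  then show ?thesis using that by blast
qed

lemma absolutely_integrable_gaussian_fourier_hat:
  assumes v: "v absolutely_integrable_on {lo..hi}" and a: "\<sigma> > 0" "t > 0"
  shows "(\<lambda>k::real. exp (\<i> * of_real k * of_real x - (of_real \<sigma> * of_real k)\<^sup>2 * of_real t) *
    fourier_hat lo hi v (of_real k)) absolutely_integrable_on UNIV"
proof (rule absolutely_integrable_exp_majorant_line)
  have "fourier_hat lo hi v holomorphic_on UNIV"
    using fourier_hat_holomorphic[OF v, of "\<lambda>k. k" UNIV] by simp
  then have "continuous_on UNIV (fourier_hat lo hi v)"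
    by (rule holomorphic_on_imp_continuous_on)
  then have "continuous_on UNIV (\<lambda>k::real. fourier_hat lo hi v (of_real k))"
    by (rule continuous_on_compose2) (auto intro!: continuous_intros)
  then show "continuous_on UNIV (\<lambda>k::real. exp (\<i> * of_real k * of_real x - (of_real \<sigma> * of_real k)\<^sup>2 * of_real t) *
      fourier_hat lo hi v (of_real k))"
    by (intro continuous_intros)
  show "\<sigma>\<^sup>2 * t > 0" using a by simp
  fix k :: real
  let ?I = "integral {lo..hi} (\<lambda>x. norm (v x))"
  have "norm (exp (\<i> * of_real k * of_real x - (of_real \<sigma> * of_real k)\<^sup>2 * of_real t)) = exp (- (\<sigma> * k)\<^sup>2 * t)"
    by (simp flip: of_real_mult of_real_power)
  moreover have "norm (fourier_hat lo hi v (of_real k)) \<le> exp 0 * ?I"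
    by (rule fourier_hat_norm_le[OF v]) simp
  moreover have "- (\<sigma> * k)\<^sup>2 * t \<le> \<sigma>\<^sup>2 * t + - (\<sigma>\<^sup>2 * t) * \<bar>k\<bar>"
  proof -
    have "\<bar>k\<bar> - 1 \<le> k\<^sup>2"
    proof -
      have "0 \<le> (\<bar>k\<bar> - 1 / 2)\<^sup>2" by simp
      then show ?thesis by (simp add: power2_diff power2_eq_square field_simps)
    qed
    then have "\<sigma>\<^sup>2 * t * (\<bar>k\<bar> - 1) \<le> \<sigma>\<^sup>2 * t * k\<^sup>2"
      using a by (intro mult_left_mono) auto
    then show ?thesis by (simp add: algebra_simps power_mult_distrib)
  qed
  ultimately have "norm (exp (\<i> * of_real k * of_real x - (of_real \<sigma> * of_real k)\<^sup>2 * of_real t) * fourier_hat lo hi v (of_real k))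
      \<le> exp (\<sigma>\<^sup>2 * t + - (\<sigma>\<^sup>2 * t) * \<bar>k\<bar>) * ?I"
    unfolding norm_mult by (intro mult_mono) auto
  also have "\<dots> = (exp (\<sigma>\<^sup>2 * t) * ?I) * exp (- (\<sigma>\<^sup>2 * t) * \<bar>k\<bar>)"
    by (simp only: exp_add mult_ac)
  finally show "norm (exp (\<i> * of_real k * of_real x - (of_real \<sigma> * of_real k)\<^sup>2 * of_real t) * fourier_hat lo hi v (of_real k))
      \<le> (exp (\<sigma>\<^sup>2 * t) * ?I) * exp (- (\<sigma>\<^sup>2 * t) * \<bar>k\<bar>)" .
qed

lemma gaussian_mult_absolutely_integrable:
  fixes f :: "real \<Rightarrow> complex"
  assumes "f absolutely_integrable_on UNIV"
  shows "(\<lambda>k::real. exp (- (of_real \<delta> * of_real k)\<^sup>2 / 2) * f k) absolutely_integrable_on UNIV"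
proof (rule absolutely_integrable_bounded_measurable_product[OF bilinear_times])
  show "(\<lambda>k::real. exp (- (of_real \<delta> * of_real k)\<^sup>2 / 2) :: complex) \<in> borel_measurable (lebesgue_on UNIV)"
    by (intro continuous_imp_measurable_on_sets_lebesgue continuous_intros) auto
  have "norm (exp (- (of_real \<delta> * of_real k)\<^sup>2 / 2) :: complex) \<le> 1" for k :: real
    using norm_gaussian[of \<delta> "of_real k"] by (simp add: power2_eq_square)
  then show "bounded (range (\<lambda>k::real. exp (- (of_real \<delta> * of_real k)\<^sup>2 / 2) :: complex))"
    unfolding bounded_iff by blast
qed (use assms in auto)

lemma gaussian_mult_integral_tendsto:
  fixes f :: "real \<Rightarrow> complex"
  assumes f: "f absolutely_integrable_on UNIV" and \<delta>: "\<delta> \<longlonglongrightarrow> 0"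
  shows "(\<lambda>n. integral UNIV (\<lambda>k::real. exp (- (of_real (\<delta> n) * of_real k)\<^sup>2 / 2) * f k)) \<longlonglongrightarrow> integral UNIV f"
proof (rule dominated_convergence(2)[where h = "\<lambda>k. norm (f k)"])
  show "(\<lambda>k::real. exp (- (of_real (\<delta> n) * of_real k)\<^sup>2 / 2) * f k) integrable_on UNIV" for n
    using gaussian_mult_absolutely_integrable[OF f] by (rule set_lebesgue_integral_eq_integral(1))
  show "(\<lambda>k. norm (f k)) integrable_on UNIV"
    using f by (simp add: absolutely_integrable_on_def)
  show "norm (exp (- (of_real (\<delta> n) * of_real k)\<^sup>2 / 2) * f k) \<le> norm (f k)" for n k
    unfolding norm_mult norm_gaussian by (rule mult_left_le_one_le) (auto simp: power2_eq_square)
  show "(\<lambda>n. exp (- (of_real (\<delta> n) * of_real k)\<^sup>2 / 2) * f k) \<longlonglongrightarrow> f k" for k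
    using tendsto_mult[OF gaussian_tendsto_1[OF \<delta>] tendsto_const, of "of_real k" "f k"] by simp
qed

text \<open>Both contour integrals carry a minus sign for different reasons: the lower contour runs
  against the real line, while the upper one runs along it but the endpoint \<open>lo\<close> enters
  the global relation negatively.\<close>

theorem heat_boundary_representation:
  assumes heat: "classical_heat_solution \<sigma> lo hi u ux"
    and x: "lo < x" "x < hi" and t: "t > 0" and \<sigma>: "\<sigma> > 0" and r: "r > 0"
  defines "H \<equiv> \<lambda>k. exp (- \<i> * k * of_real (hi - x)) * boundary_density \<sigma> u ux t hi k"
    and "L \<equiv> \<lambda>k. exp (\<i> * k * of_real (x - lo)) * boundary_density \<sigma> u ux t lo k"
    and "G \<equiv> \<lambda>k::real. exp (\<i> * of_real k * of_real x - (of_real \<sigma> * of_real k)\<^sup>2 * of_real t) *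
      fourier_hat lo hi (\<lambda>x. u x 0) (of_real k)"
  shows "D0_minus_integrable r H" "D0_plus_integrable r L" "G absolutely_integrable_on UNIV"
    "u x t = 1 / (2 * of_real pi) * (integral UNIV G - D0_minus_integral r H - D0_plus_integral r L)"
proof -
  define \<delta> where "\<delta> n = 1 / real (Suc n)" for n
  have \<delta>: "\<delta> n > 0" "\<delta> \<longlonglongrightarrow> 0" for n
    unfolding \<delta>_def using LIMSEQ_inverse_real_of_nat by (auto simp: inverse_eq_divide)
  have iu: "u y absolutely_integrable_on {0..t}" "ux y absolutely_integrable_on {0..t}" if "y \<in> {lo, hi}" for y
    using heat that t unfolding classical_heat_solution_def absolutely_integrable_on_Icc_iff_Ioo by blast+
  have L1: "(\<lambda>x. u x 0) absolutely_integrable_on {lo..hi}"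
    using heat unfolding classical_heat_solution_def by blast
  have cu: "continuous_on {lo..hi} (\<lambda>x. u x t)"
  proof -
    have "continuous_on ({lo..hi} \<times> {0<..}) (\<lambda>(x, t). u x t)"
      using heat unfolding classical_heat_solution_def by blast
    then have "continuous_on {lo..hi} (\<lambda>x. (\<lambda>(x, t). u x t) (x, t))"
      by (rule continuous_on_compose2) (use t in \<open>auto intro!: continuous_intros\<close>)
    then show ?thesis by simp
  qed
  obtain Ch where Ch: "\<And>k. Re (k\<^sup>2) \<ge> 0 \<Longrightarrow> norm (boundary_density \<sigma> u ux t hi k) \<le> Ch * (1 + norm k)"
    using boundary_density_bound[where u = u and y = hi and t = t and ux = ux and \<sigma> = \<sigma>] iu[of hi] by auto
  obtain Cl where Cl: "\<And>k. Re (k\<^sup>2) \<ge> 0 \<Longrightarrow> norm (boundary_density \<sigma> u ux t lo k) \<le> Cl * (1 + norm k)"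
    using boundary_density_bound[where u = u and y = lo and t = t and ux = ux and \<sigma> = \<sigma>] iu[of lo] by auto
  have holh: "boundary_density \<sigma> u ux t hi holomorphic_on UNIV" and holl: "boundary_density \<sigma> u ux t lo holomorphic_on UNIV"
    by (rule boundary_density_holomorphic; use iu in simp)+
  have dh: "hi - x > 0" and dl: "x - lo > 0" using x by auto
  have H: "exp (- \<i> * k * of_real (hi - x)) * boundary_density \<sigma> u ux t hi k = H k" for k
    by (simp only: H_def)
  have L: "exp (\<i> * k * of_real (x - lo)) * boundary_density \<sigma> u ux t lo k = L k" for k
    by (simp only: L_def)
  note minus = boundary_term_minus[OF r dh holh Ch \<delta>(1) \<delta>(2), unfolded H]
  note plus = boundary_term_plus[OF r dl holl Cl \<delta>(1) \<delta>(2), unfolded L]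
  show "D0_minus_integrable r H" by (rule minus(1))
  show "D0_plus_integrable r L" by (rule plus(1))
  show G: "G absolutely_integrable_on UNIV"
    unfolding G_def by (rule absolutely_integrable_gaussian_fourier_hat[OF L1 \<sigma> t])
  let ?G = "\<lambda>n k::real. exp (- (of_real (\<delta> n) * of_real k)\<^sup>2 / 2) :: complex"
  \<comment> \<open>The global relation at real \<open>k\<close>, divided by
    \<open>exp (\<omega> * t)\<close> and multiplied by \<open>exp (\<i> * k * x)\<close> and the
    Gaussian.\<close>
  have point: "exp (\<i> * of_real k * of_real x - (of_real (\<delta> n) * of_real k)\<^sup>2 / 2) * fourier_hat lo hi (\<lambda>x. u x t) (of_real k)
      = ?G n k * G k + ?G n k * H (of_real k) - ?G n k * L (of_real k)" for n k
  proof -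
    define K where "K = complex_of_real k"
    define \<omega> where "\<omega> = (of_real \<sigma> * K)\<^sup>2"
    define e where "e = exp (\<omega> * of_real t)"
    have e: "e \<noteq> 0" "exp (- \<omega> * of_real t) = inverse e"
      by (simp_all add: e_def exp_minus)
    define X where "X = exp (\<i> * K * of_real x)"
    define Y where "Y = exp (- \<i> * K * of_real hi)"
    define Z where "Z = exp (- \<i> * K * of_real lo)"
    define h where "h = time_hat (ux hi) \<omega> t + \<i> * K * time_hat (u hi) \<omega> t"
    define l where "l = time_hat (ux lo) \<omega> t + \<i> * K * time_hat (u lo) \<omega> t"
    have rel: "e * fourier_hat lo hi (\<lambda>x. u x t) K = fourier_hat lo hi (\<lambda>x. u x 0) K + of_real (\<sigma>\<^sup>2) * (Y * h - Z * l)"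
      unfolding e_def Y_def Z_def h_def l_def
      by (rule heat_global_relation[OF heat _ t \<omega>_def]) (use x in simp)
    have "G k = X * inverse e * fourier_hat lo hi (\<lambda>x. u x 0) K"
      unfolding G_def X_def K_def[symmetric] \<omega>_def[symmetric] e(2)[symmetric] mult_exp_exp by simp
    moreover have "H K = X * Y * (of_real (\<sigma>\<^sup>2) * inverse e * h)"
      unfolding H_def boundary_density_def X_def Y_def h_def \<omega>_def[symmetric] e(2)[symmetric] mult_exp_exp
      by (simp add: algebra_simps)
    moreover have "L K = X * Z * (of_real (\<sigma>\<^sup>2) * inverse e * l)"
      unfolding L_def boundary_density_def X_def Z_def l_def \<omega>_def[symmetric] e(2)[symmetric] mult_exp_exp
      by (simp add: algebra_simps)
    ultimately have "G k + H K - L K = X * inverse e * (fourier_hat lo hi (\<lambda>x. u x 0) K + of_real (\<sigma>\<^sup>2) * (Y * h - Z * l))"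
      by (simp add: algebra_simps)
    also have "\<dots> = X * fourier_hat lo hi (\<lambda>x. u x t) K"
      unfolding rel[symmetric] using e(1) by simp
    finally have *: "X * fourier_hat lo hi (\<lambda>x. u x t) K = G k + H K - L K" ..
    have "exp (\<i> * K * of_real x - (of_real (\<delta> n) * K)\<^sup>2 / 2) = ?G n k * X"
      unfolding X_def K_def[symmetric] mult_exp_exp by simp
    then show ?thesis
      unfolding K_def[symmetric] by (simp only: mult.assoc *) (simp only: ring_distribs)
  qed
  have int: "(\<lambda>k. ?G n k * G k) integrable_on UNIV" "(\<lambda>k. ?G n k * H (of_real k)) integrable_on UNIV"
    "(\<lambda>k. ?G n k * L (of_real k)) integrable_on UNIV" for n
    using set_lebesgue_integral_eq_integral(1)[OF gaussian_mult_absolutely_integrable[OF G]]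
      set_lebesgue_integral_eq_integral(1)[OF minus(2)] set_lebesgue_integral_eq_integral(1)[OF plus(2)]
    by blast+
  have "1 / (2 * of_real pi) * integral UNIV (\<lambda>k::real.
        exp (\<i> * of_real k * of_real x - (of_real (\<delta> n) * of_real k)\<^sup>2 / 2) * fourier_hat lo hi (\<lambda>x. u x t) (of_real k))
      = 1 / (2 * of_real pi) * (integral UNIV (\<lambda>k. ?G n k * G k) + integral UNIV (\<lambda>k. ?G n k * H (of_real k))
        - integral UNIV (\<lambda>k. ?G n k * L (of_real k)))" for n
    unfolding point
    by (simp only: Henstock_Kurzweil_Integration.integral_diff Henstock_Kurzweil_Integration.integral_add integrable_add int)
  with gaussian_inversion_limit[OF cu x \<delta>(1) \<delta>(2)]
  have "(\<lambda>n. 1 / (2 * of_real pi) * (integral UNIV (\<lambda>k. ?G n k * G k) + integral UNIV (\<lambda>k. ?G n k * H (of_real k))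
        - integral UNIV (\<lambda>k. ?G n k * L (of_real k)))) \<longlonglongrightarrow> u x t"
    by (simp only:)
  moreover have "(\<lambda>n. 1 / (2 * of_real pi) * (integral UNIV (\<lambda>k. ?G n k * G k) + integral UNIV (\<lambda>k. ?G n k * H (of_real k))
        - integral UNIV (\<lambda>k. ?G n k * L (of_real k))))
      \<longlonglongrightarrow> 1 / (2 * of_real pi) * (integral UNIV G + - D0_minus_integral r H - D0_plus_integral r L)"
    by (intro tendsto_mult tendsto_add tendsto_diff tendsto_const gaussian_mult_integral_tendsto[OF G \<delta>(2)] minus(3) plus(3))
  ultimately have "u x t = 1 / (2 * of_real pi) * (integral UNIV G + - D0_minus_integral r H - D0_plus_integral r L)"
    by (rule LIMSEQ_unique)
  then show "u x t = 1 / (2 * of_real pi) * (integral UNIV G - D0_minus_integral r H - D0_plus_integral r L)"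
    by simp
qed

section \<open>Elimination of the unknown boundary values\<close>

text \<open>The assumptions are the global relations of the left layer (\<open>U\<close>,
  \<open>U'\<close>) and of the right layer (\<open>V\<close>, \<open>V'\<close>) at a frequency and
  its negative, with \<open>m\<close> the common value of \<sigma> times the frequency.
  \<open>g0\<close>, \<open>l0\<close>, \<open>w0\<close> are the time transforms of the solution at
  the interface, the left end and the right end; \<open>G1\<close>, \<open>L1\<close>,
  \<open>W1\<close> are those of the fluxes. Given \<open>l0\<close> and \<open>w0\<close>, four
  unknowns remain. The factors \<open>p\<close> and \<open>q\<close> on the left clear the inverse
  exponentials, so that everything is polynomial.\<close>

context
  fixes sL sR p q m g0 l0 w0 G1 L1 W1 U U' V V' :: complex
  assumes U: "U = - ((G1 + \<i> * m * sL * g0) - p * (L1 + \<i> * m * sL * l0))"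
    and U': "p * U' = - (p * (G1 - \<i> * m * sL * g0) - (L1 - \<i> * m * sL * l0))"
    and V: "q * V = - ((W1 + \<i> * m * sR * w0) - q * (G1 + \<i> * m * sR * g0))"
    and V': "V' = - (q * (W1 - \<i> * m * sR * w0) - (G1 - \<i> * m * sR * g0))"
begin

text \<open>The brackets of the solution formula, with the transforms of the data replaced by the
  differences \<open>U\<close>, \<open>V\<close>. The last coefficient decides which boundary term
  survives, the one at the interface or the one at the left end; the factor in front of it on the
  right is minus Delta divided by \<open>pi\<close>.\<close>

lemma interface_elimination_left:
  "2 * (- (2 * \<i> * m * sL * sR * p\<^sup>2 * q) * w0 + \<i> * m * sL * p * ((sL + sR) - q\<^sup>2 * (sL - sR)) * l0
      + 1 / 2 * p\<^sup>2 * ((sL + sR) + q\<^sup>2 * (sR - sL)) * U' - sL * p\<^sup>2 * q\<^sup>2 * V + sL * p\<^sup>2 * V'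
      + 1 / 2 * (- (sL + sR) + q\<^sup>2 * (sL - sR)) * U)
    = - (sL * (p\<^sup>2 + 1) * (q\<^sup>2 - 1) + sR * (p\<^sup>2 - 1) * (q\<^sup>2 + 1)) * (G1 + \<i> * m * sL * g0)" (is ?minus)
  "2 * (- (2 * \<i> * m * sL * sR * p\<^sup>2 * q) * w0 + \<i> * m * sL * p * ((sL + sR) - q\<^sup>2 * (sL - sR)) * l0
      + 1 / 2 * p\<^sup>2 * ((sL + sR) + q\<^sup>2 * (sR - sL)) * U' - sL * p\<^sup>2 * q\<^sup>2 * V + sL * p\<^sup>2 * V'
      + 1 / 2 * (- (p\<^sup>2 * (sR - sL)) - p\<^sup>2 * q\<^sup>2 * (sL + sR)) * U)
    = - (sL * (p\<^sup>2 + 1) * (q\<^sup>2 - 1) + sR * (p\<^sup>2 - 1) * (q\<^sup>2 + 1)) * (p * (L1 + \<i> * m * sL * l0))" (is ?plus)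
proof -
  \<comment> \<open>Regrouped so that \<open>U'\<close> and \<open>V\<close> occur only as
    \<open>p * U'\<close> and \<open>q * V\<close>, the form in which the relations are
    assumed.\<close>
  have "2 * (A + B + 1 / 2 * p\<^sup>2 * C * U' - sL * p\<^sup>2 * q\<^sup>2 * V + F * V' + 1 / 2 * H * U)
      = 2 * A + 2 * B + p * C * (p * U') - 2 * sL * p\<^sup>2 * q * (q * V) + 2 * F * V' + H * U" for A B C F H
    by (simp add: algebra_simps power2_eq_square)
  note * = this
  show ?minus unfolding * U' V unfolding U V' by algebra
  show ?plus unfolding * U' V unfolding U V' by algebra
qed

text \<open>The same elimination, isolating the right end or the interface. The first identity is
  multiplied by \<open>q\<close> because the boundary term at the right end carries the factor
  \<open>1 / q\<close>.\<close>

lemma interface_elimination_right: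
  "2 * q * (2 * \<i> * m * sL * sR * p * l0 - \<i> * m * sR * q * ((sL - sR) + p\<^sup>2 * (sL + sR)) * w0
      - sR * U + sR * p\<^sup>2 * U' + 1 / 2 * ((sL - sR) + p\<^sup>2 * (sL + sR)) * V'
      + 1 / 2 * (- (sL + sR) + p\<^sup>2 * (sR - sL)) * V)
    = - (sL * (p\<^sup>2 + 1) * (q\<^sup>2 - 1) + sR * (p\<^sup>2 - 1) * (q\<^sup>2 + 1)) * (W1 + \<i> * m * sR * w0)" (is ?minus)
  "2 * (2 * \<i> * m * sL * sR * p * l0 - \<i> * m * sR * q * ((sL - sR) + p\<^sup>2 * (sL + sR)) * w0
      - sR * U + sR * p\<^sup>2 * U' + 1 / 2 * ((sL - sR) + p\<^sup>2 * (sL + sR)) * V'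
      + 1 / 2 * (- (q\<^sup>2 * (sL - sR)) - p\<^sup>2 * q\<^sup>2 * (sL + sR)) * V)
    = - (sL * (p\<^sup>2 + 1) * (q\<^sup>2 - 1) + sR * (p\<^sup>2 - 1) * (q\<^sup>2 + 1)) * (G1 + \<i> * m * sR * g0)" (is ?plus)
proof -
  have "2 * q * (A - B - sR * U + sR * p\<^sup>2 * U' + 1 / 2 * C * V' + 1 / 2 * H * V)
      = 2 * q * A - 2 * q * B - 2 * q * sR * U + 2 * q * sR * p * (p * U') + q * C * V' + H * (q * V)" for A B C H
    by (simp add: algebra_simps power2_eq_square)
  note * = this
  show ?minus unfolding * U' V unfolding U V' by algebra
  have "2 * (A - B - sR * U + sR * p\<^sup>2 * U' + 1 / 2 * C * V' + 1 / 2 * (- (q\<^sup>2 * (sL - sR)) - p\<^sup>2 * q\<^sup>2 * (sL + sR)) * V)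
      = 2 * A - 2 * B - 2 * sR * U + 2 * sR * p * (p * U') + C * V' - (q * (sL - sR) + p\<^sup>2 * q * (sL + sR)) * (q * V)" for A B C
    by (simp add: algebra_simps power2_eq_square)
  note * = this
  show ?plus unfolding * U' V unfolding U V' by algebra
qed

end

text \<open>Multiplying by \<open>cnj ((x + 1) * (y + 1))\<close> makes both summands have real part of the same sign.\<close>

lemma interface_symbol_lower_bound:
  fixes x y :: complex
  assumes s: "sL > 0" "sR > 0" and x: "norm x < 1" and y: "norm y < 1"
  shows "sL * (1 - norm x) * (1 - norm y) / 2
    \<le> norm (of_real sL * (x + 1) * (y - 1) + of_real sR * (x - 1) * (y + 1))"
proof -
  let ?X = "of_real sL * (x + 1) * (y - 1) + of_real sR * (x - 1) * (y + 1)"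
  define u v where "u = norm (x + 1)" and "v = norm (y + 1)"
  have re: "Re ((z - 1) * cnj (z + 1)) = (norm z)\<^sup>2 - 1" for z
    unfolding cmod_power2 by (simp add: power2_eq_square algebra_simps)
  have Re_of_real_mult: "Re (of_real c * z) = c * Re z" for c z by simp
  have "?X * cnj ((x + 1) * (y + 1))
      = of_real sL * ((x + 1) * cnj (x + 1)) * ((y - 1) * cnj (y + 1)) + of_real sR * ((y + 1) * cnj (y + 1)) * ((x - 1) * cnj (x + 1))"
    by (simp only: complex_cnj_mult) algebra
  also have "\<dots> = of_real (sL * u\<^sup>2) * ((y - 1) * cnj (y + 1)) + of_real (sR * v\<^sup>2) * ((x - 1) * cnj (x + 1))"
    by (simp only: u_def v_def complex_norm_square of_real_mult)
  finally have "Re (?X * cnj ((x + 1) * (y + 1))) = sL * u\<^sup>2 * ((norm y)\<^sup>2 - 1) + sR * v\<^sup>2 * ((norm x)\<^sup>2 - 1)"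
    by (simp only: plus_complex.sel Re_of_real_mult re)
  moreover have "sR * v\<^sup>2 * ((norm x)\<^sup>2 - 1) \<le> 0"
    using s x by (intro mult_nonneg_nonpos) (auto simp: power_le_one)
  ultimately have "sL * u\<^sup>2 * (1 - (norm y)\<^sup>2) \<le> - Re (?X * cnj ((x + 1) * (y + 1)))"
    by (simp add: algebra_simps)
  also have "\<dots> \<le> norm (?X * cnj ((x + 1) * (y + 1)))"
    using abs_Re_le_cmod[of "?X * cnj ((x + 1) * (y + 1))"] by linarith
  also have "\<dots> = norm ?X * (u * v)"
    unfolding norm_mult[of ?X] complex_mod_cnj by (simp only: norm_mult u_def v_def)
  finally have main: "sL * u\<^sup>2 * (1 - (norm y)\<^sup>2) \<le> norm ?X * (u * v)" .
  have u: "1 - norm x \<le> u" using norm_triangle_ineq2[of 1 "- x"] by (simp add: u_def add.commute)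
  then have u0: "u > 0" using x by linarith
  have v: "v \<le> 2" using norm_triangle_ineq[of y 1] y by (simp add: v_def)
  have v0: "v \<ge> 0" by (simp add: v_def)
  \<comment> \<open>One factor \<open>u\<close> is cancelled. The other is at least
    \<open>1 - norm x\<close>, and \<open>v \<le> 2\<close> accounts for the final division by
    2.\<close>
  have "u * (sL * u * (1 - (norm y)\<^sup>2)) \<le> u * (norm ?X * v)"
    using main by (simp add: power2_eq_square mult_ac)
  then have "sL * u * (1 - (norm y)\<^sup>2) \<le> norm ?X * v"
    using u0 by (simp only: mult_le_cancel_left_pos)
  also have "\<dots> \<le> norm ?X * 2" using v by (intro mult_left_mono) auto
  finally have 1: "sL * u * (1 - (norm y)\<^sup>2) \<le> norm ?X * 2" .
  have "(norm y)\<^sup>2 \<le> norm y" using y by (simp add: power2_eq_square mult_left_le_one_le)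
  then have "sL * (1 - norm x) * (1 - norm y) \<le> sL * u * (1 - (norm y)\<^sup>2)"
    using s x y u by (intro mult_mono) auto
  with 1 show ?thesis by simp
qed

text \<open>Common form of both denominators: \<open>Delta_L\<close> is the case
  \<open>A = a\<close>, \<open>B = b * sL / sR\<close>, and \<open>Delta_R\<close> the case
  \<open>A = a * sR / sL\<close>, \<open>B = b\<close>.\<close>

definition interface_symbol :: "real \<Rightarrow> real \<Rightarrow> real \<Rightarrow> real \<Rightarrow> complex \<Rightarrow> complex" where
  "interface_symbol A B sL sR k = of_real pi *
    (of_real sL * ((exp (\<i> * k * of_real A))\<^sup>2 + 1) * ((exp (\<i> * k * of_real B))\<^sup>2 - 1)
      + of_real sR * ((exp (\<i> * k * of_real A))\<^sup>2 - 1) * ((exp (\<i> * k * of_real B))\<^sup>2 + 1))"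

lemma norm_exp_ik: "norm (exp (\<i> * k * of_real A)) = exp (- (A * Im k))"
  by (simp add: mult.commute)

text \<open>For \<open>Im k \<ge> \<eta>\<close> the squared exponentials have moduli at most
  \<open>exp (- (2 * A * \<eta>))\<close> and \<open>exp (- (2 * B * \<eta>))\<close>, both below 1,
  and the general lower bound decreases in these moduli.\<close>

lemma interface_symbol_bound_upper:
  assumes pos: "A > 0" "B > 0" "sL > 0" "sR > 0" "\<eta> > 0"
  obtains c where "c > 0" "\<And>k. Im k \<ge> \<eta> \<Longrightarrow> c \<le> norm (interface_symbol A B sL sR k)"
proof
  let ?c = "pi * (sL * (1 - exp (- (2 * A * \<eta>))) * (1 - exp (- (2 * B * \<eta>))) / 2)"
  show "?c > 0" using pos by simp
  fix k assume k: "Im k \<ge> \<eta>"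
  define x where "x = (exp (\<i> * k * of_real A))\<^sup>2"
  define y where "y = (exp (\<i> * k * of_real B))\<^sup>2"
  have n: "norm x = exp (- (2 * A * Im k))" "norm y = exp (- (2 * B * Im k))"
    by (simp_all only: x_def y_def norm_power norm_exp_ik) (simp_all add: power2_eq_square mult_exp_exp)
  have le: "norm x \<le> exp (- (2 * A * \<eta>))" "norm y \<le> exp (- (2 * B * \<eta>))"
    unfolding n using k pos by auto
  have lt: "exp (- (2 * A * \<eta>)) < 1" "exp (- (2 * B * \<eta>)) < 1" using pos by auto
  have "sL * (1 - exp (- (2 * A * \<eta>))) * (1 - exp (- (2 * B * \<eta>))) / 2 \<le> sL * (1 - norm x) * (1 - norm y) / 2"
    using le lt pos less_imp_le[OF le_less_trans[OF le(1) lt(1)]]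
    by (intro divide_right_mono mult_mono) auto
  also have "\<dots> \<le> norm (of_real sL * (x + 1) * (y - 1) + of_real sR * (x - 1) * (y + 1))"
    using pos by (intro interface_symbol_lower_bound le_less_trans[OF le(1) lt(1)] le_less_trans[OF le(2) lt(2)]) auto
  finally have "?c \<le> pi * norm (of_real sL * (x + 1) * (y - 1) + of_real sR * (x - 1) * (y + 1))"
    by (intro mult_left_mono) auto
  then show "?c \<le> norm (interface_symbol A B sL sR k)"
    unfolding interface_symbol_def x_def[symmetric] y_def[symmetric] by (simp only: norm_mult norm_of_real) simp
qed

text \<open>Replacing \<open>x\<close>, \<open>y\<close> by their inverses in
  \<open>(x + 1) * (y - 1)\<close> gives its negative divided by \<open>x * y\<close>, and likewise
  for the other product. This transfers facts from the upper to the lower half plane.\<close>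

lemma interface_symbol_uminus:
  "interface_symbol A B sL sR k
    = - ((exp (\<i> * k * of_real A))\<^sup>2 * (exp (\<i> * k * of_real B))\<^sup>2) * interface_symbol A B sL sR (- k)"
proof -
  define x where "x = exp (\<i> * k * of_real A)"
  define y where "y = exp (\<i> * k * of_real B)"
  have inv: "exp (\<i> * (- k) * of_real A) = inverse x" "exp (\<i> * (- k) * of_real B) = inverse y"
    by (simp_all add: x_def y_def exp_minus)
  have "x \<noteq> 0" "y \<noteq> 0" by (simp_all add: x_def y_def)
  then have "of_real sL * (x\<^sup>2 + 1) * (y\<^sup>2 - 1) + of_real sR * (x\<^sup>2 - 1) * (y\<^sup>2 + 1)
      = - (x\<^sup>2 * y\<^sup>2) * (of_real sL * ((inverse x)\<^sup>2 + 1) * ((inverse y)\<^sup>2 - 1)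
        + of_real sR * ((inverse x)\<^sup>2 - 1) * ((inverse y)\<^sup>2 + 1))"
    by (simp add: field_simps power2_eq_square)
  then show ?thesis
    unfolding interface_symbol_def x_def[symmetric] y_def[symmetric] inv by simp
qed

text \<open>Here the exponentials are large, so the bound is stated relative to their product, the
  order of growth that the numerators will match.\<close>

lemma interface_symbol_bound_lower:
  assumes pos: "A > 0" "B > 0" "sL > 0" "sR > 0" "\<eta> > 0"
  obtains c where "c > 0" "\<And>k. Im k \<le> - \<eta> \<Longrightarrow>
    c * norm ((exp (\<i> * k * of_real A))\<^sup>2 * (exp (\<i> * k * of_real B))\<^sup>2) \<le> norm (interface_symbol A B sL sR k)"
proof -
  obtain c where c: "c > 0" "\<And>k. Im k \<ge> \<eta> \<Longrightarrow> c \<le> norm (interface_symbol A B sL sR k)"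
    using interface_symbol_bound_upper[OF pos] by blast
  show ?thesis
  proof
    fix k assume "Im k \<le> - \<eta>"
    then have "c \<le> norm (interface_symbol A B sL sR (- k))" by (intro c(2)) simp
    then show "c * norm ((exp (\<i> * k * of_real A))\<^sup>2 * (exp (\<i> * k * of_real B))\<^sup>2) \<le> norm (interface_symbol A B sL sR k)"
      unfolding interface_symbol_uminus[of A B sL sR k] norm_mult norm_minus_cancel
      by (simp add: mult.commute mult_left_mono)
  qed (use c in auto)
qed

lemma interface_symbol_nonzero:
  assumes pos: "A > 0" "B > 0" "sL > 0" "sR > 0" and k: "Im k \<noteq> 0"
  shows "interface_symbol A B sL sR k \<noteq> 0"
proof -
  have *: "interface_symbol A B sL sR k \<noteq> 0" if "Im k > 0" for k
    using interface_symbol_bound_upper[OF pos that] by (metis norm_zero not_le order_refl)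
  show ?thesis
  proof (cases "Im k > 0")
    case False
    then have "interface_symbol A B sL sR (- k) \<noteq> 0" using k by (intro *) auto
    then show ?thesis unfolding interface_symbol_uminus[of A B sL sR k] by simp
  qed (rule *)
qed

lemma Delta_L_eq: "Delta_L a b sL sR = interface_symbol a (b * sL / sR) sL sR"
proof
  have "exp (2 * \<i> * of_real a * k) = (exp (\<i> * k * of_real a))\<^sup>2"
    "exp (2 * \<i> * of_real b * k * of_real (sL / sR)) = (exp (\<i> * k * of_real (b * sL / sR)))\<^sup>2" for k
    unfolding exp_double[symmetric] by (simp_all add: mult_ac)
  then show "Delta_L a b sL sR k = interface_symbol a (b * sL / sR) sL sR k" for k
    unfolding Delta_L_def interface_symbol_def by (simp only:)
qed

lemma Delta_R_eq:
  assumes "sL \<noteq> 0" "sR \<noteq> 0"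
  shows "Delta_R a b sL sR = interface_symbol (a * sR / sL) b sL sR"
proof
  have "\<i> * (k * of_real (sR / sL)) * of_real a = \<i> * k * of_real (a * sR / sL)"
    "\<i> * (k * of_real (sR / sL)) * of_real (b * sL / sR) = \<i> * k * of_real b" for k
    using assms by (simp_all add: field_simps)
  then show "Delta_R a b sL sR k = interface_symbol (a * sR / sL) b sL sR k" for k
    unfolding Delta_R_def Delta_L_eq interface_symbol_def by (simp only:)
qed

section \<open>From the boundary representation of one layer to its contour formula\<close>

lemma D0_minus_cong:
  assumes r: "r > 0" and eq: "\<And>k. Im k < 0 \<Longrightarrow> f k = g k"
  shows "D0_minus_integrable r f \<longleftrightarrow> D0_minus_integrable r g" "D0_minus_integral r f = D0_minus_integral r g"
proof -
  have ray: "f (of_real s * cis (- pi / 4)) = g (of_real s * cis (- pi / 4))"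
    "f (of_real s * cis (- 3 * pi / 4)) = g (of_real s * cis (- 3 * pi / 4))" if "s \<in> {r..}" for s
    using that r by (intro eq; unfold cis_D0_minus; simp)+
  have arc: "f k = g k" if "k \<in> path_image (part_circlepath 0 r (- pi / 4) (- 3 * pi / 4))" for k
    using arc_D0_minus(1)[OF r that] by (rule eq)
  have "f contour_integrable_on part_circlepath 0 r (- pi / 4) (- 3 * pi / 4)
      \<longleftrightarrow> g contour_integrable_on part_circlepath 0 r (- pi / 4) (- 3 * pi / 4)"
    using arc by (metis contour_integrable_eq)
  then show "D0_minus_integrable r f \<longleftrightarrow> D0_minus_integrable r g"
    unfolding sector_contour_integrable_def
    by (intro conj_cong set_integrable_cong refl ray) auto
  show "D0_minus_integral r f = D0_minus_integral r g"
    unfolding sector_contour_integral_def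
    using ray arc by (intro arg_cong2[where f = "(+)"] arg_cong2[where f = "(*)"] refl integral_cong contour_integral_eq) auto
qed

lemma D0_plus_cong:
  assumes r: "r > 0" and eq: "\<And>k. Im k > 0 \<Longrightarrow> f k = g k"
  shows "D0_plus_integrable r f \<longleftrightarrow> D0_plus_integrable r g" "D0_plus_integral r f = D0_plus_integral r g"
  unfolding D0_plus_reflect using D0_minus_cong[OF r, of "\<lambda>k. f (- k)" "\<lambda>k. g (- k)"] eq by simp_all

lemma fourier_hat_cong:
  assumes "\<And>x. lo < x \<Longrightarrow> x < hi \<Longrightarrow> v x = w x"
  shows "fourier_hat lo hi v = fourier_hat lo hi w"
  unfolding fourier_hat_def fun_eq_iff
  by (intro allI integral_spike[of "{lo, hi}"]) (use assms in auto)

lemma time_hat_cong: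
  assumes "\<And>s. s > 0 \<Longrightarrow> f s = g s"
  shows "time_hat f \<omega> t = time_hat g \<omega> t"
  unfolding time_hat_def by (intro integral_spike[of "{0}"]) (use assms in auto)

lemma time_hat_cmult: "time_hat (\<lambda>s. c * f s) \<omega> t = c * time_hat f \<omega> t"
  unfolding time_hat_def mult.left_commute[of _ c] by simp

lemma time_hat_zero [simp]: "time_hat (\<lambda>_. 0) \<omega> t = 0"
  by (simp add: time_hat_def)

text \<open>The argument shared by both layers: off the real axis the integrands \<open>gm\<close>,
  \<open>gp\<close> agree with the boundary terms of the representation up to remainders
  \<open>Tm\<close>, \<open>Tp\<close>, whose contour integrals vanish.\<close>

lemma heat_contour_formula:
  assumes heat: "classical_heat_solution \<sigma> lo hi u ux"
    and initial: "\<And>y. lo < y \<Longrightarrow> y < hi \<Longrightarrow> u y 0 = v y"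
    and x: "lo < x" "x < hi" and t: "t > 0" and \<sigma>: "\<sigma> > 0" and r: "r > 0"
    and minus: "\<And>k. Im k < 0 \<Longrightarrow> gm k = - 1 / (2 * of_real pi) *
        (exp (- \<i> * k * of_real (hi - x)) * boundary_density \<sigma> u ux t hi k) + Tm k"
    and plus: "\<And>k. Im k > 0 \<Longrightarrow> gp k = - 1 / (2 * of_real pi) *
        (exp (\<i> * k * of_real (x - lo)) * boundary_density \<sigma> u ux t lo k) + Tp k"
    and Tm: "Tm holomorphic_on {k. Im k < 0}" "dm > 0" "\<And>k. Im k \<le> - (r / 2) \<Longrightarrow> norm (Tm k) \<le> Cm * exp (dm * Im k)"
    and Tp: "Tp holomorphic_on {k. Im k > 0}" "dp > 0" "\<And>k. Im k \<ge> r / 2 \<Longrightarrow> norm (Tp k) \<le> Cp * exp (- (dp * Im k))"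
  defines "G \<equiv> \<lambda>k::real. exp (\<i> * of_real k * of_real x - (of_real \<sigma> * of_real k)\<^sup>2 * of_real t) * fourier_hat lo hi v (of_real k)"
  shows "G absolutely_integrable_on UNIV \<and> D0_minus_integrable r gm \<and> D0_plus_integrable r gp \<and>
    u x t = 1 / (2 * of_real pi) * integral UNIV G + D0_minus_integral r gm + D0_plus_integral r gp"
proof -
  let ?H = "\<lambda>k. exp (- \<i> * k * of_real (hi - x)) * boundary_density \<sigma> u ux t hi k"
  let ?L = "\<lambda>k. exp (\<i> * k * of_real (x - lo)) * boundary_density \<sigma> u ux t lo k"
  have v: "fourier_hat lo hi (\<lambda>x. u x 0) = fourier_hat lo hi v"
    using initial by (rule fourier_hat_cong)
  note rep = heat_boundary_representation[OF heat x t \<sigma> r, unfolded v, folded G_def]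
  \<comment> \<open>Turns the half-plane bounds on \<open>Tm\<close> and \<open>Tp\<close> into
    decay in \<open>norm k\<close>, and shows that the region stays at distance at least
    \<open>r / 2\<close> from the real axis, where these bounds hold.\<close>
  have sector: "\<bar>Im k\<bar> \<ge> norm k / 2" if "Re (k\<^sup>2) \<le> 0" "norm k \<ge> r" for k
  proof (rule ccontr)
    assume "\<not> \<bar>Im k\<bar> \<ge> norm k / 2"
    then have "Re (k\<^sup>2) \<ge> (norm k)\<^sup>2 / 2" by (intro norm_Im_sector) simp
    then have "(norm k)\<^sup>2 \<le> 0" using that by linarith
    then show False using that r by simp
  qed
  have Cm: "Cm \<ge> 0"
  proof -
    have "norm (Tm (Complex 0 (- (r / 2)))) \<le> Cm * exp (dm * - (r / 2))"
      using Tm(3)[of "Complex 0 (- (r / 2))"] by simp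
    then have "0 \<le> Cm * exp (dm * - (r / 2))" using norm_ge_zero order_trans by blast
    then show ?thesis by (simp add: zero_le_mult_iff)
  qed
  have Cp: "Cp \<ge> 0"
  proof -
    have "norm (Tp (Complex 0 (r / 2))) \<le> Cp * exp (- (dp * (r / 2)))"
      using Tp(3)[of "Complex 0 (r / 2)"] by simp
    then have "0 \<le> Cp * exp (- (dp * (r / 2)))" using norm_ge_zero order_trans by blast
    then show ?thesis by (simp add: zero_le_mult_iff)
  qed
  have Tm0: "D0_minus_integrable r Tm" "D0_minus_integral r Tm = 0"
  proof -
    have "norm (Tm k) \<le> Cm * exp (- (dm / 2) * norm k)" if "Im k < 0" "Re (k\<^sup>2) \<le> 0" "norm k \<ge> r" for k
    proof -
      have Im: "Im k \<le> - (norm k / 2)" using sector[OF that(2,3)] that(1) by linarith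
      then have "norm (Tm k) \<le> Cm * exp (dm * Im k)" using that by (intro Tm(3)) linarith
      also have "\<dots> \<le> Cm * exp (- (dm / 2) * norm k)"
        using mult_left_mono[OF Im, of dm] Tm(2) Cm by (intro mult_left_mono) auto
      finally show ?thesis .
    qed
    from D0_minus_integral_eq_0[OF r Tm(1) _ this] Tm(2)
    show "D0_minus_integrable r Tm" "D0_minus_integral r Tm = 0" by simp_all
  qed
  have Tp0: "D0_plus_integrable r Tp" "D0_plus_integral r Tp = 0"
  proof -
    have "norm (Tp k) \<le> Cp * exp (- (dp / 2) * norm k)" if "Im k > 0" "Re (k\<^sup>2) \<le> 0" "norm k \<ge> r" for k
    proof -
      have Im: "norm k / 2 \<le> Im k" using sector[OF that(2,3)] that(1) by linarith
      then have "norm (Tp k) \<le> Cp * exp (- (dp * Im k))" using that by (intro Tp(3)) linarith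
      also have "\<dots> \<le> Cp * exp (- (dp / 2) * norm k)"
        using mult_left_mono[OF Im, of dp] Tp(2) Cp by (intro mult_left_mono) auto
      finally show ?thesis .
    qed
    from D0_plus_integral_eq_0[OF r Tp(1) _ this] Tp(2)
    show "D0_plus_integrable r Tp" "D0_plus_integral r Tp = 0" by simp_all
  qed
  note addm = sector_contour_integral_add[OF sector_contour_integral_cmult(1)[OF rep(1), of "- 1 / (2 * of_real pi)"] Tm0(1)]
  note addp = sector_contour_integral_add[OF sector_contour_integral_cmult(1)[OF rep(2), of "- 1 / (2 * of_real pi)"] Tp0(1)]
  note congm = D0_minus_cong[OF r, of gm "\<lambda>k. - 1 / (2 * of_real pi) * ?H k + Tm k", OF minus]
  note congp = D0_plus_cong[OF r, of gp "\<lambda>k. - 1 / (2 * of_real pi) * ?L k + Tp k", OF plus]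
  have "D0_minus_integrable r gm"
    using congm(1) addm(1) by blast
  moreover have "D0_plus_integrable r gp"
    using congp(1) addp(1) by blast
  moreover have "D0_minus_integral r gm = - 1 / (2 * of_real pi) * D0_minus_integral r ?H"
    using congm(2) unfolding addm(2) sector_contour_integral_cmult(2)[OF rep(1)] Tm0(2) by simp
  moreover have "D0_plus_integral r gp = - 1 / (2 * of_real pi) * D0_plus_integral r ?L"
    using congp(2) unfolding addp(2) sector_contour_integral_cmult(2)[OF rep(2)] Tp0(2) by simp
  ultimately show ?thesis
    using rep(3,4) by (simp add: algebra_simps diff_divide_distrib)
qed

section \<open>Growth of the numerators in the two half planes\<close>

lemma norm_interface_coefficient_le:
  fixes y :: complex
  assumes "sL > 0" "sR > 0" "Y \<ge> 1" "norm y \<le> Y"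
  shows "norm ((of_real sL + of_real sR) + y * (of_real sR - of_real sL)) \<le> 2 * (sL + sR) * Y"
    "norm ((of_real sL - of_real sR) + y * (of_real sL + of_real sR)) \<le> 2 * (sL + sR) * Y"
proof -
  have *: "norm (of_real c + y * of_real d) \<le> 2 * (sL + sR) * Y" if "\<bar>c\<bar> \<le> sL + sR" "\<bar>d\<bar> \<le> sL + sR" for c d
  proof -
    have "norm (of_real c + y * of_real d) \<le> \<bar>c\<bar> + norm y * \<bar>d\<bar>"
      using norm_triangle_ineq[of "of_real c" "y * of_real d"] by (simp add: norm_mult)
    also have "\<dots> \<le> (sL + sR) * Y + Y * (sL + sR)"
    proof (intro add_mono mult_mono)
      have "(sL + sR) * 1 \<le> (sL + sR) * Y" using assms by (intro mult_left_mono) auto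
      then show "\<bar>c\<bar> \<le> (sL + sR) * Y" using order_trans[OF that(1)] by simp
    qed (use assms that in auto)
    finally show ?thesis by (simp add: algebra_simps)
  qed
  show "norm ((of_real sL + of_real sR) + y * (of_real sR - of_real sL)) \<le> 2 * (sL + sR) * Y"
    using *[of "sL + sR" "sR - sL"] assms by simp
  show "norm ((of_real sL - of_real sR) + y * (of_real sL + of_real sR)) \<le> 2 * (sL + sR) * Y"
    using *[of "sL - sR" "sL + sR"] assms by simp
qed

lemma norm_sum4_le:
  fixes A B C D :: complex
  assumes "norm A \<le> M" "norm B \<le> M" "norm C \<le> M" "norm D \<le> M"
  shows "norm (A + B + C + D) \<le> 4 * M"
  using norm_triangle_ineq[of "A + B + C" D] norm_triangle_ineq[of "A + B" C] norm_triangle_ineq[of A B] assms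
  by linarith

text \<open>Lower half plane, where both exponentials have modulus at least 1. The growth allowed
  for \<open>U\<close> and \<open>V'\<close> is that of the transforms; each of the four terms then
  stays within the order \<open>p\<^sup>2 * q\<^sup>2\<close> of the denominator.\<close>

lemma norm_left_numerator_minus_le:
  fixes p q U U' V V' :: complex
  assumes s: "sL > 0" "sR > 0" and N: "N \<ge> 0" and p: "norm p \<ge> 1" and q: "norm q \<ge> 1"
    and U: "norm U \<le> norm p * N" and U': "norm U' \<le> N" and V: "norm V \<le> N" and V': "norm V' \<le> norm q * N"
  shows "norm (1 / 2 * p\<^sup>2 * ((of_real sL + of_real sR) + q\<^sup>2 * (of_real sR - of_real sL)) * U'
      - of_real sL * p\<^sup>2 * q\<^sup>2 * V + of_real sL * p\<^sup>2 * V'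
      + 1 / 2 * (- (of_real sL + of_real sR) + q\<^sup>2 * (of_real sL - of_real sR)) * U)
    \<le> 4 * ((sL + sR) * N * norm (p\<^sup>2 * q\<^sup>2))"
proof -
  let ?P = "norm p" and ?Q = "norm q" and ?S = "sL + sR"
  let ?c = "(of_real sL + of_real sR) + q\<^sup>2 * (of_real sR - of_real sL) :: complex"
  have c: "norm ?c \<le> 2 * ?S * ?Q\<^sup>2"
    using s q by (intro norm_interface_coefficient_le) (auto simp: norm_power)
  have c': "- (of_real sL + of_real sR) + q\<^sup>2 * (of_real sL - of_real sR) = - ?c" by (simp add: algebra_simps)
  have P2: "?P \<le> ?P\<^sup>2" and Q2: "?Q \<le> ?Q\<^sup>2" using self_le_power[OF p, of 2] self_le_power[OF q, of 2] by simp_all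
  have "norm (1 / 2 * p\<^sup>2 * ?c * U') \<le> ?S * N * (?P\<^sup>2 * ?Q\<^sup>2)"
  proof -
    have "norm (1 / 2 * p\<^sup>2 * ?c * U') = 1 / 2 * ?P\<^sup>2 * norm ?c * norm U'"
      unfolding norm_mult norm_power by simp
    also have "\<dots> \<le> 1 / 2 * ?P\<^sup>2 * (2 * ?S * ?Q\<^sup>2) * N"
      using c U' s by (intro mult_mono) auto
    also have "\<dots> = ?S * N * (?P\<^sup>2 * ?Q\<^sup>2)" by (simp add: algebra_simps)
    finally show ?thesis .
  qed
  moreover have "norm (- (of_real sL * p\<^sup>2 * q\<^sup>2 * V)) \<le> ?S * N * (?P\<^sup>2 * ?Q\<^sup>2)"
  proof -
    have "norm (- (of_real sL * p\<^sup>2 * q\<^sup>2 * V)) = sL * (?P\<^sup>2 * ?Q\<^sup>2) * norm V"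
      unfolding norm_minus_cancel norm_mult norm_power norm_of_real using s by simp
    also have "\<dots> \<le> ?S * (?P\<^sup>2 * ?Q\<^sup>2) * N"
      using V s by (intro mult_mono) auto
    also have "\<dots> = ?S * N * (?P\<^sup>2 * ?Q\<^sup>2)" by (simp add: algebra_simps)
    finally show ?thesis .
  qed
  moreover have "norm (of_real sL * p\<^sup>2 * V') \<le> ?S * N * (?P\<^sup>2 * ?Q\<^sup>2)"
  proof -
    have "norm (of_real sL * p\<^sup>2 * V') = sL * ?P\<^sup>2 * norm V'"
      unfolding norm_mult norm_power norm_of_real using s by simp
    also have "\<dots> \<le> ?S * ?P\<^sup>2 * (?Q\<^sup>2 * N)"
      using order_trans[OF V' mult_right_mono[OF Q2 N]] s by (intro mult_mono) auto
    also have "\<dots> = ?S * N * (?P\<^sup>2 * ?Q\<^sup>2)" by (simp add: algebra_simps)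
    finally show ?thesis .
  qed
  moreover have "norm (1 / 2 * - ?c * U) \<le> ?S * N * (?P\<^sup>2 * ?Q\<^sup>2)"
  proof -
    have "norm (1 / 2 * - ?c * U) = 1 / 2 * norm ?c * norm U"
      unfolding norm_mult norm_minus_cancel by simp
    also have "\<dots> \<le> 1 / 2 * (2 * ?S * ?Q\<^sup>2) * (?P\<^sup>2 * N)"
      using c order_trans[OF U mult_right_mono[OF P2 N]] s by (intro mult_mono) auto
    also have "\<dots> = ?S * N * (?P\<^sup>2 * ?Q\<^sup>2)" by (simp add: algebra_simps)
    finally show ?thesis .
  qed
  ultimately show ?thesis
    unfolding c' diff_conv_add_uminus[of _ "of_real sL * p\<^sup>2 * q\<^sup>2 * V"] norm_mult[of "p\<^sup>2"] norm_power
    by (rule norm_sum4_le)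
qed

text \<open>Upper half plane. The transforms \<open>U'\<close> and \<open>V\<close> may grow like
  the inverse exponentials, whence their weighted bounds. The factor \<open>norm p\<close> is kept
  in the result because \<open>exp (\<i> * k * x)\<close> with \<open>x < 0\<close> grows here and
  has to be compensated.\<close>

lemma norm_left_numerator_plus_le:
  fixes p q U U' V V' :: complex
  assumes s: "sL > 0" "sR > 0" and N: "N \<ge> 0" and p: "norm p \<le> 1" and q: "norm q \<le> 1"
    and U: "norm U \<le> N" and U': "norm p * norm U' \<le> N" and V: "norm q * norm V \<le> N" and V': "norm V' \<le> N"
  shows "norm (1 / 2 * p\<^sup>2 * ((of_real sL + of_real sR) + q\<^sup>2 * (of_real sR - of_real sL)) * U'
      - of_real sL * p\<^sup>2 * q\<^sup>2 * V + of_real sL * p\<^sup>2 * V'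
      + 1 / 2 * (- (p\<^sup>2 * (of_real sR - of_real sL)) - p\<^sup>2 * q\<^sup>2 * (of_real sL + of_real sR)) * U)
    \<le> 4 * ((sL + sR) * N * norm p)"
proof -
  let ?P = "norm p" and ?Q = "norm q" and ?S = "sL + sR"
  let ?c = "(of_real sL + of_real sR) + q\<^sup>2 * (of_real sR - of_real sL) :: complex"
  let ?d = "(of_real sR - of_real sL) + q\<^sup>2 * (of_real sR + of_real sL) :: complex"
  have c: "norm ?c \<le> 2 * ?S" and d: "norm ?d \<le> 2 * ?S"
    using norm_interface_coefficient_le(1)[of sL sR 1 "q\<^sup>2"] norm_interface_coefficient_le(2)[of sR sL 1 "q\<^sup>2"] s q
    by (auto simp: norm_power power_le_one add.commute)
  have d': "- (p\<^sup>2 * (of_real sR - of_real sL)) - p\<^sup>2 * q\<^sup>2 * (of_real sL + of_real sR) = - (p\<^sup>2 * ?d)"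
    by (simp add: algebra_simps)
  have P2: "?P\<^sup>2 \<le> ?P" using p by (simp add: power2_eq_square mult_left_le)
  have "norm (1 / 2 * p\<^sup>2 * ?c * U') \<le> ?S * N * ?P"
  proof -
    have "norm (1 / 2 * p\<^sup>2 * ?c * U') = 1 / 2 * ?P * norm ?c * (?P * norm U')"
      unfolding norm_mult norm_power by (simp add: power2_eq_square)
    also have "\<dots> \<le> 1 / 2 * ?P * (2 * ?S) * N"
      using c U' s by (intro mult_mono) auto
    also have "\<dots> = ?S * N * ?P" by (simp add: algebra_simps)
    finally show ?thesis .
  qed
  moreover have "norm (- (of_real sL * p\<^sup>2 * q\<^sup>2 * V)) \<le> ?S * N * ?P"
  proof -
    have "norm (- (of_real sL * p\<^sup>2 * q\<^sup>2 * V)) = sL * (?P\<^sup>2 * ?Q) * (?Q * norm V)"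
      unfolding norm_minus_cancel norm_mult norm_power norm_of_real using s by (simp add: power2_eq_square)
    also have "\<dots> \<le> ?S * (?P * 1) * N"
      using V s P2 q by (intro mult_mono) auto
    also have "\<dots> = ?S * N * ?P" by (simp add: algebra_simps)
    finally show ?thesis .
  qed
  moreover have "norm (of_real sL * p\<^sup>2 * V') \<le> ?S * N * ?P"
  proof -
    have "norm (of_real sL * p\<^sup>2 * V') = sL * ?P\<^sup>2 * norm V'"
      unfolding norm_mult norm_power norm_of_real using s by simp
    also have "\<dots> \<le> ?S * ?P * N"
      using V' P2 s by (intro mult_mono) auto
    also have "\<dots> = ?S * N * ?P" by (simp add: algebra_simps)
    finally show ?thesis .
  qed
  moreover have "norm (1 / 2 * - (p\<^sup>2 * ?d) * U) \<le> ?S * N * ?P"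
  proof -
    have "norm (1 / 2 * - (p\<^sup>2 * ?d) * U) = 1 / 2 * (?P\<^sup>2 * norm ?d) * norm U"
      unfolding norm_mult norm_minus_cancel norm_power by simp
    also have "\<dots> \<le> 1 / 2 * (?P * (2 * ?S)) * N"
      using d U P2 s by (intro mult_mono) auto
    also have "\<dots> = ?S * N * ?P" by (simp add: algebra_simps)
    finally show ?thesis .
  qed
  ultimately show ?thesis
    unfolding d' diff_conv_add_uminus[of _ "of_real sL * p\<^sup>2 * q\<^sup>2 * V"]
    by (rule norm_sum4_le)
qed

text \<open>One power of \<open>norm q\<close> is gained over the order
  \<open>p\<^sup>2 * q\<^sup>2\<close> of the denominator. It compensates the growth of
  \<open>exp (\<i> * k * x)\<close> with \<open>x > 0\<close> in the lower half plane.\<close>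

lemma norm_right_numerator_minus_le:
  fixes p q U U' V V' :: complex
  assumes s: "sL > 0" "sR > 0" and N: "N \<ge> 0" and p: "norm p \<ge> 1" and q: "norm q \<ge> 1"
    and U: "norm U \<le> norm p * N" and U': "norm U' \<le> N" and V: "norm V \<le> N" and V': "norm V' \<le> norm q * N"
  shows "norm (- (of_real sR * U) + of_real sR * p\<^sup>2 * U'
      + 1 / 2 * ((of_real sL - of_real sR) + p\<^sup>2 * (of_real sL + of_real sR)) * V'
      + 1 / 2 * (- (of_real sL + of_real sR) + p\<^sup>2 * (of_real sR - of_real sL)) * V)
    \<le> 4 * ((sL + sR) * N * (norm (p\<^sup>2) * norm q))"
proof -
  let ?P = "norm p" and ?Q = "norm q" and ?S = "sL + sR"
  let ?c = "(of_real sL - of_real sR) + p\<^sup>2 * (of_real sL + of_real sR) :: complex"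
  let ?d = "(of_real sR + of_real sL) + p\<^sup>2 * (of_real sL - of_real sR) :: complex"
  have c: "norm ?c \<le> 2 * ?S * ?P\<^sup>2" and d: "norm ?d \<le> 2 * ?S * ?P\<^sup>2"
    using norm_interface_coefficient_le(2)[of sL sR "?P\<^sup>2" "p\<^sup>2"] norm_interface_coefficient_le(1)[of sR sL "?P\<^sup>2" "p\<^sup>2"] s p
    by (auto simp: norm_power add.commute)
  have d': "- (of_real sL + of_real sR) + p\<^sup>2 * (of_real sR - of_real sL) = - ?d"
    by (simp add: algebra_simps)
  have P2: "?P \<le> ?P\<^sup>2 * ?Q"
  proof -
    have "?P * 1 \<le> ?P * (?P * ?Q)" using p q mult_mono[of 1 ?P 1 ?Q] by (intro mult_left_mono) auto
    then show ?thesis by (simp add: power2_eq_square mult_ac)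
  qed
  have Q1: "N \<le> ?Q * N" using q N by (simp add: mult_le_cancel_right1)
  have "norm (- (of_real sR * U)) \<le> ?S * N * (?P\<^sup>2 * ?Q)"
  proof -
    have "norm (- (of_real sR * U)) = sR * norm U"
      unfolding norm_minus_cancel norm_mult norm_of_real using s by simp
    also have "\<dots> \<le> ?S * (?P\<^sup>2 * ?Q * N)"
      using order_trans[OF U mult_right_mono[OF P2 N]] s by (intro mult_mono) auto
    also have "\<dots> = ?S * N * (?P\<^sup>2 * ?Q)" by (simp add: algebra_simps)
    finally show ?thesis .
  qed
  moreover have "norm (of_real sR * p\<^sup>2 * U') \<le> ?S * N * (?P\<^sup>2 * ?Q)"
  proof -
    have "norm (of_real sR * p\<^sup>2 * U') = sR * ?P\<^sup>2 * norm U'"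
      unfolding norm_mult norm_power norm_of_real using s by simp
    also have "\<dots> \<le> ?S * ?P\<^sup>2 * (?Q * N)"
      using order_trans[OF U' Q1] s by (intro mult_mono) auto
    also have "\<dots> = ?S * N * (?P\<^sup>2 * ?Q)" by (simp add: algebra_simps)
    finally show ?thesis .
  qed
  moreover have "norm (1 / 2 * ?c * V') \<le> ?S * N * (?P\<^sup>2 * ?Q)"
  proof -
    have "norm (1 / 2 * ?c * V') = 1 / 2 * norm ?c * norm V'"
      unfolding norm_mult by simp
    also have "\<dots> \<le> 1 / 2 * (2 * ?S * ?P\<^sup>2) * (?Q * N)"
      using c V' s by (intro mult_mono) auto
    also have "\<dots> = ?S * N * (?P\<^sup>2 * ?Q)" by (simp add: algebra_simps)
    finally show ?thesis .
  qed
  moreover have "norm (1 / 2 * - ?d * V) \<le> ?S * N * (?P\<^sup>2 * ?Q)"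
  proof -
    have "norm (1 / 2 * - ?d * V) = 1 / 2 * norm ?d * norm V"
      unfolding norm_mult norm_minus_cancel by simp
    also have "\<dots> \<le> 1 / 2 * (2 * ?S * ?P\<^sup>2) * (?Q * N)"
      using d order_trans[OF V Q1] s by (intro mult_mono) auto
    also have "\<dots> = ?S * N * (?P\<^sup>2 * ?Q)" by (simp add: algebra_simps)
    finally show ?thesis .
  qed
  ultimately show ?thesis
    unfolding d' norm_power by (rule norm_sum4_le)
qed

text \<open>Boundedness is enough in this case, since \<open>exp (\<i> * k * x)\<close> with
  \<open>x > 0\<close> itself decays in the upper half plane.\<close>

lemma norm_right_numerator_plus_le:
  fixes p q U U' V V' :: complex
  assumes s: "sL > 0" "sR > 0" and N: "N \<ge> 0" and p: "norm p \<le> 1" and q: "norm q \<le> 1"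
    and U: "norm U \<le> N" and U': "norm p * norm U' \<le> N" and V: "norm q * norm V \<le> N" and V': "norm V' \<le> N"
  shows "norm (- (of_real sR * U) + of_real sR * p\<^sup>2 * U'
      + 1 / 2 * ((of_real sL - of_real sR) + p\<^sup>2 * (of_real sL + of_real sR)) * V'
      + 1 / 2 * (- (q\<^sup>2 * (of_real sL - of_real sR)) - p\<^sup>2 * q\<^sup>2 * (of_real sL + of_real sR)) * V)
    \<le> 4 * ((sL + sR) * N)"
proof -
  let ?P = "norm p" and ?Q = "norm q" and ?S = "sL + sR"
  let ?c = "(of_real sL - of_real sR) + p\<^sup>2 * (of_real sL + of_real sR) :: complex"
  have c: "norm ?c \<le> 2 * ?S"
    using norm_interface_coefficient_le(2)[of sL sR 1 "p\<^sup>2"] s p by (auto simp: norm_power power_le_one)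
  have c': "- (q\<^sup>2 * (of_real sL - of_real sR)) - p\<^sup>2 * q\<^sup>2 * (of_real sL + of_real sR) = - (q\<^sup>2 * ?c)"
    by (simp add: algebra_simps)
  have "norm (- (of_real sR * U)) \<le> ?S * N"
  proof -
    have "norm (- (of_real sR * U)) = sR * norm U"
      unfolding norm_minus_cancel norm_mult norm_of_real using s by simp
    also have "\<dots> \<le> ?S * N" using U s by (intro mult_mono) auto
    finally show ?thesis .
  qed
  moreover have "norm (of_real sR * p\<^sup>2 * U') \<le> ?S * N"
  proof -
    have "norm (of_real sR * p\<^sup>2 * U') = sR * ?P * (?P * norm U')"
      unfolding norm_mult norm_power norm_of_real using s by (simp add: power2_eq_square)
    also have "\<dots> \<le> ?S * 1 * N" using U' p s by (intro mult_mono) auto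
    also have "\<dots> = ?S * N" by simp
    finally show ?thesis .
  qed
  moreover have "norm (1 / 2 * ?c * V') \<le> ?S * N"
  proof -
    have "norm (1 / 2 * ?c * V') = 1 / 2 * norm ?c * norm V'"
      unfolding norm_mult by simp
    also have "\<dots> \<le> 1 / 2 * (2 * ?S) * N" using c V' s by (intro mult_mono) auto
    also have "\<dots> = ?S * N" by simp
    finally show ?thesis .
  qed
  moreover have "norm (1 / 2 * - (q\<^sup>2 * ?c) * V) \<le> ?S * N"
  proof -
    have "norm (1 / 2 * - (q\<^sup>2 * ?c) * V) = 1 / 2 * (?Q * norm ?c) * (?Q * norm V)"
      unfolding norm_mult norm_minus_cancel norm_power by (simp add: power2_eq_square)
    also have "\<dots> \<le> 1 / 2 * (1 * (2 * ?S)) * N" using c V q s by (intro mult_mono) auto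
    also have "\<dots> = ?S * N" by simp
    finally show ?thesis .
  qed
  ultimately show ?thesis
    unfolding c' by (rule norm_sum4_le)
qed

section \<open>The interface problem\<close>

lemma fourier_hat_bound_upper:
  assumes v: "v absolutely_integrable_on {lo..hi}" and k: "Im k \<ge> 0"
  shows "norm (fourier_hat lo hi v k) \<le> exp (Im k * hi) * integral {lo..hi} (\<lambda>x. norm (v x))"
  using k by (intro fourier_hat_norm_le[OF v] mult_left_mono) auto

lemma fourier_hat_bound_lower:
  assumes v: "v absolutely_integrable_on {lo..hi}" and k: "Im k \<le> 0"
  shows "norm (fourier_hat lo hi v k) \<le> exp (Im k * lo) * integral {lo..hi} (\<lambda>x. norm (v x))"
  using k by (intro fourier_hat_norm_le[OF v] mult_left_mono_neg) auto

text \<open>\<open>S0\<close> is the bracket for the data, \<open>St\<close> the one for the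
  solution at time \<open>t\<close>, and \<open>Z\<close> the isolated boundary term. The factor
  \<open>e\<close> in front of \<open>St\<close> cancels \<open>inverse e\<close>, so the remainder
  is free of the time exponential. The constant \<open>- 1 / (2 * pi)\<close> combines the 2 of the
  elimination with the \<open>pi\<close> in Delta.\<close>

lemma contour_split:
  fixes e D Z X S0 St :: complex
  assumes "e \<noteq> 0" "\<Delta> = of_real pi * D" "\<Delta> \<noteq> 0" "2 * (S0 - e * St) = - D * Z"
  shows "X * inverse e / \<Delta> * S0 = - 1 / (2 * of_real pi) * (X * inverse e * Z) + X / \<Delta> * St"
proof -
  have D: "D \<noteq> 0" using assms by auto
  have S0: "S0 = e * St - D * Z / 2" using assms(4) by (simp add: field_simps)
  show ?thesis
    unfolding S0 assms(2) using assms(1) D by (simp add: field_simps)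
qed

section \<open>Coupling the global relations of the two layers\<close>

locale heat_interface =
  fixes a b \<sigma>L \<sigma>R :: real
    and \<alpha>1 \<alpha>3 :: complex
    and u0L u0R fL fR :: "real \<Rightarrow> complex"
    and uL uLx uR uRx :: "real \<Rightarrow> real \<Rightarrow> complex"
  assumes pos: "a > 0" "b > 0" "\<sigma>L > 0" "\<sigma>R > 0"
    and \<alpha>: "\<alpha>1 \<noteq> 0" "\<alpha>3 \<noteq> 0"
    and heat_L: "classical_heat_solution \<sigma>L (- a) 0 uL uLx"
    and heat_R: "classical_heat_solution \<sigma>R 0 b uR uRx"
    and initial_L: "\<And>x. - a < x \<Longrightarrow> x < 0 \<Longrightarrow> uL x 0 = u0L x"
    and initial_R: "\<And>x. 0 < x \<Longrightarrow> x < b \<Longrightarrow> uR x 0 = u0R x"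
    and boundary_L: "\<And>t. t > 0 \<Longrightarrow> \<alpha>1 * uL (- a) t = fL t"
    and boundary_R: "\<And>t. t > 0 \<Longrightarrow> \<alpha>3 * uR b t = fR t"
    and interface_value: "\<And>t. t > 0 \<Longrightarrow> uL 0 t = uR 0 t"
    and interface_flux: "\<And>t. t > 0 \<Longrightarrow> of_real (\<sigma>L\<^sup>2) * uLx 0 t = of_real (\<sigma>R\<^sup>2) * uRx 0 t"
begin

abbreviation (input) "K \<equiv> calK a b \<sigma>L \<sigma>R \<alpha>1 \<alpha>3"
abbreviation (input) "M \<equiv> calM a b \<sigma>L \<sigma>R \<alpha>1 \<alpha>3"
abbreviation (input) "UL t \<equiv> (\<lambda>x. uL x t)"
abbreviation (input) "UR t \<equiv> (\<lambda>x. uR x t)"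
abbreviation (input) "sL \<equiv> complex_of_real \<sigma>L"
abbreviation (input) "sR \<equiv> complex_of_real \<sigma>R"

lemma UL_integrable: "t \<ge> 0 \<Longrightarrow> UL t absolutely_integrable_on {- a..0}"
  using heat_L unfolding classical_heat_solution_def by blast

lemma UR_integrable: "t \<ge> 0 \<Longrightarrow> UR t absolutely_integrable_on {0..b}"
  using heat_R unfolding classical_heat_solution_def by blast

lemma Delta_R: "Delta_R a b \<sigma>L \<sigma>R = interface_symbol (a * \<sigma>R / \<sigma>L) b \<sigma>L \<sigma>R"
  using pos by (intro Delta_R_eq) auto

lemma fourier_hat_initial:
  "fourier_hat (- a) 0 (UL 0) = fourier_hat (- a) 0 u0L" "fourier_hat 0 b (UR 0) = fourier_hat 0 b u0R"
  by (rule fourier_hat_cong; use initial_L initial_R in simp)+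

lemma time_hat_data:
  "time_hat fL \<omega> t = \<alpha>1 * time_hat (uL (- a)) \<omega> t" "time_hat fR \<omega> t = \<alpha>3 * time_hat (uR b) \<omega> t"
  "time_hat (uR 0) \<omega> t = time_hat (uL 0) \<omega> t"
  "of_real (\<sigma>R\<^sup>2) * time_hat (uRx 0) \<omega> t = of_real (\<sigma>L\<^sup>2) * time_hat (uLx 0) \<omega> t"
  unfolding time_hat_cmult[symmetric]
  by (rule time_hat_cong; use boundary_L boundary_R interface_value interface_flux in simp)+

text \<open>The frequencies \<open>kL\<close> and \<open>kR\<close> are matched so that both layers
  have the same time frequency \<omega>. Only then do the interface conditions identify the time
  transforms of the two sides and leave one pair \<open>g0\<close>, \<open>G1\<close>.\<close>

lemma global_relations:
  fixes m kL kR \<omega> p q e g0 l0 w0 G1 L1 W1 :: complex and U V :: "complex \<Rightarrow> complex"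
  assumes t: "t > 0" and m: "m = sL * kL" "m = sR * kR"
  defines "\<omega> \<equiv> m\<^sup>2"
  defines "p \<equiv> exp (\<i> * kL * of_real a)" and "q \<equiv> exp (\<i> * kR * of_real b)" and "e \<equiv> exp (\<omega> * of_real t)"
    and "g0 \<equiv> time_hat (uL 0) \<omega> t" and "l0 \<equiv> time_hat (uL (- a)) \<omega> t" and "w0 \<equiv> time_hat (uR b) \<omega> t"
    and "G1 \<equiv> sL\<^sup>2 * time_hat (uLx 0) \<omega> t" and "L1 \<equiv> sL\<^sup>2 * time_hat (uLx (- a)) \<omega> t"
    and "W1 \<equiv> sR\<^sup>2 * time_hat (uRx b) \<omega> t"
    and "U \<equiv> \<lambda>k. fourier_hat (- a) 0 u0L k - e * fourier_hat (- a) 0 (UL t) k"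
    and "V \<equiv> \<lambda>k. fourier_hat 0 b u0R k - e * fourier_hat 0 b (UR t) k"
  shows "U kL = - ((G1 + \<i> * m * sL * g0) - p * (L1 + \<i> * m * sL * l0))"
    and "p * U (- kL) = - (p * (G1 - \<i> * m * sL * g0) - (L1 - \<i> * m * sL * l0))"
    and "q * V kR = - ((W1 + \<i> * m * sR * w0) - q * (G1 + \<i> * m * sR * g0))"
    and "V (- kR) = - (q * (W1 - \<i> * m * sR * w0) - (G1 - \<i> * m * sR * g0))"
proof -
  have left: "U k = - (sL\<^sup>2 * (time_hat (uLx 0) \<omega> t + \<i> * k * g0)
      - exp (\<i> * k * of_real a) * (sL\<^sup>2 * (time_hat (uLx (- a)) \<omega> t + \<i> * k * l0)))" if "(sL * k)\<^sup>2 = \<omega>" for k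
    unfolding U_def e_def g0_def l0_def
    using heat_global_relation[OF heat_L _ t that[symmetric]] pos(1)
    by (simp add: fourier_hat_initial algebra_simps)
  have right: "V k = - (exp (- (\<i> * k * of_real b)) * (sR\<^sup>2 * (time_hat (uRx b) \<omega> t + \<i> * k * w0))
      - (sR\<^sup>2 * time_hat (uRx 0) \<omega> t + sR\<^sup>2 * \<i> * k * g0))" if "(sR * k)\<^sup>2 = \<omega>" for k
    unfolding V_def e_def g0_def w0_def
    using heat_global_relation[OF heat_R _ t that[symmetric]] pos(2)
    by (simp add: fourier_hat_initial time_hat_data(3) algebra_simps)
  have flux: "sR\<^sup>2 * time_hat (uRx 0) \<omega> t = G1"
    unfolding G1_def using time_hat_data(4)[of \<omega> t] by simp
  have \<omega>: "(sL * kL)\<^sup>2 = \<omega>" "(sL * (- kL))\<^sup>2 = \<omega>" "(sR * kR)\<^sup>2 = \<omega>" "(sR * (- kR))\<^sup>2 = \<omega>"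
    using m by (simp_all add: \<omega>_def)
  have mL: "sL\<^sup>2 * (X + \<i> * kL * Y) = sL\<^sup>2 * X + \<i> * m * sL * Y" "sL\<^sup>2 * (X + \<i> * (- kL) * Y) = sL\<^sup>2 * X - \<i> * m * sL * Y" for X Y
    unfolding m(1) by (simp_all add: algebra_simps power2_eq_square)
  have mR: "sR\<^sup>2 * (X + \<i> * kR * Y) = sR\<^sup>2 * X + \<i> * m * sR * Y" "sR\<^sup>2 * (X + \<i> * (- kR) * Y) = sR\<^sup>2 * X - \<i> * m * sR * Y"
    "sR\<^sup>2 * \<i> * kR * Y = \<i> * m * sR * Y" "sR\<^sup>2 * \<i> * (- kR) * Y = - (\<i> * m * sR * Y)" for X Y
    unfolding m(2) by (simp_all add: algebra_simps power2_eq_square)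
  have pq: "exp (\<i> * (- kL) * of_real a) = inverse p" "exp (- (\<i> * kR * of_real b)) = inverse q" "exp (- (\<i> * (- kR) * of_real b)) = q"
    "p \<noteq> 0" "q \<noteq> 0"
    by (simp_all add: p_def q_def exp_minus)
  show "U kL = - ((G1 + \<i> * m * sL * g0) - p * (L1 + \<i> * m * sL * l0))"
    using left[OF \<omega>(1)] unfolding mL p_def[symmetric] G1_def[symmetric] L1_def[symmetric] .
  show "p * U (- kL) = - (p * (G1 - \<i> * m * sL * g0) - (L1 - \<i> * m * sL * l0))"
    using left[OF \<omega>(2)] pq(4) unfolding mL pq(1) G1_def[symmetric] L1_def[symmetric] by (simp add: field_simps)
  show "q * V kR = - ((W1 + \<i> * m * sR * w0) - q * (G1 + \<i> * m * sR * g0))"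
    using right[OF \<omega>(3)] pq(5) unfolding mR pq(2) W1_def[symmetric] flux by (simp add: field_simps)
  show "V (- kR) = - (q * (W1 - \<i> * m * sR * w0) - (G1 - \<i> * m * sR * g0))"
    using right[OF \<omega>(4)] unfolding mR pq(3) W1_def[symmetric] flux by simp
qed

text \<open>The part of the integrands that comes from the solution at time \<open>t\<close>.\<close>

definition remainder_left :: "real \<Rightarrow> real \<Rightarrow> (complex \<Rightarrow> complex) \<Rightarrow> complex \<Rightarrow> complex" where
  "remainder_left x t c k = exp (\<i> * k * of_real x) / Delta_L a b \<sigma>L \<sigma>R k *
    (K (\<lambda>_. 0) (\<lambda>_. 0) (UL t) (UR t) t k + 1 / 2 * c k * fourier_hat (- a) 0 (UL t) k)"

definition remainder_right :: "real \<Rightarrow> real \<Rightarrow> (complex \<Rightarrow> complex) \<Rightarrow> complex \<Rightarrow> complex" where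
  "remainder_right x t c k = exp (\<i> * k * of_real x) / Delta_R a b \<sigma>L \<sigma>R k *
    (M (\<lambda>_. 0) (\<lambda>_. 0) (UL t) (UR t) t k + 1 / 2 * c k * fourier_hat 0 b (UR t) k)"

definition "coeff_left_minus k = - (sL + sR) + (exp (\<i> * k * of_real (b * \<sigma>L / \<sigma>R)))\<^sup>2 * (sL - sR)"
definition "coeff_left_plus k = - ((exp (\<i> * k * of_real a))\<^sup>2 * (sR - sL))
  - (exp (\<i> * k * of_real a))\<^sup>2 * (exp (\<i> * k * of_real (b * \<sigma>L / \<sigma>R)))\<^sup>2 * (sL + sR)"
definition "coeff_right_minus k = - (sL + sR) + (exp (\<i> * k * of_real (a * \<sigma>R / \<sigma>L)))\<^sup>2 * (sR - sL)"
definition "coeff_right_plus k = - ((exp (\<i> * k * of_real b))\<^sup>2 * (sL - sR))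
  - (exp (\<i> * k * of_real (a * \<sigma>R / \<sigma>L)))\<^sup>2 * (exp (\<i> * k * of_real b))\<^sup>2 * (sL + sR)"

text \<open>The two coefficients of the transform at \<open>k\<close> serve the two endpoints:
  \<open>coeff_left_minus\<close> reproduces the boundary term at 0, which decays downwards, and
  \<open>coeff_left_plus\<close> the one at \<open>- a\<close>, which decays upwards. The right
  layer is evaluated at the matched frequency \<open>kR\<close>.\<close>

lemma left_integrand_split:
  assumes t: "t > 0" and k: "Im k \<noteq> 0"
  shows "exp (\<i> * k * of_real x - (sL * k)\<^sup>2 * of_real t) / Delta_L a b \<sigma>L \<sigma>R k *
      (K fL fR u0L u0R t k + 1 / 2 * coeff_left_minus k * fourier_hat (- a) 0 u0L k)
    = - 1 / (2 * of_real pi) * (exp (- \<i> * k * of_real (0 - x)) * boundary_density \<sigma>L uL uLx t 0 k)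
      + remainder_left x t coeff_left_minus k" (is ?minus)
    and "exp (\<i> * k * of_real x - (sL * k)\<^sup>2 * of_real t) / Delta_L a b \<sigma>L \<sigma>R k *
      (K fL fR u0L u0R t k + 1 / 2 * coeff_left_plus k * fourier_hat (- a) 0 u0L k)
    = - 1 / (2 * of_real pi) * (exp (\<i> * k * of_real (x - (- a))) * boundary_density \<sigma>L uL uLx t (- a) k)
      + remainder_left x t coeff_left_plus k" (is ?plus)
proof -
  define kR where "kR = k * sL / sR"
  define m where "m = sL * k"
  have m: "m = sL * k" "m = sR * kR" using pos by (simp_all add: m_def kR_def)
  define \<omega> where "\<omega> = m\<^sup>2"
  define p where "p = exp (\<i> * k * of_real a)"
  define q where "q = exp (\<i> * kR * of_real b)"
  define e where "e = exp (\<omega> * of_real t)"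
  define X where "X = exp (\<i> * k * of_real x)"
  have q: "exp (\<i> * k * of_real (b * \<sigma>L / \<sigma>R)) = q"
    by (simp add: q_def kR_def mult_ac)
  have e: "e \<noteq> 0" "exp (- \<omega> * of_real t) = inverse e" by (simp_all add: e_def exp_minus)
  have E: "exp (\<i> * k * of_real x - (sL * k)\<^sup>2 * of_real t) = X * inverse e"
    unfolding e(2)[symmetric] X_def mult_exp_exp m_def[symmetric] \<omega>_def[symmetric] by simp
  note rel = global_relations[OF t m, folded \<omega>_def p_def q_def, folded e_def]
  have neg: "- k * sL / sR = - kR" by (simp add: kR_def)
  have BD: "boundary_density \<sigma>L uL uLx t y k = inverse e * (sL\<^sup>2 * time_hat (uLx y) \<omega> t + \<i> * m * sL * time_hat (uL y) \<omega> t)" for y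
    unfolding boundary_density_def m_def[symmetric] \<omega>_def[symmetric] e(2)
    by (simp add: m_def algebra_simps power2_eq_square)
  have \<Delta>: "Delta_L a b \<sigma>L \<sigma>R k = of_real pi * (sL * (p\<^sup>2 + 1) * (q\<^sup>2 - 1) + sR * (p\<^sup>2 - 1) * (q\<^sup>2 + 1))"
    unfolding Delta_L_eq interface_symbol_def q p_def ..
  have \<Delta>0: "Delta_L a b \<sigma>L \<sigma>R k \<noteq> 0"
    unfolding Delta_L_eq using pos k by (intro interface_symbol_nonzero) auto
  \<comment> \<open>Linearity in the data: only the differences that occur in the global relations
    remain, together with the time transforms of the prescribed boundary values.\<close>
  have K: "K fL fR u0L u0R t k - e * K (\<lambda>_. 0) (\<lambda>_. 0) (UL t) (UR t) t k
      = - (2 * \<i> * m * sL * sR * p\<^sup>2 * q) * time_hat (uR b) \<omega> t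
        + \<i> * m * sL * p * ((sL + sR) - q\<^sup>2 * (sL - sR)) * time_hat (uL (- a)) \<omega> t
        + 1 / 2 * p\<^sup>2 * ((sL + sR) + q\<^sup>2 * (sR - sL)) * (fourier_hat (- a) 0 u0L (- k) - e * fourier_hat (- a) 0 (UL t) (- k))
        - sL * p\<^sup>2 * q\<^sup>2 * (fourier_hat 0 b u0R kR - e * fourier_hat 0 b (UR t) kR)
        + sL * p\<^sup>2 * (fourier_hat 0 b u0R (- kR) - e * fourier_hat 0 b (UR t) (- kR))"
    unfolding calK_def Let_def p_def[symmetric] q m_def[symmetric] \<omega>_def[symmetric] neg kR_def[symmetric] time_hat_data time_hat_zero
    using \<alpha> by (simp add: m_def power2_eq_square field_simps)
  have split: "2 * (K fL fR u0L u0R t k + 1 / 2 * c * U - e * (K (\<lambda>_. 0) (\<lambda>_. 0) (UL t) (UR t) t k + 1 / 2 * c * Ut))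
      = 2 * ((K fL fR u0L u0R t k - e * K (\<lambda>_. 0) (\<lambda>_. 0) (UL t) (UR t) t k) + 1 / 2 * c * (U - e * Ut))" for c U Ut
    by (simp add: algebra_simps diff_divide_distrib)
  have X0: "exp (- \<i> * k * of_real (0 - x)) = X" "exp (\<i> * k * of_real (x - (- a))) = X * p"
    by (simp_all add: X_def p_def mult_exp_exp algebra_simps)
  show ?minus
    unfolding E X0 BD remainder_left_def X_def[symmetric]
    unfolding mult.assoc[symmetric, of X "inverse e"]
  proof (rule contour_split[OF e(1) \<Delta> \<Delta>0])
    show "2 * (K fL fR u0L u0R t k + 1 / 2 * coeff_left_minus k * fourier_hat (- a) 0 u0L k
        - e * (K (\<lambda>_. 0) (\<lambda>_. 0) (UL t) (UR t) t k + 1 / 2 * coeff_left_minus k * fourier_hat (- a) 0 (UL t) k))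
      = - (sL * (p\<^sup>2 + 1) * (q\<^sup>2 - 1) + sR * (p\<^sup>2 - 1) * (q\<^sup>2 + 1)) *
        (sL\<^sup>2 * time_hat (uLx 0) \<omega> t + \<i> * m * sL * time_hat (uL 0) \<omega> t)"
      unfolding split K coeff_left_minus_def q by (rule interface_elimination_left(1)[OF rel])
  qed
  have XP: "X * p * (inverse e * Z) = X * inverse e * (p * Z)" for Z by simp
  show ?plus
    unfolding E X0 BD remainder_left_def X_def[symmetric] XP
  proof (rule contour_split[OF e(1) \<Delta> \<Delta>0])
    show "2 * (K fL fR u0L u0R t k + 1 / 2 * coeff_left_plus k * fourier_hat (- a) 0 u0L k
        - e * (K (\<lambda>_. 0) (\<lambda>_. 0) (UL t) (UR t) t k + 1 / 2 * coeff_left_plus k * fourier_hat (- a) 0 (UL t) k))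
      = - (sL * (p\<^sup>2 + 1) * (q\<^sup>2 - 1) + sR * (p\<^sup>2 - 1) * (q\<^sup>2 + 1)) *
        (p * (sL\<^sup>2 * time_hat (uLx (- a)) \<omega> t + \<i> * m * sL * time_hat (uL (- a)) \<omega> t))"
      unfolding split K coeff_left_plus_def q p_def[symmetric] by (rule interface_elimination_left(2)[OF rel])
  qed
qed

lemma right_integrand_split:
  assumes t: "t > 0" and k: "Im k \<noteq> 0"
  shows "exp (\<i> * k * of_real x - (sR * k)\<^sup>2 * of_real t) / Delta_R a b \<sigma>L \<sigma>R k *
      (M fL fR u0L u0R t k + 1 / 2 * coeff_right_minus k * fourier_hat 0 b u0R k)
    = - 1 / (2 * of_real pi) * (exp (- \<i> * k * of_real (b - x)) * boundary_density \<sigma>R uR uRx t b k)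
      + remainder_right x t coeff_right_minus k" (is ?minus)
    and "exp (\<i> * k * of_real x - (sR * k)\<^sup>2 * of_real t) / Delta_R a b \<sigma>L \<sigma>R k *
      (M fL fR u0L u0R t k + 1 / 2 * coeff_right_plus k * fourier_hat 0 b u0R k)
    = - 1 / (2 * of_real pi) * (exp (\<i> * k * of_real (x - 0)) * boundary_density \<sigma>R uR uRx t 0 k)
      + remainder_right x t coeff_right_plus k" (is ?plus)
proof -
  define kL where "kL = k * sR / sL"
  define m where "m = sR * k"
  have m: "m = sL * kL" "m = sR * k" using pos by (simp_all add: m_def kL_def)
  define \<omega> where "\<omega> = m\<^sup>2"
  define p where "p = exp (\<i> * kL * of_real a)"
  define q where "q = exp (\<i> * k * of_real b)"
  define e where "e = exp (\<omega> * of_real t)"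
  define X where "X = exp (\<i> * k * of_real x)"
  have p: "exp (\<i> * k * of_real (a * \<sigma>R / \<sigma>L)) = p"
    by (simp add: p_def kL_def mult_ac)
  have e: "e \<noteq> 0" "exp (- \<omega> * of_real t) = inverse e" by (simp_all add: e_def exp_minus)
  have E: "exp (\<i> * k * of_real x - (sR * k)\<^sup>2 * of_real t) = X * inverse e"
    unfolding e(2)[symmetric] X_def mult_exp_exp m_def[symmetric] \<omega>_def[symmetric] by simp
  note rel = global_relations[OF t m, folded \<omega>_def p_def q_def, folded e_def]
  have neg: "- k * sR / sL = - kL" by (simp add: kL_def)
  have BD: "boundary_density \<sigma>R uR uRx t y k = inverse e * (sR\<^sup>2 * time_hat (uRx y) \<omega> t + \<i> * m * sR * time_hat (uR y) \<omega> t)" for y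
    unfolding boundary_density_def m_def[symmetric] \<omega>_def[symmetric] e(2)
    by (simp add: m_def algebra_simps power2_eq_square)
  have flux: "sR\<^sup>2 * time_hat (uRx 0) \<omega> t = sL\<^sup>2 * time_hat (uLx 0) \<omega> t"
    using time_hat_data(4)[of \<omega> t] by simp
  have \<Delta>: "Delta_R a b \<sigma>L \<sigma>R k = of_real pi * (sL * (p\<^sup>2 + 1) * (q\<^sup>2 - 1) + sR * (p\<^sup>2 - 1) * (q\<^sup>2 + 1))"
    unfolding Delta_R interface_symbol_def p q_def ..
  have \<Delta>0: "Delta_R a b \<sigma>L \<sigma>R k \<noteq> 0"
    unfolding Delta_R using pos k by (intro interface_symbol_nonzero) auto
  have K: "M fL fR u0L u0R t k - e * M (\<lambda>_. 0) (\<lambda>_. 0) (UL t) (UR t) t k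
      = 2 * \<i> * m * sL * sR * p * time_hat (uL (- a)) \<omega> t
        - \<i> * m * sR * q * ((sL - sR) + p\<^sup>2 * (sL + sR)) * time_hat (uR b) \<omega> t
        - sR * (fourier_hat (- a) 0 u0L kL - e * fourier_hat (- a) 0 (UL t) kL)
        + sR * p\<^sup>2 * (fourier_hat (- a) 0 u0L (- kL) - e * fourier_hat (- a) 0 (UL t) (- kL))
        + 1 / 2 * ((sL - sR) + p\<^sup>2 * (sL + sR)) * (fourier_hat 0 b u0R (- k) - e * fourier_hat 0 b (UR t) (- k))"
    unfolding calM_def Let_def q_def[symmetric] p m_def[symmetric] \<omega>_def[symmetric] neg kL_def[symmetric] time_hat_data(1,2) time_hat_zero
    using \<alpha> by (simp add: m_def power2_eq_square field_simps)
  have split: "2 * (M fL fR u0L u0R t k + 1 / 2 * c * V - e * (M (\<lambda>_. 0) (\<lambda>_. 0) (UL t) (UR t) t k + 1 / 2 * c * Vt))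
      = 2 * ((M fL fR u0L u0R t k - e * M (\<lambda>_. 0) (\<lambda>_. 0) (UL t) (UR t) t k) + 1 / 2 * c * (V - e * Vt))" for c V Vt
    by (simp add: algebra_simps diff_divide_distrib)
  have q0: "q \<noteq> 0" by (simp add: q_def)
  have X0: "exp (- \<i> * k * of_real (b - x)) = X * inverse q" "exp (\<i> * k * of_real (x - 0)) = X"
    by (simp_all add: X_def q_def mult_exp_exp algebra_simps flip: exp_minus)
  have XQ: "X * inverse q * (inverse e * Z) = X * inverse e * (inverse q * Z)" for Z by simp
  show ?minus
    unfolding E X0 BD remainder_right_def X_def[symmetric] XQ
  proof (rule contour_split[OF e(1) \<Delta> \<Delta>0])
    \<comment> \<open>Divides the elimination identity by \<open>q\<close>; the resulting
      \<open>inverse q\<close> is the factor \<open>exp (- \<i> * k * b)\<close> of the boundary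
      term at \<open>b\<close>.\<close>
    have 2: "2 * S = D * (inverse q * Z)" if "2 * q * S = D * Z" for S D Z
      using that q0 by (simp add: field_simps)
    show "2 * (M fL fR u0L u0R t k + 1 / 2 * coeff_right_minus k * fourier_hat 0 b u0R k
        - e * (M (\<lambda>_. 0) (\<lambda>_. 0) (UL t) (UR t) t k + 1 / 2 * coeff_right_minus k * fourier_hat 0 b (UR t) k))
      = - (sL * (p\<^sup>2 + 1) * (q\<^sup>2 - 1) + sR * (p\<^sup>2 - 1) * (q\<^sup>2 + 1)) *
        (inverse q * (sR\<^sup>2 * time_hat (uRx b) \<omega> t + \<i> * m * sR * time_hat (uR b) \<omega> t))"
      unfolding split K coeff_right_minus_def p by (rule 2[OF interface_elimination_right(1)[OF rel]])
  qed
  show ?plus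
    unfolding E X0 BD remainder_right_def X_def[symmetric] flux time_hat_data(3)
    unfolding mult.assoc[symmetric, of X "inverse e"]
  proof (rule contour_split[OF e(1) \<Delta> \<Delta>0])
    show "2 * (M fL fR u0L u0R t k + 1 / 2 * coeff_right_plus k * fourier_hat 0 b u0R k
        - e * (M (\<lambda>_. 0) (\<lambda>_. 0) (UL t) (UR t) t k + 1 / 2 * coeff_right_plus k * fourier_hat 0 b (UR t) k))
      = - (sL * (p\<^sup>2 + 1) * (q\<^sup>2 - 1) + sR * (p\<^sup>2 - 1) * (q\<^sup>2 + 1)) *
        (sL\<^sup>2 * time_hat (uLx 0) \<omega> t + \<i> * m * sR * time_hat (uL 0) \<omega> t)"
      unfolding split K coeff_right_plus_def p q_def[symmetric] by (rule interface_elimination_right(2)[OF rel])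
  qed
qed

end

section \<open>Holomorphy and decay of the remainders\<close>

lemma interface_symbol_holomorphic: "interface_symbol A B sL sR holomorphic_on S"
  unfolding interface_symbol_def by (intro holomorphic_intros)

text \<open>\<open>w\<close> is the order of growth shared by numerator and denominator: the squared
  exponentials in the lower half plane, 1 in the upper.\<close>

lemma norm_quotient_le:
  fixes X S \<Delta> :: complex
  assumes "norm S \<le> B * w" "c * w \<le> norm \<Delta>" "c > 0" "w > 0"
  shows "norm (X / \<Delta> * S) \<le> B / c * norm X"
proof -
  have cw: "c * w > 0" using assms by simp
  have "norm S / norm \<Delta> \<le> B * w / (c * w)"
    using assms cw order_trans[OF norm_ge_zero assms(1)] by (intro frac_le) auto
  also have "\<dots> = B / c" using assms(4) by simp
  finally have "norm X * (norm S / norm \<Delta>) \<le> norm X * (B / c)" by (intro mult_left_mono) auto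
  then show ?thesis by (simp add: norm_mult norm_divide mult.commute)
qed

context heat_interface
begin

lemma remainder_holomorphic:
  assumes t: "t \<ge> 0" and S: "S \<subseteq> {k. Im k \<noteq> 0}" and c: "c holomorphic_on S"
  shows "remainder_left x t c holomorphic_on S" "remainder_right x t c holomorphic_on S"
proof -
  have "Delta_L a b \<sigma>L \<sigma>R k \<noteq> 0" "Delta_R a b \<sigma>L \<sigma>R k \<noteq> 0" if "k \<in> S" for k
    unfolding Delta_L_eq Delta_R using pos that S by (intro interface_symbol_nonzero; auto)+
  moreover have "Delta_L a b \<sigma>L \<sigma>R holomorphic_on S" "Delta_R a b \<sigma>L \<sigma>R holomorphic_on S"
    unfolding Delta_L_eq Delta_R by (rule interface_symbol_holomorphic)+
  moreover have "(\<lambda>k. K (\<lambda>_. 0) (\<lambda>_. 0) (UL t) (UR t) t k) holomorphic_on S"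
    unfolding calK_def Let_def time_hat_zero using pos t \<alpha>
    by (intro holomorphic_intros fourier_hat_holomorphic UL_integrable UR_integrable) auto
  moreover have "(\<lambda>k. M (\<lambda>_. 0) (\<lambda>_. 0) (UL t) (UR t) t k) holomorphic_on S"
    unfolding calM_def Let_def time_hat_zero using pos t \<alpha>
    by (intro holomorphic_intros fourier_hat_holomorphic UL_integrable UR_integrable) auto
  ultimately show "remainder_left x t c holomorphic_on S" "remainder_right x t c holomorphic_on S"
    unfolding remainder_left_def remainder_right_def
    by (intro holomorphic_intros fourier_hat_holomorphic UL_integrable UR_integrable t c; simp)+
qed

text \<open>A single constant for the transforms of both layers, to serve as \<open>N\<close> in the
  numerator estimates.\<close>

definition "mass t = integral {- a..0} (\<lambda>x. norm (uL x t)) + integral {0..b} (\<lambda>x. norm (uR x t))"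

lemma mass_bounds:
  assumes "t \<ge> 0"
  shows "0 \<le> mass t" "integral {- a..0} (\<lambda>x. norm (uL x t)) \<le> mass t" "integral {0..b} (\<lambda>x. norm (uR x t)) \<le> mass t"
proof -
  have "0 \<le> integral {- a..0} (\<lambda>x. norm (uL x t))" "0 \<le> integral {0..b} (\<lambda>x. norm (uR x t))"
    using UL_integrable[OF assms] UR_integrable[OF assms]
    by (auto intro!: integral_nonneg simp: absolutely_integrable_on_def)
  then show "0 \<le> mass t" "integral {- a..0} (\<lambda>x. norm (uL x t)) \<le> mass t" "integral {0..b} (\<lambda>x. norm (uR x t)) \<le> mass t"
    by (auto simp: mass_def)
qed

lemma transform_bounds:
  assumes t: "t \<ge> 0"
  shows "Im k \<ge> 0 \<Longrightarrow> norm (fourier_hat (- a) 0 (UL t) k) \<le> mass t"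
    "Im k \<le> 0 \<Longrightarrow> norm (fourier_hat (- a) 0 (UL t) k) \<le> exp (- (a * Im k)) * mass t"
    "Im k \<le> 0 \<Longrightarrow> norm (fourier_hat 0 b (UR t) k) \<le> mass t"
    "Im k \<ge> 0 \<Longrightarrow> norm (fourier_hat 0 b (UR t) k) \<le> exp (b * Im k) * mass t"
proof -
  have e: "exp s * I \<le> exp s * mass t"
    if "I = integral {- a..0} (\<lambda>x. norm (uL x t)) \<or> I = integral {0..b} (\<lambda>x. norm (uR x t))" for s I
    using that mass_bounds[OF t] by (intro mult_left_mono) auto
  show "norm (fourier_hat (- a) 0 (UL t) k) \<le> mass t" if "Im k \<ge> 0"
    using order_trans[OF fourier_hat_bound_upper[OF UL_integrable[OF t] that] e] by simp
  show "norm (fourier_hat (- a) 0 (UL t) k) \<le> exp (- (a * Im k)) * mass t" if "Im k \<le> 0"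
    using order_trans[OF fourier_hat_bound_lower[OF UL_integrable[OF t] that] e] by (simp add: mult.commute)
  show "norm (fourier_hat 0 b (UR t) k) \<le> mass t" if "Im k \<le> 0"
    using order_trans[OF fourier_hat_bound_lower[OF UR_integrable[OF t] that] e] by simp
  show "norm (fourier_hat 0 b (UR t) k) \<le> exp (b * Im k) * mass t" if "Im k \<ge> 0"
    using order_trans[OF fourier_hat_bound_upper[OF UR_integrable[OF t] that] e] by (simp add: mult.commute)
qed

text \<open>Numerator and denominator have the same order, so the modulus of
  \<open>exp (\<i> * k * x)\<close> remains; it decays downwards for \<open>x < 0\<close>.\<close>

lemma remainder_left_minus_bound:
  assumes t: "t \<ge> 0" and \<eta>: "\<eta> > 0"
  obtains C where "\<And>k. Im k \<le> - \<eta> \<Longrightarrow> norm (remainder_left x t coeff_left_minus k) \<le> C * exp (- x * Im k)"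
proof -
  obtain c where c: "c > 0" "\<And>k. Im k \<le> - \<eta> \<Longrightarrow>
      c * norm ((exp (\<i> * k * of_real a))\<^sup>2 * (exp (\<i> * k * of_real (b * \<sigma>L / \<sigma>R)))\<^sup>2) \<le> norm (Delta_L a b \<sigma>L \<sigma>R k)"
    using interface_symbol_bound_lower[of a "b * \<sigma>L / \<sigma>R" \<sigma>L \<sigma>R \<eta>] pos \<eta> unfolding Delta_L_eq by auto
  show ?thesis
  proof
    fix k assume k: "Im k \<le> - \<eta>"
    define kR where "kR = k * sL / sR"
    define p where "p = exp (\<i> * k * of_real a)"
    define q where "q = exp (\<i> * k * of_real (b * \<sigma>L / \<sigma>R))"
    have neg: "Im k < 0" using k \<eta> by linarith
    have ImR: "Im kR = Im k * \<sigma>L / \<sigma>R" unfolding kR_def by (simp flip: of_real_divide)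
    then have negR: "Im kR < 0" using neg pos by (simp add: divide_neg_pos mult_neg_pos)
    have np: "norm p = exp (- (a * Im k))" unfolding p_def norm_exp_ik ..
    have nq: "norm q = exp (- (b * Im kR))" unfolding q_def norm_exp_ik ImR by simp
    have p1: "norm p \<ge> 1" and q1: "norm q \<ge> 1"
      unfolding np nq using pos neg negR by (auto intro: mult_nonneg_nonpos)
    have K: "K (\<lambda>_. 0) (\<lambda>_. 0) (UL t) (UR t) t k + 1 / 2 * coeff_left_minus k * fourier_hat (- a) 0 (UL t) k
      = 1 / 2 * p\<^sup>2 * ((sL + sR) + q\<^sup>2 * (sR - sL)) * fourier_hat (- a) 0 (UL t) (- k)
      - sL * p\<^sup>2 * q\<^sup>2 * fourier_hat 0 b (UR t) kR + sL * p\<^sup>2 * fourier_hat 0 b (UR t) (- kR)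
      + 1 / 2 * (- (sL + sR) + q\<^sup>2 * (sL - sR)) * fourier_hat (- a) 0 (UL t) k"
      unfolding calK_def Let_def time_hat_zero coeff_left_minus_def by (simp add: p_def q_def kR_def)
    have "norm (remainder_left x t coeff_left_minus k) \<le> 4 * ((\<sigma>L + \<sigma>R) * mass t) / c * norm (exp (\<i> * k * of_real x))"
      unfolding remainder_left_def K
    proof (rule norm_quotient_le)
      show "c * norm (p\<^sup>2 * q\<^sup>2) \<le> norm (Delta_L a b \<sigma>L \<sigma>R k)"
        using c(2)[OF k] unfolding p_def q_def .
      show "norm (1 / 2 * p\<^sup>2 * ((sL + sR) + q\<^sup>2 * (sR - sL)) * fourier_hat (- a) 0 (UL t) (- k)
        - sL * p\<^sup>2 * q\<^sup>2 * fourier_hat 0 b (UR t) kR + sL * p\<^sup>2 * fourier_hat 0 b (UR t) (- kR)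
        + 1 / 2 * (- (sL + sR) + q\<^sup>2 * (sL - sR)) * fourier_hat (- a) 0 (UL t) k)
        \<le> 4 * ((\<sigma>L + \<sigma>R) * mass t) * norm (p\<^sup>2 * q\<^sup>2)"
        unfolding mult.assoc[of 4]
      proof (rule norm_left_numerator_minus_le[OF pos(3,4) mass_bounds(1)[OF t] p1 q1])
        show "norm (fourier_hat (- a) 0 (UL t) k) \<le> norm p * mass t"
          using transform_bounds(2)[OF t, of k] neg unfolding np by simp
        show "norm (fourier_hat (- a) 0 (UL t) (- k)) \<le> mass t"
          using transform_bounds(1)[OF t, of "- k"] neg by simp
        show "norm (fourier_hat 0 b (UR t) kR) \<le> mass t"
          using transform_bounds(3)[OF t, of kR] negR by simp
        show "norm (fourier_hat 0 b (UR t) (- kR)) \<le> norm q * mass t"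
          using transform_bounds(4)[OF t, of "- kR"] negR unfolding nq by simp
      qed
    qed (use c(1) in \<open>simp_all add: p_def q_def\<close>)
    then show "norm (remainder_left x t coeff_left_minus k) \<le> 4 * ((\<sigma>L + \<sigma>R) * mass t) / c * exp (- x * Im k)"
      unfolding norm_exp_ik by simp
  qed
qed

text \<open>The denominator is bounded away from 0 and the numerator keeps a factor
  \<open>p\<close>, which shifts the exponent from \<open>x\<close> to the distance
  \<open>x + a\<close> from the left end.\<close>

lemma remainder_left_plus_bound:
  assumes t: "t \<ge> 0" and \<eta>: "\<eta> > 0"
  obtains C where "\<And>k. Im k \<ge> \<eta> \<Longrightarrow> norm (remainder_left x t coeff_left_plus k) \<le> C * exp (- ((x + a) * Im k))"
proof -
  obtain c where c: "c > 0" "\<And>k. Im k \<ge> \<eta> \<Longrightarrow> c \<le> norm (Delta_L a b \<sigma>L \<sigma>R k)"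
    using interface_symbol_bound_upper[of a "b * \<sigma>L / \<sigma>R" \<sigma>L \<sigma>R \<eta>] pos \<eta> unfolding Delta_L_eq by auto
  show ?thesis
  proof
    fix k assume k: "Im k \<ge> \<eta>"
    define kR where "kR = k * sL / sR"
    define p where "p = exp (\<i> * k * of_real a)"
    define q where "q = exp (\<i> * k * of_real (b * \<sigma>L / \<sigma>R))"
    have pos': "Im k > 0" using k \<eta> by linarith
    have ImR: "Im kR = Im k * \<sigma>L / \<sigma>R" unfolding kR_def by (simp flip: of_real_divide)
    then have posR: "Im kR > 0" using pos' pos by simp
    have np: "norm p = exp (- (a * Im k))" unfolding p_def norm_exp_ik ..
    have nq: "norm q = exp (- (b * Im kR))" unfolding q_def norm_exp_ik ImR by simp
    have p1: "norm p \<le> 1" and q1: "norm q \<le> 1"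
      unfolding np nq using pos pos' posR by auto
    have K: "K (\<lambda>_. 0) (\<lambda>_. 0) (UL t) (UR t) t k + 1 / 2 * coeff_left_plus k * fourier_hat (- a) 0 (UL t) k
      = 1 / 2 * p\<^sup>2 * ((sL + sR) + q\<^sup>2 * (sR - sL)) * fourier_hat (- a) 0 (UL t) (- k)
      - sL * p\<^sup>2 * q\<^sup>2 * fourier_hat 0 b (UR t) kR + sL * p\<^sup>2 * fourier_hat 0 b (UR t) (- kR)
      + 1 / 2 * (- (p\<^sup>2 * (sR - sL)) - p\<^sup>2 * q\<^sup>2 * (sL + sR)) * fourier_hat (- a) 0 (UL t) k"
      unfolding calK_def Let_def time_hat_zero coeff_left_plus_def by (simp add: p_def q_def kR_def)
    have "norm (remainder_left x t coeff_left_plus k) \<le> 4 * ((\<sigma>L + \<sigma>R) * mass t * norm p) / c * norm (exp (\<i> * k * of_real x))"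
      unfolding remainder_left_def K
    proof (rule norm_quotient_le)
      show "c * 1 \<le> norm (Delta_L a b \<sigma>L \<sigma>R k)" using c(2)[OF k] by simp
      show "norm (1 / 2 * p\<^sup>2 * ((sL + sR) + q\<^sup>2 * (sR - sL)) * fourier_hat (- a) 0 (UL t) (- k)
        - sL * p\<^sup>2 * q\<^sup>2 * fourier_hat 0 b (UR t) kR + sL * p\<^sup>2 * fourier_hat 0 b (UR t) (- kR)
        + 1 / 2 * (- (p\<^sup>2 * (sR - sL)) - p\<^sup>2 * q\<^sup>2 * (sL + sR)) * fourier_hat (- a) 0 (UL t) k)
        \<le> 4 * ((\<sigma>L + \<sigma>R) * mass t * norm p) * 1"
        unfolding mult_1_right
      proof (rule norm_left_numerator_plus_le[OF pos(3,4) mass_bounds(1)[OF t] p1 q1])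
        show "norm (fourier_hat (- a) 0 (UL t) k) \<le> mass t"
          using transform_bounds(1)[OF t, of k] pos' by simp
        show "norm p * norm (fourier_hat (- a) 0 (UL t) (- k)) \<le> mass t"
          using mult_left_mono[OF transform_bounds(2)[OF t, of "- k"], of "norm p"] pos'
          unfolding np by (simp add: mult_exp_exp flip: mult.assoc)
        show "norm q * norm (fourier_hat 0 b (UR t) kR) \<le> mass t"
          using mult_left_mono[OF transform_bounds(4)[OF t, of kR], of "norm q"] posR
          unfolding nq by (simp add: mult_exp_exp flip: mult.assoc)
        show "norm (fourier_hat 0 b (UR t) (- kR)) \<le> mass t"
          using transform_bounds(3)[OF t, of "- kR"] posR by simp
      qed
    qed (use c(1) in simp_all)
    also have "\<dots> = 4 * ((\<sigma>L + \<sigma>R) * mass t) / c * (norm p * norm (exp (\<i> * k * of_real x)))"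
      by simp
    also have "norm p * norm (exp (\<i> * k * of_real x)) = exp (- ((x + a) * Im k))"
      unfolding norm_exp_ik np mult_exp_exp by (simp add: algebra_simps)
    finally show "norm (remainder_left x t coeff_left_plus k) \<le> 4 * ((\<sigma>L + \<sigma>R) * mass t) / c * exp (- ((x + a) * Im k))" .
  qed
qed

text \<open>The power of \<open>q\<close> that the numerator lacks against the denominator shifts
  the exponent to the distance \<open>b - x\<close> from the right end.\<close>

lemma remainder_right_minus_bound:
  assumes t: "t \<ge> 0" and \<eta>: "\<eta> > 0"
  obtains C where "\<And>k. Im k \<le> - \<eta> \<Longrightarrow> norm (remainder_right x t coeff_right_minus k) \<le> C * exp ((b - x) * Im k)"
proof -
  obtain c where c: "c > 0" "\<And>k. Im k \<le> - \<eta> \<Longrightarrow>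
      c * norm ((exp (\<i> * k * of_real (a * \<sigma>R / \<sigma>L)))\<^sup>2 * (exp (\<i> * k * of_real b))\<^sup>2) \<le> norm (Delta_R a b \<sigma>L \<sigma>R k)"
    using interface_symbol_bound_lower[of "a * \<sigma>R / \<sigma>L" b \<sigma>L \<sigma>R \<eta>] pos \<eta> unfolding Delta_R by auto
  show ?thesis
  proof
    fix k assume k: "Im k \<le> - \<eta>"
    define kL where "kL = k * sR / sL"
    define p where "p = exp (\<i> * k * of_real (a * \<sigma>R / \<sigma>L))"
    define q where "q = exp (\<i> * k * of_real b)"
    have neg: "Im k < 0" using k \<eta> by linarith
    have ImL: "Im kL = Im k * \<sigma>R / \<sigma>L" unfolding kL_def by (simp flip: of_real_divide)
    then have negL: "Im kL < 0" using neg pos by (simp add: divide_neg_pos mult_neg_pos)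
    have np: "norm p = exp (- (a * Im kL))" unfolding p_def norm_exp_ik ImL by simp
    have nq: "norm q = exp (- (b * Im k))" unfolding q_def norm_exp_ik ..
    have p1: "norm p \<ge> 1" and q1: "norm q \<ge> 1"
      unfolding np nq using pos neg negL by (auto intro: mult_nonneg_nonpos)
    have q0: "norm q > 0" using q1 by linarith
    have M: "M (\<lambda>_. 0) (\<lambda>_. 0) (UL t) (UR t) t k + 1 / 2 * coeff_right_minus k * fourier_hat 0 b (UR t) k
      = - (sR * fourier_hat (- a) 0 (UL t) kL) + sR * p\<^sup>2 * fourier_hat (- a) 0 (UL t) (- kL)
      + 1 / 2 * ((sL - sR) + p\<^sup>2 * (sL + sR)) * fourier_hat 0 b (UR t) (- k)
      + 1 / 2 * (- (sL + sR) + p\<^sup>2 * (sR - sL)) * fourier_hat 0 b (UR t) k"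
      unfolding calM_def Let_def time_hat_zero coeff_right_minus_def by (simp add: p_def q_def kL_def)
    have "norm (remainder_right x t coeff_right_minus k) \<le> 4 * ((\<sigma>L + \<sigma>R) * mass t / norm q) / c * norm (exp (\<i> * k * of_real x))"
      unfolding remainder_right_def M
    proof (rule norm_quotient_le)
      show "c * norm (p\<^sup>2 * q\<^sup>2) \<le> norm (Delta_R a b \<sigma>L \<sigma>R k)"
        using c(2)[OF k] unfolding p_def q_def .
      have w: "4 * ((\<sigma>L + \<sigma>R) * mass t / norm q) * norm (p\<^sup>2 * q\<^sup>2) = 4 * ((\<sigma>L + \<sigma>R) * mass t * (norm (p\<^sup>2) * norm q))"
        using q0 by (simp add: norm_mult norm_power power2_eq_square)
      show "norm (- (sR * fourier_hat (- a) 0 (UL t) kL) + sR * p\<^sup>2 * fourier_hat (- a) 0 (UL t) (- kL)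
        + 1 / 2 * ((sL - sR) + p\<^sup>2 * (sL + sR)) * fourier_hat 0 b (UR t) (- k)
        + 1 / 2 * (- (sL + sR) + p\<^sup>2 * (sR - sL)) * fourier_hat 0 b (UR t) k)
        \<le> 4 * ((\<sigma>L + \<sigma>R) * mass t / norm q) * norm (p\<^sup>2 * q\<^sup>2)"
        unfolding w
      proof (rule norm_right_numerator_minus_le[OF pos(3,4) mass_bounds(1)[OF t] p1 q1])
        show "norm (fourier_hat (- a) 0 (UL t) kL) \<le> norm p * mass t"
          using transform_bounds(2)[OF t, of kL] negL unfolding np by simp
        show "norm (fourier_hat (- a) 0 (UL t) (- kL)) \<le> mass t"
          using transform_bounds(1)[OF t, of "- kL"] negL by simp
        show "norm (fourier_hat 0 b (UR t) k) \<le> mass t"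
          using transform_bounds(3)[OF t, of k] neg by simp
        show "norm (fourier_hat 0 b (UR t) (- k)) \<le> norm q * mass t"
          using transform_bounds(4)[OF t, of "- k"] neg unfolding nq by simp
      qed
    qed (use c(1) in \<open>simp_all add: p_def q_def\<close>)
    also have "\<dots> = 4 * ((\<sigma>L + \<sigma>R) * mass t) / c * (inverse (norm q) * norm (exp (\<i> * k * of_real x)))"
      by (simp add: divide_inverse)
    also have "inverse (norm q) * norm (exp (\<i> * k * of_real x)) = exp ((b - x) * Im k)"
      unfolding norm_exp_ik nq exp_minus[symmetric] mult_exp_exp by (simp add: algebra_simps)
    finally show "norm (remainder_right x t coeff_right_minus k) \<le> 4 * ((\<sigma>L + \<sigma>R) * mass t) / c * exp ((b - x) * Im k)" .
  qed
qed

text \<open>A bounded numerator over a denominator bounded away from 0 leaves the modulus of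
  \<open>exp (\<i> * k * x)\<close>, with rate the distance from the interface.\<close>

lemma remainder_right_plus_bound:
  assumes t: "t \<ge> 0" and \<eta>: "\<eta> > 0"
  obtains C where "\<And>k. Im k \<ge> \<eta> \<Longrightarrow> norm (remainder_right x t coeff_right_plus k) \<le> C * exp (- (x * Im k))"
proof -
  obtain c where c: "c > 0" "\<And>k. Im k \<ge> \<eta> \<Longrightarrow> c \<le> norm (Delta_R a b \<sigma>L \<sigma>R k)"
    using interface_symbol_bound_upper[of "a * \<sigma>R / \<sigma>L" b \<sigma>L \<sigma>R \<eta>] pos \<eta> unfolding Delta_R by auto
  show ?thesis
  proof
    fix k assume k: "Im k \<ge> \<eta>"
    define kL where "kL = k * sR / sL"
    define p where "p = exp (\<i> * k * of_real (a * \<sigma>R / \<sigma>L))"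
    define q where "q = exp (\<i> * k * of_real b)"
    have pos': "Im k > 0" using k \<eta> by linarith
    have ImL: "Im kL = Im k * \<sigma>R / \<sigma>L" unfolding kL_def by (simp flip: of_real_divide)
    then have posL: "Im kL > 0" using pos' pos by simp
    have np: "norm p = exp (- (a * Im kL))" unfolding p_def norm_exp_ik ImL by simp
    have nq: "norm q = exp (- (b * Im k))" unfolding q_def norm_exp_ik ..
    have p1: "norm p \<le> 1" and q1: "norm q \<le> 1"
      unfolding np nq using pos pos' posL by auto
    have M: "M (\<lambda>_. 0) (\<lambda>_. 0) (UL t) (UR t) t k + 1 / 2 * coeff_right_plus k * fourier_hat 0 b (UR t) k
      = - (sR * fourier_hat (- a) 0 (UL t) kL) + sR * p\<^sup>2 * fourier_hat (- a) 0 (UL t) (- kL)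
      + 1 / 2 * ((sL - sR) + p\<^sup>2 * (sL + sR)) * fourier_hat 0 b (UR t) (- k)
      + 1 / 2 * (- (q\<^sup>2 * (sL - sR)) - p\<^sup>2 * q\<^sup>2 * (sL + sR)) * fourier_hat 0 b (UR t) k"
      unfolding calM_def Let_def time_hat_zero coeff_right_plus_def by (simp add: p_def q_def kL_def)
    have "norm (remainder_right x t coeff_right_plus k) \<le> 4 * ((\<sigma>L + \<sigma>R) * mass t) / c * norm (exp (\<i> * k * of_real x))"
      unfolding remainder_right_def M
    proof (rule norm_quotient_le)
      show "c * 1 \<le> norm (Delta_R a b \<sigma>L \<sigma>R k)" using c(2)[OF k] by simp
      show "norm (- (sR * fourier_hat (- a) 0 (UL t) kL) + sR * p\<^sup>2 * fourier_hat (- a) 0 (UL t) (- kL)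
        + 1 / 2 * ((sL - sR) + p\<^sup>2 * (sL + sR)) * fourier_hat 0 b (UR t) (- k)
        + 1 / 2 * (- (q\<^sup>2 * (sL - sR)) - p\<^sup>2 * q\<^sup>2 * (sL + sR)) * fourier_hat 0 b (UR t) k)
        \<le> 4 * ((\<sigma>L + \<sigma>R) * mass t) * 1"
        unfolding mult_1_right
      proof (rule norm_right_numerator_plus_le[OF pos(3,4) mass_bounds(1)[OF t] p1 q1])
        show "norm (fourier_hat (- a) 0 (UL t) kL) \<le> mass t"
          using transform_bounds(1)[OF t, of kL] posL by simp
        show "norm p * norm (fourier_hat (- a) 0 (UL t) (- kL)) \<le> mass t"
          using mult_left_mono[OF transform_bounds(2)[OF t, of "- kL"], of "norm p"] posL
          unfolding np by (simp add: mult_exp_exp flip: mult.assoc)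
        show "norm q * norm (fourier_hat 0 b (UR t) k) \<le> mass t"
          using mult_left_mono[OF transform_bounds(4)[OF t, of k], of "norm q"] pos'
          unfolding nq by (simp add: mult_exp_exp flip: mult.assoc)
        show "norm (fourier_hat 0 b (UR t) (- k)) \<le> mass t"
          using transform_bounds(3)[OF t, of "- k"] pos' by simp
      qed
    qed (use c(1) in simp_all)
    then show "norm (remainder_right x t coeff_right_plus k) \<le> 4 * ((\<sigma>L + \<sigma>R) * mass t) / c * exp (- (x * Im k))"
      unfolding norm_exp_ik .
  qed
qed

section \<open>The contour formulas of both layers\<close>

lemma coefficient_holomorphic:
  "coeff_left_minus holomorphic_on S" "coeff_left_plus holomorphic_on S" "coeff_right_minus holomorphic_on S" "coeff_right_plus holomorphic_on S"
  unfolding coeff_left_minus_def[abs_def] coeff_left_plus_def[abs_def] coeff_right_minus_def[abs_def] coeff_right_plus_def[abs_def] by (intro holomorphic_intros)+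

theorem left_contour_formula:
  fixes x t r :: real
  assumes x: "- a < x" "x < 0" and t: "t > 0" and r: "r > 0"
  defines "E \<equiv> \<lambda>k. exp (\<i> * k * of_real x - (sL * k)\<^sup>2 * of_real t)"
  defines "G \<equiv> \<lambda>k::real. E (of_real k) * fourier_hat (- a) 0 u0L (of_real k)"
    and "gm \<equiv> \<lambda>k. E k / Delta_L a b \<sigma>L \<sigma>R k * (K fL fR u0L u0R t k + 1 / 2 * coeff_left_minus k * fourier_hat (- a) 0 u0L k)"
    and "gp \<equiv> \<lambda>k. E k / Delta_L a b \<sigma>L \<sigma>R k * (K fL fR u0L u0R t k + 1 / 2 * coeff_left_plus k * fourier_hat (- a) 0 u0L k)"
  shows "G absolutely_integrable_on UNIV \<and> D0_minus_integrable r gm \<and> D0_plus_integrable r gp \<and>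
    uL x t = 1 / (2 * of_real pi) * integral UNIV G + D0_minus_integral r gm + D0_plus_integral r gp"
proof -
  have t0: "t \<ge> 0" and r2: "r / 2 > 0" using t r by auto
  obtain Cm where Cm: "\<And>k. Im k \<le> - (r / 2) \<Longrightarrow> norm (remainder_left x t coeff_left_minus k) \<le> Cm * exp (- x * Im k)"
    using remainder_left_minus_bound[OF t0 r2] by blast
  obtain Cp where Cp: "\<And>k. Im k \<ge> r / 2 \<Longrightarrow> norm (remainder_left x t coeff_left_plus k) \<le> Cp * exp (- ((x + a) * Im k))"
    using remainder_left_plus_bound[OF t0 r2] by blast
  show ?thesis
    unfolding G_def gm_def gp_def E_def
  \<comment> \<open>The decay rates are \<open>dm = - x\<close> and \<open>dp = x + a\<close>, the
    distances from \<open>x\<close> to the two ends of the left layer.\<close>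
  proof (rule heat_contour_formula[OF heat_L initial_L x t pos(3) r
        left_integrand_split(1)[OF t] left_integrand_split(2)[OF t] _ _ Cm _ _ Cp])
    show "remainder_left x t coeff_left_minus holomorphic_on {k. Im k < 0}" "remainder_left x t coeff_left_plus holomorphic_on {k. Im k > 0}"
      by (rule remainder_holomorphic(1)[OF t0 _ coefficient_holomorphic(1)] remainder_holomorphic(1)[OF t0 _ coefficient_holomorphic(2)]; auto)+
  qed (use x in auto)
qed

theorem right_contour_formula:
  fixes x t r :: real
  assumes x: "0 < x" "x < b" and t: "t > 0" and r: "r > 0"
  defines "E \<equiv> \<lambda>k. exp (\<i> * k * of_real x - (sR * k)\<^sup>2 * of_real t)"
  defines "G \<equiv> \<lambda>k::real. E (of_real k) * fourier_hat 0 b u0R (of_real k)"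
    and "gm \<equiv> \<lambda>k. E k / Delta_R a b \<sigma>L \<sigma>R k * (M fL fR u0L u0R t k + 1 / 2 * coeff_right_minus k * fourier_hat 0 b u0R k)"
    and "gp \<equiv> \<lambda>k. E k / Delta_R a b \<sigma>L \<sigma>R k * (M fL fR u0L u0R t k + 1 / 2 * coeff_right_plus k * fourier_hat 0 b u0R k)"
  shows "G absolutely_integrable_on UNIV \<and> D0_minus_integrable r gm \<and> D0_plus_integrable r gp \<and>
    uR x t = 1 / (2 * of_real pi) * integral UNIV G + D0_minus_integral r gm + D0_plus_integral r gp"
proof -
  have t0: "t \<ge> 0" and r2: "r / 2 > 0" using t r by auto
  obtain Cm where Cm: "\<And>k. Im k \<le> - (r / 2) \<Longrightarrow> norm (remainder_right x t coeff_right_minus k) \<le> Cm * exp ((b - x) * Im k)"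
    using remainder_right_minus_bound[OF t0 r2] by blast
  obtain Cp where Cp: "\<And>k. Im k \<ge> r / 2 \<Longrightarrow> norm (remainder_right x t coeff_right_plus k) \<le> Cp * exp (- (x * Im k))"
    using remainder_right_plus_bound[OF t0 r2] by blast
  show ?thesis
    unfolding G_def gm_def gp_def E_def
  \<comment> \<open>Here the rates are \<open>dm = b - x\<close> and \<open>dp = x\<close>.\<close>
  proof (rule heat_contour_formula[OF heat_R initial_R x t pos(4) r
        right_integrand_split(1)[OF t] right_integrand_split(2)[OF t] _ _ Cm _ _ Cp])
    show "remainder_right x t coeff_right_minus holomorphic_on {k. Im k < 0}" "remainder_right x t coeff_right_plus holomorphic_on {k. Im k > 0}"
      by (rule remainder_holomorphic(2)[OF t0 _ coefficient_holomorphic(3)] remainder_holomorphic(2)[OF t0 _ coefficient_holomorphic(4)]; auto)+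
  qed (use x in auto)
qed

end

theorem proposition2:
  fixes a b \<sigma>L \<sigma>R r :: real
    and \<alpha>1 \<alpha>3 :: complex
    and u0L u0R fL fR :: "real \<Rightarrow> complex"
    and uL uLx uR uRx :: "real \<Rightarrow> real \<Rightarrow> complex"
  assumes "a > 0" "b > 0" "\<sigma>L > 0" "\<sigma>R > 0" "r > 0"
    and "\<alpha>1 \<noteq> 0" "\<alpha>3 \<noteq> 0"
    and u0L_integrable: "u0L absolutely_integrable_on {- a..0}"
    and u0R_integrable: "u0R absolutely_integrable_on {0..b}"
    and heat_L: "classical_heat_solution \<sigma>L (- a) 0 uL uLx"
    and heat_R: "classical_heat_solution \<sigma>R 0 b uR uRx"
    and initial_L: "\<And>x. - a < x \<Longrightarrow> x < 0 \<Longrightarrow> uL x 0 = u0L x"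
    and initial_R: "\<And>x. 0 < x \<Longrightarrow> x < b \<Longrightarrow> uR x 0 = u0R x"
    and boundary_L: "\<And>t. t > 0 \<Longrightarrow> \<alpha>1 * uL (- a) t = fL t"
    and boundary_R: "\<And>t. t > 0 \<Longrightarrow> \<alpha>3 * uR b t = fR t"
    and interface_value: "\<And>t. t > 0 \<Longrightarrow> uL 0 t = uR 0 t"
    and interface_flux:
      "\<And>t. t > 0 \<Longrightarrow> of_real (\<sigma>L\<^sup>2) * uLx 0 t = of_real (\<sigma>R\<^sup>2) * uRx 0 t"
  shows
    "(\<forall>x t. - a < x \<and> x < 0 \<and> t > 0 \<longrightarrow>
      (let sL = complex_of_real \<sigma>L;
           sR = complex_of_real \<sigma>R;
           p = (\<lambda>k. exp (\<i> * k * of_real a));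
           q = (\<lambda>k. exp (\<i> * k * of_real (b * \<sigma>L / \<sigma>R)));
           E = (\<lambda>k. exp (\<i> * k * of_real x - (sL * k)\<^sup>2 * of_real t));
           K = calK a b \<sigma>L \<sigma>R \<alpha>1 \<alpha>3 fL fR u0L u0R t;
           U = fourier_hat (- a) 0 u0L;
           G = (\<lambda>k::real. E (of_real k) * U (of_real k));
           Gminus = (\<lambda>k. E k / Delta_L a b \<sigma>L \<sigma>R k *
             (K k + 1 / 2 * (- (sL + sR) + (q k)\<^sup>2 * (sL - sR)) * U k));
           Gplus = (\<lambda>k. E k / Delta_L a b \<sigma>L \<sigma>R k *
             (K k + 1 / 2 * (- ((p k)\<^sup>2 * (sR - sL)) - (p k)\<^sup>2 * (q k)\<^sup>2 * (sL + sR)) * U k))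
       in G absolutely_integrable_on UNIV \<and>
          D0_minus_integrable r Gminus \<and>
          D0_plus_integrable r Gplus \<and>
          uL x t = 1 / (2 * of_real pi) * integral UNIV G
            + D0_minus_integral r Gminus + D0_plus_integral r Gplus)) \<and>
     (\<forall>x t. 0 < x \<and> x < b \<and> t > 0 \<longrightarrow>
      (let sL = complex_of_real \<sigma>L;
           sR = complex_of_real \<sigma>R;
           P = (\<lambda>k. exp (\<i> * k * of_real (a * \<sigma>R / \<sigma>L)));
           Q = (\<lambda>k. exp (\<i> * k * of_real b));
           F = (\<lambda>k. exp (\<i> * k * of_real x - (sR * k)\<^sup>2 * of_real t));
           M = calM a b \<sigma>L \<sigma>R \<alpha>1 \<alpha>3 fL fR u0L u0R t;
           U = fourier_hat 0 b u0R;
           G = (\<lambda>k::real. F (of_real k) * U (of_real k));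
           Gminus = (\<lambda>k. F k / Delta_R a b \<sigma>L \<sigma>R k *
             (M k + 1 / 2 * (- (sL + sR) + (P k)\<^sup>2 * (sR - sL)) * U k));
           Gplus = (\<lambda>k. F k / Delta_R a b \<sigma>L \<sigma>R k *
             (M k + 1 / 2 * (- ((Q k)\<^sup>2 * (sL - sR)) - (P k)\<^sup>2 * (Q k)\<^sup>2 * (sL + sR)) * U k))
       in G absolutely_integrable_on UNIV \<and>
          D0_minus_integrable r Gminus \<and>
          D0_plus_integrable r Gplus \<and>
          uR x t = 1 / (2 * of_real pi) * integral UNIV G
            + D0_minus_integral r Gminus + D0_plus_integral r Gplus))"
proof -
  interpret heat_interface a b \<sigma>L \<sigma>R \<alpha>1 \<alpha>3 u0L u0R fL fR uL uLx uR uRx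
    by (rule heat_interface.intro) (fact assms)+
  show ?thesis
    unfolding Let_def
    using left_contour_formula[OF _ _ _ \<open>r > 0\<close>, unfolded coeff_left_minus_def coeff_left_plus_def]
      right_contour_formula[OF _ _ _ \<open>r > 0\<close>, unfolded coeff_right_minus_def coeff_right_plus_def]
    by blast
qed

end
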